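(* Let $\boldsymbol{p}=(p_1,p_2,\ldots)$ be a sequence with $p_j\in(0,1)$ for all $j\ge 1$ such that the limit $\delta=\lim_{k\to\infty}\sum_{j=1}^k(2p_j-1)$ exists and is finite. Let $\{X_n\}_{n\ge 0}$ be the excited random walk on $\mathbb{Z}$ in the cookie environment $\boldsymbol{p}$ (the same deterministic cookie stack $\boldsymbol{p}$ at every site). Then: (1) If $\delta>1$, then $P\left(\lim_{n\to\infty}X_n=+\infty\right)=1$. (2) If $\delta<-1$, then $P\left(\lim_{n\to\infty}X_n=-\infty\right)=1$. (3) If $|\delta|<1$, then $P\left(X_n=0\text{ infinitely often}\right)=1$. (4) If $|\delta|=1$ and moreover $\left|\sum_{j=n}^{\infty}(2p_j-1)\right|=o\left(\frac{1}{\log n}\right)$ as $n\to\infty$, then $P\left(X_n=0\text{ infinitely often}\right)=1$.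
   Context: Excited random walk (ERW) in the deterministic, identically-piled cookie environment $\boldsymbol{p}=(p_1,p_2,\ldots)$ is the nearest-neighbor process $\{X_n\}_{n\ge0}$ on $\mathbb{Z}$ with $X_0=0$ and, with $L_n=\#\{0\le j\le n: X_j=X_n\}$ (the number of visits to the current site up to and including time $n$), $$P(X_{n+1}=X_n+1\mid X_0,\ldots,X_n)=p_{L_n},\qquad P(X_{n+1}=X_n-1\mid X_0,\ldots,X_n)=1-p_{L_n}.$$ Infinite sums $\sum_{j=n}^\infty(2p_j-1)$ are understood as limits of partial sums (convergence need not be absolute). *)

theory Defs
  imports "HOL-Probability.Probability" "HOL-Library.Landau_Symbols"
begin

definition visits :: "(nat \<Rightarrow> 'a \<Rightarrow> int) \<Rightarrow> nat \<Rightarrow> 'a \<Rightarrow> nat" where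
  "visits X n \<omega> = card {j \<in> {0..n}. X j \<omega> = X n \<omega>}"

text \<open>The sigma-algebra generated by \<open>X 0, \<dots>, X n\<close>; only its space and sets matter.\<close>

definition history :: "'a measure \<Rightarrow> (nat \<Rightarrow> 'a \<Rightarrow> int) \<Rightarrow> nat \<Rightarrow> 'a measure" where
  "history M X n = sigma (space M) {X j -` A \<inter> space M | j A. j \<le> n}"

text \<open>The first cookie of a pile is \<open>p 1\<close>: \<open>visits X n \<omega>\<close> is always positive,
  so the value \<open>p 0\<close> plays no role.\<close>

locale excited_random_walk = prob_space M
  for M :: "'a measure" and p :: "nat \<Rightarrow> real" and X :: "nat \<Rightarrow> 'a \<Rightarrow> int" +
  assumes random_variable_X: "\<And>n. random_variable (count_space UNIV) (X n)"
    and start: "AE \<omega> in M. X 0 \<omega> = 0"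
    and step_right: "\<And>n. AE \<omega> in M.
      real_cond_exp M (history M X n)
        (indicator {\<omega> \<in> space M. X (Suc n) \<omega> = X n \<omega> + 1}) \<omega> = p (visits X n \<omega>)"
    and step_left: "\<And>n. AE \<omega> in M.
      real_cond_exp M (history M X n)
        (indicator {\<omega> \<in> space M. X (Suc n) \<omega> = X n \<omega> - 1}) \<omega> = 1 - p (visits X n \<omega>)"

end

theory Submission
  imports Defs "HOL-Real_Asymp.Real_Asymp"
begin

text \<open>
  Drive the walk by independent stacks of coins, one stack per site. If the steps from \<open>N - 1\<close> to
  \<open>N\<close> number \<open>m\<close>, then the numbers of steps across the following edges are governed by the Markov
  chain that maps \<open>m\<close> to the number \<open>G\<close> of successes before the \<open>m\<close>-th failure in the next stack:
  extinction of this chain bounds the walk from above, and its survival prevents the return to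
  \<open>N - 1\<close>. The deviation \<open>G - m\<close> has mean close to \<open>\<delta>\<close>, variance close to \<open>2 m\<close> and fourth
  moment \<open>O(m\<^sup>2)\<close>. So \<open>sqrt (ln (m + 3))\<close> is a Lyapunov function for extinction if \<open>\<delta> < 1\<close>, or
  if \<open>\<delta> = 1\<close> and the tails are \<open>o(1 / ln n)\<close>, and \<open>1 / ln (m + 3)\<close> is one for survival if
  \<open>\<delta> > 1\<close>. By the Kolmogorov 0-1 law survival then occurs at infinitely many sites. The cases
  of negative \<open>\<delta>\<close> follow by reflection.
\<close>


section \<open>Walks driven by stacks of coins\<close>

text \<open>With mean deviation \<delta> and variance \<open>2 * m\<close>, a second-order expansion
  gives \<open>sqrt (ln m)\<close> a drift that is a positive multiple of \<delta> - 1 - 1 / (2 ln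
  m), and \<open>1 / ln m\<close> one that is a positive multiple of 1 - \<delta> + 2 / ln m. Plain
  \<open>ln\<close> would leave no margin at \<delta> = 1; the square root leaves one of order 1 /
  ln m, and the tail condition keeps all errors below it. The obstacle is that the series need not
  converge absolutely: the variance falls short of its ideal value by the expected sum of (2 q -
  1)^2 over the trials, which may be unbounded in \<open>m\<close>. This deficit hurts only the
  extinction argument, where concavity has to help, and it is controlled there because each square
  is at most an increment of the convergent partial sums. The fourth moment allows Taylor bounds
  that hold for jumps of any size, so no truncation occurs. As the given walk is known only through
  conditional probabilities, the results are proved for coins and carried over by equality of laws
  on path space.\<close>

text \<open>The number of successes before the \<open>m\<close>-th failure in \<open>s\<close>; if there are infinitely many
  such successes, \<^const>\<open>card\<close> returns the junk value 0.\<close>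

definition succ_before :: "(nat \<Rightarrow> bool) \<Rightarrow> nat \<Rightarrow> nat" where
  "succ_before s m = card {i. s i \<and> card {j. j < i \<and> \<not> s j} < m}"

text \<open>\<open>chain a N m k\<close> is to be compared with the number of steps from \<open>N - 1 + k\<close> to \<open>N + k\<close>.\<close>

primrec chain :: "(int \<Rightarrow> nat \<Rightarrow> bool) \<Rightarrow> int \<Rightarrow> nat \<Rightarrow> nat \<Rightarrow> nat" where
  "chain a N m 0 = m"
| "chain a N m (Suc k) = succ_before (a (N + int k)) (chain a N m k)"

text \<open>The second component counts the coins already taken from each stack. Indices start at 0,
  so coin \<open>i\<close> of a stack plays the part of cookie \<open>i + 1\<close>.\<close>

primrec walk_state :: "(int \<Rightarrow> nat \<Rightarrow> bool) \<Rightarrow> nat \<Rightarrow> int \<times> (int \<Rightarrow> nat)" where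
  "walk_state a 0 = (0, \<lambda>_. 0)"
| "walk_state a (Suc n) = (let (x, c) = walk_state a n in
     (if a x (c x) then x + 1 else x - 1, c(x := Suc (c x))))"

definition pos :: "(int \<Rightarrow> nat \<Rightarrow> bool) \<Rightarrow> nat \<Rightarrow> int" where
  "pos a n = fst (walk_state a n)"

definition used :: "(int \<Rightarrow> nat \<Rightarrow> bool) \<Rightarrow> nat \<Rightarrow> int \<Rightarrow> nat" where
  "used a n = snd (walk_state a n)"

lemma pos_0 [simp]: "pos a 0 = 0" and used_0 [simp]: "used a 0 = (\<lambda>_. 0)"
  by (simp_all add: pos_def used_def)

lemma pos_Suc: "pos a (Suc n) = (if a (pos a n) (used a n (pos a n)) then pos a n + 1 else pos a n - 1)"
  by (simp add: pos_def used_def Let_def split: prod.splits)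

lemma used_Suc: "used a (Suc n) = (used a n)(pos a n := Suc (used a n (pos a n)))"
  by (simp add: pos_def used_def Let_def split: prod.splits)

lemma used_eq_card: "used a n x = card {j. j < n \<and> pos a j = x}"
proof (induction n)
  case (Suc n)
  have "{j. j < Suc n \<and> pos a j = x} =
      (if pos a n = x then insert n {j. j < n \<and> pos a j = x} else {j. j < n \<and> pos a j = x})"
    by (auto simp: less_Suc_eq)
  then show ?case using Suc by (auto simp: used_Suc)
qed simp

text \<open>The numbers of steps to the right and to the left from \<open>x\<close> before time \<open>n\<close>.\<close>

definition rights :: "(int \<Rightarrow> nat \<Rightarrow> bool) \<Rightarrow> nat \<Rightarrow> int \<Rightarrow> nat" where
  "rights a n x = card {i. i < used a n x \<and> a x i}"

definition lefts :: "(int \<Rightarrow> nat \<Rightarrow> bool) \<Rightarrow> nat \<Rightarrow> int \<Rightarrow> nat" where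
  "lefts a n x = card {i. i < used a n x \<and> \<not> a x i}"

lemma rights_0 [simp]: "rights a 0 x = 0" and lefts_0 [simp]: "lefts a 0 x = 0"
  by (simp_all add: rights_def lefts_def)

lemma rights_Suc: "rights a (Suc n) x =
    rights a n x + (if pos a n = x \<and> pos a (Suc n) = x + 1 then 1 else 0)"
proof -
  have "{i. i < Suc k \<and> P i} = (if P k then insert k {i. i < k \<and> P i} else {i. i < k \<and> P i})"
    for k and P :: "nat \<Rightarrow> bool" by (auto simp: less_Suc_eq)
  then show ?thesis by (auto simp: rights_def used_Suc pos_Suc)
qed

lemma lefts_Suc: "lefts a (Suc n) x =
    lefts a n x + (if pos a n = x \<and> pos a (Suc n) = x - 1 then 1 else 0)"
proof -
  have "{i. i < Suc k \<and> P i} = (if P k then insert k {i. i < k \<and> P i} else {i. i < k \<and> P i})"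
    for k and P :: "nat \<Rightarrow> bool" by (auto simp: less_Suc_eq)
  then show ?thesis by (auto simp: lefts_def used_Suc pos_Suc)
qed

text \<open>The walk starts at 0, so it crosses the edge between \<open>x\<close> and
  \<open>x + 1\<close> alternately upwards and downwards, the first time upwards because
  \<open>0 \<le> x\<close>.\<close>

lemma rights_eq_lefts:
  assumes "0 \<le> x"
  shows "rights a n x = lefts a n (x + 1) + (if x < pos a n then 1 else 0)"
proof (induction n)
  case 0
  then show ?case using assms by simp
next
  case (Suc n)
  have "pos a (Suc n) = pos a n + 1 \<or> pos a (Suc n) = pos a n - 1"
    by (simp add: pos_Suc)
  with Suc show ?case unfolding rights_Suc lefts_Suc by auto
qed

text \<open>The counter at \<open>x\<close> moves in unit steps, and only while the walk stands at
  \<open>x\<close>; the time found is the one at which coin \<open>i\<close> of that stack is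
  read.\<close>

lemma used_attained:
  assumes "i < used a n x"
  shows "\<exists>j<n. pos a j = x \<and> used a j x = i"
  using assms
proof (induction n)
  case (Suc n)
  show ?case
  proof (cases "i < used a n x")
    case True
    with Suc.IH show ?thesis by (meson less_Suc_eq)
  next
    case False
    with Suc.prems have "pos a n = x" "used a n x = i"
      by (auto simp: used_Suc split: if_splits)
    then show ?thesis by blast
  qed
qed simp

text \<open>Some \<open>m\<close> failures lie in a bounded range, and every later index has at
  least \<open>m\<close> failures below it. This keeps \<open>succ_before\<close> away from its junk
  value.\<close>

lemma finite_succ_before:
  fixes s :: "nat \<Rightarrow> bool"
  assumes "infinite {i. \<not> s i}"
  shows "finite {i. s i \<and> card {j. j < i \<and> \<not> s j} < m}"
proof -
  obtain F :: "nat set" where F: "finite F" "card F = m" "F \<subseteq> {i. \<not> s i}"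
    using infinite_arbitrarily_large[OF assms] by blast
  have "i \<le> Max (insert 0 F)" if "card {j. j < i \<and> \<not> s j} < m" for i
  proof (rule ccontr)
    assume "\<not> i \<le> Max (insert 0 F)"
    then have "F \<subseteq> {j. j < i \<and> \<not> s j}"
    proof safe
      fix j assume "j \<in> F"
      then have "j \<le> Max (insert 0 F)" using F(1) by (intro Max_ge) auto
      then show "j < i" using \<open>\<not> i \<le> Max (insert 0 F)\<close> by linarith
    qed (use F(3) in blast)
    then have "card F \<le> card {j. j < i \<and> \<not> s j}"
      by (intro card_mono) auto
    with that F(2) show False by linarith
  qed
  then have "{i. s i \<and> card {j. j < i \<and> \<not> s j} < m} \<subseteq> {..Max (insert 0 F)}" by blast
  then show ?thesis by (rule finite_subset) simp
qed

text \<open>When coin \<open>i\<close> at \<open>N + k\<close> is read, the failures before it are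
  the left steps already made there. One arrival from the left is still unmatched at that time, so
  they are fewer than the arrivals and \<open>i\<close> is counted by
  \<open>succ_before\<close>.\<close>

lemma rights_le_chain:
  assumes inf: "\<And>x. infinite {i. \<not> a x i}" and N: "1 \<le> N"
    and m: "\<And>n. rights a n (N - 1) \<le> m"
  shows "rights a n (N - 1 + int k) \<le> chain a N m k"
proof (induction k arbitrary: n)
  case 0
  then show ?case using m by simp
next
  case (Suc k)
  let ?x = "N + int k"
  have "{i. i < used a n ?x \<and> a ?x i} \<subseteq>
      {i. a ?x i \<and> card {j. j < i \<and> \<not> a ?x j} < chain a N m k}"
  proof safe
    fix i assume "i < used a n ?x"
    then obtain t where t: "pos a t = ?x" "used a t ?x = i"
      using used_attained by blast
    have "lefts a t ?x < rights a t (N - 1 + int k)"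
      using rights_eq_lefts[of "N - 1 + int k" a t] N t by simp
    also have "\<dots> \<le> chain a N m k" by (rule Suc.IH)
    finally show "card {j. j < i \<and> \<not> a ?x j} < chain a N m k"
      by (simp add: lefts_def t)
  qed
  then have "rights a n ?x \<le> succ_before (a ?x) (chain a N m k)"
    unfolding rights_def succ_before_def by (intro card_mono finite_succ_before inf)
  then show ?case by (simp add: algebra_simps)
qed

lemma bounded_above_if_chain_dies:
  assumes inf: "\<And>x. infinite {i. \<not> a x i}" and N: "1 \<le> N"
    and m: "\<And>n. rights a n (N - 1) \<le> m" and dies: "chain a N m k = 0"
  shows "pos a n \<le> N - 1 + int k"
proof (induction n)
  case 0
  then show ?case using N by simp
next
  case (Suc n)
  have "rights a (Suc n) (N - 1 + int k) = 0"
    using rights_le_chain[where a = a, OF inf N m, of "Suc n" k] dies by simp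
  then have "\<not> (pos a n = N - 1 + int k \<and> pos a (Suc n) = N - 1 + int k + 1)"
    unfolding rights_Suc by (auto split: if_splits)
  moreover have "pos a (Suc n) \<le> pos a n + 1" by (simp add: pos_Suc)
  ultimately show ?case using Suc by linarith
qed

lemma pos_le: "pos a n \<le> int n"
  by (induction n) (auto simp: pos_Suc)

lemma rights_eq_0_far:
  assumes "int n \<le> x" shows "rights a n x = 0"
proof -
  have "{j. j < n \<and> pos a j = x} = {}"
  proof -
    have False if "j < n" "pos a j = x" for j
      using pos_le[of a j] that assms by linarith
    then show ?thesis by blast
  qed
  then have "used a n x = 0" unfolding used_eq_card by simp
  then show ?thesis by (simp add: rights_def)
qed

text \<open>At a return to \<open>N - 1\<close> every upward crossing of an edge above is matched by
  a downward one, so each stack above has used as many failures as it had arrivals and hence all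
  successes that the chain counts. The surviving chain would then be a lower bound for the crossings
  of an edge too far away to be reached.\<close>

lemma no_return_if_chain_survives:
  assumes N: "1 \<le> N" and survives: "\<And>k. chain a N 1 k \<noteq> 0"
    and crossed: "1 \<le> rights a n (N - 1)"
  shows "pos a n \<noteq> N - 1"
proof
  assume ret: "pos a n = N - 1"
  have le: "chain a N 1 k \<le> rights a n (N - 1 + int k)" for k
  proof (induction k)
    case 0
    then show ?case using crossed by simp
  next
    case (Suc k)
    let ?x = "N + int k"
    have "lefts a n ?x = rights a n (N - 1 + int k)"
      using rights_eq_lefts[of "N - 1 + int k" a n] N ret by simp
    with Suc have le: "chain a N 1 k \<le> card {i. i < used a n ?x \<and> \<not> a ?x i}"
      by (simp add: lefts_def)
    have "{i. a ?x i \<and> card {j. j < i \<and> \<not> a ?x j} < chain a N 1 k}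
        \<subseteq> {i. i < used a n ?x \<and> a ?x i}"
    proof safe
      fix i assume *: "card {j. j < i \<and> \<not> a ?x j} < chain a N 1 k"
      show "i < used a n ?x"
      proof (rule ccontr)
        assume "\<not> i < used a n ?x"
        then have "card {i. i < used a n ?x \<and> \<not> a ?x i} \<le> card {j. j < i \<and> \<not> a ?x j}"
          by (intro card_mono) auto
        with le * show False by simp
      qed
    qed
    then have "succ_before (a ?x) (chain a N 1 k) \<le> rights a n ?x"
      unfolding rights_def succ_before_def by (intro card_mono) auto
    then show ?case by (simp add: algebra_simps)
  qed
  \<comment> \<open>Crossing this edge takes more than \<open>n\<close> steps.\<close>
  have "rights a n (N - 1 + int n) = 0" using N by (intro rights_eq_0_far) auto
  with le[of n] survives[of n] show False by simp
qed

lemma path_passes_between: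
  fixes W :: "nat \<Rightarrow> int"
  assumes step: "\<And>n. W (Suc n) = W n + 1 \<or> W (Suc n) = W n - 1"
    and "m \<le> n" "W n \<le> x" "x \<le> W m"
  shows "\<exists>k. m \<le> k \<and> k \<le> n \<and> W k = x"
  using assms(2-)
proof (induction n rule: dec_induct)
  case base
  then show ?case by force
next
  case (step n)
  show ?case
  proof (cases "W n \<le> x")
    case True
    with step show ?thesis using le_SucI by blast
  next
    case False
    with step.prems assms(1)[of n] have "W (Suc n) = x" by auto
    then show ?thesis using step.hyps by (intro exI[of _ "Suc n"]) auto
  qed
qed

lemma pos_step: "pos a (Suc n) = pos a n + 1 \<or> pos a (Suc n) = pos a n - 1"
  by (simp add: pos_Suc)

lemma stays_above:
  assumes N: "1 \<le> N" and survives: "\<And>k. chain a N 1 k \<noteq> 0"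
    and n0: "N \<le> pos a n0" and n: "n0 \<le> n"
  shows "N \<le> pos a n"
proof (rule ccontr)
  assume "\<not> N \<le> pos a n"
  then obtain t where t: "n0 \<le> t" "pos a t = N - 1"
    using path_passes_between[of "pos a" n0 n "N - 1", OF pos_step] n n0 by auto
  have mono: "rights a s x \<le> rights a (s + d) x" for s d x
    by (induction d) (auto simp: rights_Suc)
  have "1 \<le> rights a n0 (N - 1)"
    using rights_eq_lefts[of "N - 1" a n0] N n0 by simp
  also have "\<dots> \<le> rights a t (N - 1)" using mono[of n0 "N - 1" "t - n0"] t by simp
  finally show False using no_return_if_chain_survives[OF N survives] t by blast
qed

text \<open>A site with a surviving chain is a floor once the walk has reached it, and such sites
  occur arbitrarily high.\<close>

lemma tendsto_at_top_if_chains_survive: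
  assumes unbdd: "\<And>B. \<exists>n. B \<le> pos a n"
    and surv: "\<exists>\<^sub>F N in sequentially. \<forall>k. chain a (int N) 1 k \<noteq> 0"
  shows "filterlim (pos a) at_top sequentially"
  unfolding filterlim_at_top eventually_sequentially
proof
  fix Z :: int
  from surv obtain N where N: "nat Z + 1 \<le> N" "\<And>k. chain a (int N) 1 k \<noteq> 0"
    unfolding frequently_sequentially by blast
  obtain n0 where "int N \<le> pos a n0" using unbdd by blast
  then have "Z \<le> pos a n" if "n0 \<le> n" for n
    using stays_above[of "int N" a n0 n] N that by force
  then show "\<exists>n0. \<forall>n\<ge>n0. Z \<le> pos a n" by blast
qed

lemma filterlim_at_topD_finite:
  fixes W :: "nat \<Rightarrow> int"
  assumes "filterlim W at_top sequentially"
  shows "finite {n. W n = x}"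
proof -
  obtain n0 where "\<And>n. n \<ge> n0 \<Longrightarrow> x + 1 \<le> W n"
    using assms unfolding filterlim_at_top eventually_sequentially by blast
  then have "{n. W n = x} \<subseteq> {..<n0}" by (force simp: not_less[symmetric])
  then show ?thesis by (rule finite_subset) simp
qed

text \<open>Divergence would leave finitely many visits to 0, hence finitely many crossings from 0
  to 1; the chain started from a bound on that number dies and caps the walk. The bound depends on
  the path, so extinction is asked from every start \<open>m\<close>.\<close>

lemma not_tendsto_at_top_if_chains_die:
  assumes inf: "\<And>x. infinite {i. \<not> a x i}"
    and dies: "\<And>m. \<exists>k. chain a 1 m k = 0"
  shows "\<not> filterlim (pos a) at_top sequentially"
proof
  assume lim: "filterlim (pos a) at_top sequentially"
  have fin: "finite {n. pos a n = 0}" using lim by (rule filterlim_at_topD_finite)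
  have "rights a n 0 \<le> card {n. pos a n = 0}" for n
  proof -
    have "rights a n 0 \<le> card {i. i < used a n 0}"
      unfolding rights_def by (intro card_mono) auto
    also have "\<dots> \<le> card {n. pos a n = 0}"
      unfolding used_eq_card by (simp, intro card_mono fin) auto
    finally show ?thesis .
  qed
  moreover obtain k where "chain a 1 (card {n. pos a n = 0}) k = 0" using dies by blast
  ultimately have *: "pos a n \<le> int k" for n
    using bounded_above_if_chain_dies[where a = a, OF inf, of 1 "card {n. pos a n = 0}" k n] by simp
  obtain n where "int k + 1 \<le> pos a n"
    using lim unfolding filterlim_at_top eventually_sequentially by blast
  with *[of n] show False by simp
qed

section \<open>Recurrence alternatives for stacks with infinitely many coins of each kind\<close>

lemma infinitely_often_neighbours:
  assumes inf: "\<And>x. infinite {i. \<not> a x i}" "\<And>x. infinite {i. a x i}"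
    and x: "infinite {n. pos a n = x}"
  shows "infinite {n. pos a n = x + 1}" "infinite {n. pos a n = x - 1}"
proof -
  \<comment> \<open>Infinitely many visits to \<open>x\<close> exhaust its stack, so every coin
    index is read at some visit.\<close>
  have reach: "\<exists>n. used a n x = i \<and> pos a n = x" for i
  proof -
    obtain F where F: "finite F" "card F = Suc i" "F \<subseteq> {n. pos a n = x}"
      using infinite_arbitrarily_large[OF x] by blast
    have "card F \<le> used a (Suc (Max F)) x"
      unfolding used_eq_card using F by (intro card_mono) (auto simp: less_Suc_eq_le)
    then show ?thesis using used_attained[of i a "Suc (Max F)" x] F by auto
  qed
  define time where "time i = (SOME n. used a n x = i \<and> pos a n = x)" for i
  have time: "used a (time i) x = i" "pos a (time i) = x" for i
    using someI_ex[OF reach[of i]] unfolding time_def by auto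
  have inj: "inj_on (\<lambda>i. Suc (time i)) A" for A
    by (rule inj_onI) (use time(1) in \<open>metis nat.inject\<close>)
  have "(\<lambda>i. Suc (time i)) ` {i. a x i} \<subseteq> {n. pos a n = x + 1}"
    by (auto simp: pos_Suc time)
  with inf(2) inj show "infinite {n. pos a n = x + 1}"
    by (meson finite_imageD finite_subset)
  have "(\<lambda>i. Suc (time i)) ` {i. \<not> a x i} \<subseteq> {n. pos a n = x - 1}"
    by (auto simp: pos_Suc time)
  with inf(1) inj show "infinite {n. pos a n = x - 1}"
    by (meson finite_imageD finite_subset)
qed

lemma infinitely_often_everywhere:
  assumes inf: "\<And>x. infinite {i. \<not> a x i}" "\<And>x. infinite {i. a x i}"
    and x: "infinite {n. pos a n = x}"
  shows "infinite {n. pos a n = y}"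
proof -
  have up: "infinite {n. pos a n = x + int k}" for k
  proof (induction k)
    case (Suc k)
    show ?case using infinitely_often_neighbours(1)[where a = a, OF inf Suc] by (simp add: algebra_simps)
  qed (use x in simp)
  have down: "infinite {n. pos a n = x - int k}" for k
  proof (induction k)
    case (Suc k)
    show ?case using infinitely_often_neighbours(2)[where a = a, OF inf Suc] by (simp add: diff_diff_eq add.commute)
  qed (use x in simp)
  show ?thesis using up[of "nat (y - x)"] down[of "nat (x - y)"] by (cases "x \<le> y") auto
qed

lemma infinite_range_bounded:
  fixes W :: "nat \<Rightarrow> int"
  assumes "infinite {n. K \<le> W n \<and> W n \<le> B}"
  shows "\<exists>x. infinite {n. W n = x}"
proof (rule ccontr)
  assume "\<nexists>x. infinite {n. W n = x}"
  then have "finite (\<Union>x\<in>{K..B}. {n. W n = x})" by auto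
  moreover have "{n. K \<le> W n \<and> W n \<le> B} \<subseteq> (\<Union>x\<in>{K..B}. {n. W n = x})" by auto
  ultimately show False using assms finite_subset by blast
qed

text \<open>A path that is bounded above and does not tend to minus infinity returns forever to a
  finite strip, hence to one site, hence to every site, even one beyond the bound.\<close>

lemma pos_unbounded_above:
  assumes inf: "\<And>x. infinite {i. \<not> a x i}" "\<And>x. infinite {i. a x i}"
    and not: "\<not> filterlim (pos a) at_bot sequentially"
  shows "\<exists>n. B \<le> pos a n"
proof (rule ccontr)
  assume "\<nexists>n. B \<le> pos a n"
  then have B: "pos a n \<le> B" for n by (meson linorder_linear)
  from not obtain K where "\<forall>n0. \<exists>n\<ge>n0. K < pos a n"
    unfolding filterlim_at_bot eventually_sequentially by (auto simp: not_le)
  then have "infinite {n. K \<le> pos a n \<and> pos a n \<le> B}"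
    unfolding infinite_nat_iff_unbounded_le using B by (metis (mono_tags, lifting) less_imp_le mem_Collect_eq)
  then obtain x where "infinite {n. pos a n = x}" using infinite_range_bounded by blast
  then have "infinite {n. pos a n = B + 1}" using infinitely_often_everywhere[where a = a, OF inf] by blast
  then obtain n where "pos a n = B + 1" using not_finite_existsD by blast
  with B[of n] show False by simp
qed

text \<open>If 0 is visited finitely often, so is every site. A walk that does not tend to minus
  infinity then climbs past its last zero, stays positive, and leaves each finite range for
  good.\<close>

lemma pos_trichotomy:
  assumes inf: "\<And>x. infinite {i. \<not> a x i}" "\<And>x. infinite {i. a x i}"
  shows "filterlim (pos a) at_top sequentially \<or> filterlim (pos a) at_bot sequentially \<or>
     infinite {n. pos a n = 0}"
proof (rule ccontr)
  assume *: "\<not> ?thesis"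
  have fin: "finite {n. pos a n = x}" for x
    using infinitely_often_everywhere[where a = a, OF inf] * by blast
  obtain n1 where n1: "\<And>n. n \<ge> n1 \<Longrightarrow> pos a n \<noteq> 0"
    using * unfolding infinite_nat_iff_unbounded_le by auto
  have "\<not> filterlim (pos a) at_bot sequentially" using * by blast
  then obtain n2 where n2: "int n1 + 1 \<le> pos a n2"
    using pos_unbounded_above[where a = a, OF inf] by blast
  \<comment> \<open>Height \<open>n1 + 1\<close> takes more than \<open>n1\<close> steps to reach,
    so \<open>n2\<close> lies after the last visit to 0.\<close>
  with pos_le[of a n2] have n12: "n1 \<le> n2" by linarith
  have p: "0 < pos a n" if ge: "n \<ge> n2" for n
  proof (rule ccontr)
    assume "\<not> 0 < pos a n"
    then obtain k where "n2 \<le> k" "pos a k = 0"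
      using path_passes_between[of "pos a" n2 n 0, OF pos_step] ge n2 by auto
    with n1 n12 show False by force
  qed
  have "filterlim (pos a) at_top sequentially"
    unfolding filterlim_at_top eventually_sequentially
  proof
    fix Z :: int
    have "finite {n. 0 \<le> pos a n \<and> pos a n \<le> Z}"
      using infinite_range_bounded fin by blast
    then obtain n0 where n0: "\<And>n. n0 \<le> n \<Longrightarrow> \<not> (0 \<le> pos a n \<and> pos a n \<le> Z)"
      unfolding finite_nat_set_iff_bounded by (metis (mono_tags, lifting) mem_Collect_eq not_le)
    have "Z \<le> pos a n" if "n \<ge> max n0 n2" for n
      using p[of n] n0[of n] that by simp
    then show "\<exists>n0. \<forall>n\<ge>n0. Z \<le> pos a n" by blast
  qed
  with * show False by blast
qed

section \<open>Elementary inequalities\<close>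

lemmas powers = power2_eq_square power3_eq_cube power4_eq_xxxx

text \<open>The step of a supermartingale: \<open>y\<close> will be the martingale \<open>Y\<close> and \<open>r\<close> the number of failures
  still to come, whose decrease compensates the growth of \<open>y ^ 4\<close>.\<close>

lemma quartic_step:
  fixes p y r \<epsilon> :: real
  assumes r: "1 \<le> (r::real)" and \<epsilon>_pos: "0 < \<epsilon>" and p: "\<epsilon> \<le> p" "p \<le> 1 - \<epsilon>"
  defines "a \<equiv> 20 / \<epsilon>" defines "b \<equiv> a / \<epsilon>" defines "c \<equiv> (8 + 4 * a) / \<epsilon>"
  defines "\<Psi> \<equiv> \<lambda>y r. y ^ 4 + a * y\<^sup>2 * r + b * r\<^sup>2 + c * r"
  shows "p * \<Psi> (y + 2 * (1 - p)) r + (1 - p) * \<Psi> (y - 2 * p) (r - 1) \<le> \<Psi> y r"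
proof -
  have p01: "0 < p" "p < 1" using p \<epsilon>_pos by linarith+
  have abc: "a > 0" "a * \<epsilon> = 20" "b * \<epsilon> = a" "c * \<epsilon> = 8 + 4 * a" "b > 0" "c > 0"
    using \<epsilon>_pos by (auto simp: a_def b_def c_def intro!: add_pos_nonneg divide_pos_pos)
  have v: "0 \<le> 4 * p * (1 - p)" "4 * p * (1 - p) \<le> 1"
    using p01 zero_le_power2[of "1 - 2 * p"] by (auto simp: power2_eq_square algebra_simps)
  have e4: "p * (y + 2 * (1 - p)) ^ 4 + (1 - p) * (y - 2 * p) ^ 4 - y ^ 4 \<le> 10 * y\<^sup>2 + 8"
  proof -
    have "p * (y + 2 * (1 - p)) ^ 4 + (1 - p) * (y - 2 * p) ^ 4 - y ^ 4 =
        (4 * p * (1 - p)) * (6 * y\<^sup>2 + 8 * (1 - 2 * p) * y + 4 * ((1 - p) ^ 3 + p ^ 3))"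
      by (simp add: powers algebra_simps)
    also have "\<dots> \<le> 1 * (10 * y\<^sup>2 + 8)"
    proof (rule mult_mono)
      have "8 * (1 - 2 * p) * y \<le> 4 * y\<^sup>2 + 4"
      proof -
        have "0 \<le> (2 * y - 2 * (1 - 2 * p))\<^sup>2" by simp
        moreover have "(1 - 2 * p)\<^sup>2 \<le> 1\<^sup>2" using p01 by (subst abs_le_square_iff[symmetric]) auto
        ultimately show ?thesis by (simp add: power2_eq_square algebra_simps)
      qed
      moreover have "(1 - p) ^ 3 + p ^ 3 \<le> (1 - p) + p"
        using p01 power_decreasing[of 1 3 "1 - p"] power_decreasing[of 1 3 p] by (intro add_mono) auto
      ultimately show "6 * y\<^sup>2 + 8 * (1 - 2 * p) * y + 4 * ((1 - p) ^ 3 + p ^ 3) \<le> 10 * y\<^sup>2 + 8" by simp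
      have "6 * y\<^sup>2 + 8 * (1 - 2 * p) * y + 4 * ((1 - p) ^ 3 + p ^ 3) =
          2 * y\<^sup>2 + (2 * y + 2 * (1 - 2 * p))\<^sup>2 + 4 * (p * (1 - p))"
        by (simp add: powers algebra_simps)
      also have "0 \<le> \<dots>" using p01 by (intro add_nonneg_nonneg) auto
      finally show "0 \<le> 6 * y\<^sup>2 + 8 * (1 - 2 * p) * y + 4 * ((1 - p) ^ 3 + p ^ 3)" .
    qed (use v in auto)
    finally show ?thesis by simp
  qed
  have e2: "p * ((y + 2 * (1 - p))\<^sup>2 * r) + (1 - p) * ((y - 2 * p)\<^sup>2 * (r - 1)) - y\<^sup>2 * r \<le> r + 4 - \<epsilon> * y\<^sup>2 / 2"
  proof -
    have "p * ((y + 2 * (1 - p))\<^sup>2 * r) + (1 - p) * ((y - 2 * p)\<^sup>2 * (r - 1)) - y\<^sup>2 * r =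
      r * (4 * p * (1 - p)) - (1 - p) * (y - 2 * p)\<^sup>2"
      by (simp add: power2_eq_square algebra_simps)
    moreover have "r * (4 * p * (1 - p)) \<le> r * 1" using v r by (intro mult_left_mono) auto
    moreover have "\<epsilon> * y\<^sup>2 / 2 - 4 \<le> (1 - p) * (y - 2 * p)\<^sup>2"
    proof -
      have "0 \<le> (y - 4 * p)\<^sup>2" by simp
      then have "y\<^sup>2 / 2 - 4 * p\<^sup>2 \<le> (y - 2 * p)\<^sup>2" by (simp add: power2_eq_square algebra_simps)
      then have "(1 - p) * (y\<^sup>2 / 2 - 4 * p\<^sup>2) \<le> (1 - p) * (y - 2 * p)\<^sup>2" using p01 by (intro mult_left_mono) auto
      moreover have "\<epsilon> * (y\<^sup>2 / 2) \<le> (1 - p) * (y\<^sup>2 / 2)" using p by (intro mult_right_mono) auto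
      moreover have "(1 - p) * p\<^sup>2 \<le> 1 * 1\<^sup>2" using p01 by (intro mult_mono power_mono) auto
      moreover have "(1 - p) * (y\<^sup>2 / 2 - 4 * p\<^sup>2) = (1 - p) * (y\<^sup>2 / 2) - 4 * ((1 - p) * p\<^sup>2)"
        by (simp add: algebra_simps)
      ultimately show ?thesis by simp
    qed
    ultimately show ?thesis by linarith
  qed
  have e1: "(1 - p) * ((r - 1)\<^sup>2 - r\<^sup>2) \<le> - \<epsilon> * r"
  proof -
    have "(1 - p) * ((r - 1)\<^sup>2 - r\<^sup>2) = - ((1 - p) * (2 * r - 1))" by (simp add: power2_eq_square algebra_simps)
    moreover have "\<epsilon> * r \<le> (1 - p) * (2 * r - 1)" using p r \<epsilon>_pos by (intro mult_mono) auto
    ultimately show ?thesis by linarith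
  qed
  \<comment> \<open>The constants cancel term by term: \<open>a * \<epsilon> / 2 = 10\<close>
    removes the terms in \<open>y\<^sup>2\<close>, \<open>b * \<epsilon> = a\<close> those in
    \<open>r\<close>, and \<open>c * \<epsilon> = 8 + 4 * a\<close> the rest.\<close>
  have "p * \<Psi> (y + 2 * (1 - p)) r + (1 - p) * \<Psi> (y - 2 * p) (r - 1) - \<Psi> y r =
     (p * (y + 2 * (1 - p)) ^ 4 + (1 - p) * (y - 2 * p) ^ 4 - y ^ 4) +
     a * (p * ((y + 2 * (1 - p))\<^sup>2 * r) + (1 - p) * ((y - 2 * p)\<^sup>2 * (r - 1)) - y\<^sup>2 * r) +
     b * ((1 - p) * ((r - 1)\<^sup>2 - r\<^sup>2)) - c * (1 - p)"
    unfolding \<Psi>_def by (simp add: algebra_simps)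
  also have "\<dots> \<le> (10 * y\<^sup>2 + 8) + a * (r + 4 - \<epsilon> * y\<^sup>2 / 2) + b * (- \<epsilon> * r) - c * \<epsilon>"
    using abc p by (intro add_mono diff_mono e4 mult_left_mono e2 e1) auto
  also have "\<dots> = 10 * y\<^sup>2 + 8 + a * r + 4 * a - (a * \<epsilon>) * y\<^sup>2 / 2 - (b * \<epsilon>) * r - c * \<epsilon>"
    by (simp add: algebra_simps)
  also have "\<dots> = 0" unfolding abc(2-4) by simp
  finally show ?thesis by simp
qed

section \<open>Taylor bounds for the logarithm, its square root and its reciprocal\<close>

lemma mono_from_deriv:
  fixes h h' :: "real \<Rightarrow> real"
  assumes "\<And>t. a \<le> t \<Longrightarrow> t \<le> b \<Longrightarrow> (h has_real_derivative h' t) (at t)"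
    and "\<And>t. a \<le> t \<Longrightarrow> t \<le> b \<Longrightarrow> 0 \<le> h' t" and "a \<le> b"
  shows "h a \<le> h b"
  using assms by (intro DERIV_nonneg_imp_nondecreasing[of a b h]) auto

lemma antimono_from_deriv:
  fixes h h' :: "real \<Rightarrow> real"
  assumes "\<And>t. a \<le> t \<Longrightarrow> t \<le> b \<Longrightarrow> (h has_real_derivative h' t) (at t)"
    and "\<And>t. a \<le> t \<Longrightarrow> t \<le> b \<Longrightarrow> h' t \<le> 0" and "a \<le> b"
  shows "h b \<le> h a"
  using assms by (intro DERIV_nonpos_imp_nonincreasing[of a b h]) auto

lemma ln_add_one_taylor2:
  fixes x :: real
  shows "0 \<le> x \<Longrightarrow> x - x\<^sup>2 / 2 \<le> ln (1 + x)"
    and "-1 < x \<Longrightarrow> x \<le> 0 \<Longrightarrow> ln (1 + x) \<le> x - x\<^sup>2 / 2"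
proof -
  let ?h = "\<lambda>x::real. ln (1 + x) - x + x\<^sup>2 / 2" and ?h' = "\<lambda>x::real. x\<^sup>2 / (1 + x)"
  have d: "(?h has_real_derivative ?h' t) (at t)" if "-1 < t" for t
    using that by (auto intro!: derivative_eq_intros simp: field_simps power2_eq_square)
  show "x - x\<^sup>2 / 2 \<le> ln (1 + x)" if "0 \<le> x"
    using mono_from_deriv[of 0 x ?h ?h'] d that by auto
  show "ln (1 + x) \<le> x - x\<^sup>2 / 2" if "-1 < x" "x \<le> 0"
    using mono_from_deriv[of x 0 ?h ?h'] d that by auto
qed

lemma ln_add_one_le_taylor3:
  assumes "-1 < x" shows "ln (1 + x) \<le> x - x\<^sup>2 / 2 + x ^ 3 / (3::real)"
proof -
  let ?h = "\<lambda>x::real. x - x\<^sup>2 / 2 + x ^ 3 / 3 - ln (1 + x)" and ?h' = "\<lambda>x::real. x ^ 3 / (1 + x)"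
  have d: "(?h has_real_derivative ?h' t) (at t)" if "-1 < t" for t
    using that by (auto intro!: derivative_eq_intros simp: field_simps powers)
  show ?thesis
  proof (cases "0 \<le> x")
    case True
    then show ?thesis using mono_from_deriv[of 0 x ?h ?h'] d by auto
  next
    case False
    have "?h' t \<le> 0" if "x \<le> t" "t \<le> 0" for t
      using that assms by (intro divide_nonpos_pos) (auto simp: power_le_zero_eq)
    then show ?thesis using antimono_from_deriv[of x 0 ?h ?h'] d False assms by auto
  qed
qed

lemma ln_add_one_ge_taylor3:
  assumes "-1/2 \<le> x" shows "x - x\<^sup>2 / 2 - \<bar>x\<bar> ^ 3 \<le> ln (1 + x :: real)"
proof (cases "0 \<le> x")
  case True
  have "0 \<le> \<bar>x\<bar> ^ 3" by simp
  with ln_add_one_taylor2(1)[OF True] show ?thesis by linarith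
next
  case False
  let ?h = "\<lambda>x::real. ln (1 + x) - x + x\<^sup>2 / 2 - x ^ 3"
    and ?h' = "\<lambda>x::real. x\<^sup>2 / (1 + x) - 3 * x\<^sup>2"
  have d: "(?h has_real_derivative ?h' t) (at t)" if "-1/2 \<le> t" for t
    using that by (auto intro!: derivative_eq_intros simp: field_simps power2_eq_square)
  have "?h' t \<le> 0" if "-1/2 \<le> t" for t
  proof -
    have "t\<^sup>2 / (1 + t) \<le> t\<^sup>2 / (1/3)" using that by (intro divide_left_mono) auto
    then show ?thesis by simp
  qed
  then have "?h 0 \<le> ?h x" using antimono_from_deriv[of x 0 ?h ?h'] d False assms by auto
  moreover have "\<bar>x\<bar> ^ 3 = - (x ^ 3)" using False by (simp add: power3_eq_cube)
  ultimately show ?thesis by simp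
qed

text \<open>A lower bound is wanted because the squared logarithm enters the expansion of the square
  root with a minus sign. For \<open>x > 1\<close> the left side is already nonpositive.\<close>

lemma ln_add_one_square_ge:
  assumes "-1 < x" shows "x\<^sup>2 - \<bar>x\<bar> ^ 3 \<le> (ln (1 + x :: real))\<^sup>2"
proof (cases "0 \<le> x")
  case True
  show ?thesis
  proof (cases "x \<le> 1")
    case le: True
    have "0 \<le> x - x\<^sup>2 / 2" using True mult_right_mono[OF le True] by (simp add: power2_eq_square)
    then have "(x - x\<^sup>2 / 2)\<^sup>2 \<le> (ln (1 + x))\<^sup>2"
      using ln_add_one_taylor2(1)[OF True] by (intro power_mono) auto
    moreover have "(x - x\<^sup>2 / 2)\<^sup>2 = x\<^sup>2 - x ^ 3 + x ^ 4 / 4"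
      by (simp add: powers algebra_simps)
    moreover have "0 \<le> x ^ 4" by simp
    moreover have "\<bar>x\<bar> ^ 3 = x ^ 3" using True by simp
    ultimately show ?thesis by linarith
  next
    case False
    then have "x ^ 2 \<le> x ^ 3" by (intro power_increasing) auto
    then have "x\<^sup>2 - \<bar>x\<bar> ^ 3 \<le> 0" using True by simp
    then show ?thesis using zero_le_power2[of "ln (1 + x)"] by linarith
  qed
next
  case False
  have "ln (1 + x) \<le> x - x\<^sup>2 / 2" using False assms ln_add_one_taylor2(2)[of x] by simp
  also have "\<dots> \<le> x" by simp
  finally have "- x \<le> - ln (1 + x)" by simp
  then have "(- x)\<^sup>2 \<le> (- ln (1 + x))\<^sup>2" using False by (intro power_mono) auto
  moreover have "0 \<le> \<bar>x\<bar> ^ 3" by simp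
  ultimately show ?thesis unfolding power2_minus by linarith
qed

text \<open>The square of the cubic Taylor polynomial exceeds \<open>1 + z\<close> by
  \<open>z ^ 4\<close> times a positive factor, and completing a square shows that the polynomial
  itself is positive from -1 on.\<close>

lemma sqrt_add_one_le_taylor3:
  assumes "-1 \<le> z" shows "sqrt (1 + z) \<le> 1 + z / 2 - z\<^sup>2 / 8 + z ^ 3 / (16::real)"
proof (rule real_le_lsqrt)
  have sq: "(1 + z / 2 - z\<^sup>2 / 8 + z ^ 3 / 16)\<^sup>2 = 1 + z + z ^ 4 * ((z - 2)\<^sup>2 + 16) / 256"
    by (simp add: powers field_simps)
  show "1 + z \<le> (1 + z / 2 - z\<^sup>2 / 8 + z ^ 3 / 16)\<^sup>2" unfolding sq by simp
  show "0 \<le> 1 + z / 2 - z\<^sup>2 / 8 + z ^ 3 / 16"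
  proof -
    have "1 + z / 2 - z\<^sup>2 / 8 + z ^ 3 / 16 = 5 / 16 + (z + 1) * ((z - 3 / 2)\<^sup>2 + 35 / 4) / 16"
      by (simp add: powers field_simps)
    moreover have "0 \<le> (z + 1) * ((z - 3 / 2)\<^sup>2 + 35 / 4)"
      by (rule mult_nonneg_nonneg) (use assms in auto)
    ultimately show ?thesis by simp
  qed
qed

text \<open>Meant for \<open>L = ln (m + 3)\<close> and \<open>x\<close> the relative deviation of
  one chain step. The bound is a polynomial in \<open>x\<close> and its absolute value, valid for
  all admissible \<open>x\<close>, so integrating it takes only moments.\<close>

lemma sqrt_ln_upper:
  fixes x L :: real
  assumes x: "-1 < x" and L: "0 < L" and pos: "0 \<le> L + ln (1 + x)"
  shows "sqrt (L + ln (1 + x)) \<le> sqrt L * (1 + (x - x\<^sup>2 / 2 + \<bar>x\<bar> ^ 3 / 3) / (2 * L)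
    - (x\<^sup>2 - \<bar>x\<bar> ^ 3) / (8 * L\<^sup>2) + \<bar>x\<bar> ^ 3 / (16 * L ^ 3))"
proof -
  let ?l = "ln (1 + x)"
  have "L + ?l = L * (1 + ?l / L)" using L by (simp add: field_simps)
  then have "sqrt (L + ?l) = sqrt L * sqrt (1 + ?l / L)" by (simp add: real_sqrt_mult)
  also have "\<dots> \<le> sqrt L * (1 + (?l / L) / 2 - (?l / L)\<^sup>2 / 8 + (?l / L) ^ 3 / 16)"
  proof (intro mult_left_mono sqrt_add_one_le_taylor3)
    have "-L \<le> ?l" using pos by linarith
    then show "-1 \<le> ?l / L" using L by (simp add: pos_le_divide_eq)
  qed (use L in auto)
  also have "\<dots> \<le> sqrt L * (1 + (x - x\<^sup>2 / 2 + \<bar>x\<bar> ^ 3 / 3) / (2 * L)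
    - (x\<^sup>2 - \<bar>x\<bar> ^ 3) / (8 * L\<^sup>2) + \<bar>x\<bar> ^ 3 / (16 * L ^ 3))"
  proof (intro mult_left_mono add_mono diff_mono)
    have "x ^ 3 \<le> \<bar>x\<bar> ^ 3" by (metis abs_ge_self power_abs)
    then have "?l \<le> x - x\<^sup>2 / 2 + \<bar>x\<bar> ^ 3 / 3" using ln_add_one_le_taylor3[OF x] by linarith
    then have "?l / (2 * L) \<le> (x - x\<^sup>2 / 2 + \<bar>x\<bar> ^ 3 / 3) / (2 * L)" using L by (intro divide_right_mono) auto
    then show "?l / L / 2 \<le> (x - x\<^sup>2 / 2 + \<bar>x\<bar> ^ 3 / 3) / (2 * L)" by (simp add: mult.commute)
    have "(x\<^sup>2 - \<bar>x\<bar> ^ 3) / (8 * L\<^sup>2) \<le> ?l\<^sup>2 / (8 * L\<^sup>2)"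
      using ln_add_one_square_ge[OF x] L by (intro divide_right_mono) auto
    then show "(x\<^sup>2 - \<bar>x\<bar> ^ 3) / (8 * L\<^sup>2) \<le> (?l / L)\<^sup>2 / 8" by (simp add: power_divide mult.commute)
    have "?l \<le> \<bar>x\<bar>" using ln_add_one_self_le_self2[OF x] by linarith
    then have "?l ^ 3 \<le> \<bar>x\<bar> ^ 3" by (rule power_mono_odd[rotated]) simp
    then have "?l ^ 3 / (16 * L ^ 3) \<le> \<bar>x\<bar> ^ 3 / (16 * L ^ 3)" using L by (intro divide_right_mono) auto
    then show "(?l / L) ^ 3 / 16 \<le> \<bar>x\<bar> ^ 3 / (16 * L ^ 3)" by (simp add: power_divide mult.commute)
  qed (use L in auto)
  finally show ?thesis .
qed

lemma inverse_ln_upper: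
  fixes x L :: real
  assumes x: "-1 < x" and L: "2 \<le> L" and ge1: "1 \<le> L + ln (1 + x)"
  shows "1 / (L + ln (1 + x)) \<le> 1 / L - (x - x\<^sup>2 / 2 - \<bar>x\<bar> ^ 3) / L\<^sup>2 + 8 * x\<^sup>2 / L ^ 3 + 16 * x ^ 4"
proof (cases "-1/2 \<le> x")
  case True
  let ?l = "ln (1 + x)"
  have lower: "x - x\<^sup>2 / 2 - \<bar>x\<bar> ^ 3 \<le> ?l" by (rule ln_add_one_ge_taylor3[OF True])
  have l2: "\<bar>?l\<bar> \<le> 3/2 * \<bar>x\<bar>"
  proof (cases "0 \<le> x")
    case True
    have "0 \<le> ?l" using True by simp
    then show ?thesis using ln_add_one_self_le_self2[OF x] True by linarith
  next
    case False
    then have "\<bar>x\<bar> \<le> 1/2" using True by simp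
    then have "\<bar>x\<bar> * \<bar>x\<bar> \<le> 1/2 * \<bar>x\<bar>" by (rule mult_right_mono) simp
    moreover from this have "(\<bar>x\<bar> * \<bar>x\<bar>) * \<bar>x\<bar> \<le> (1/2 * \<bar>x\<bar>) * (1/2)"
      using \<open>\<bar>x\<bar> \<le> 1/2\<close> by (rule mult_mono) auto
    ultimately have "x\<^sup>2 \<le> 1/2 * \<bar>x\<bar>" "\<bar>x\<bar> ^ 3 \<le> 1/4 * \<bar>x\<bar>"
      by (simp_all add: powers)
    moreover have "?l \<le> 0" using False x by simp
    ultimately show ?thesis using lower False by linarith
  qed
  have half: "L / 2 \<le> L + ?l"
  proof (cases "0 \<le> x")
    case True
    then have "0 \<le> ?l" by simp
    with L show ?thesis by linarith
  next
    case False
    with True have "\<bar>x\<bar> \<le> 1/2" by simp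
    with l2 L show ?thesis by linarith
  qed
  have "?l\<^sup>2 \<le> (3/2 * \<bar>x\<bar>)\<^sup>2" using l2 by (metis abs_ge_zero power2_abs power_mono)
  also have "\<dots> \<le> 4 * x\<^sup>2" by (simp add: power_mult_distrib power2_eq_square)
  finally have l4: "?l\<^sup>2 \<le> 4 * x\<^sup>2" .
  have "1 / u = 1 / L - (u - L) / L\<^sup>2 + (u - L)\<^sup>2 / (L\<^sup>2 * u)" if "0 < u" for u
    using L that by (simp add: divide_simps) (simp add: power2_eq_square algebra_simps)
  from this[of "L + ?l"] have "1 / (L + ?l) = 1 / L - ?l / L\<^sup>2 + ?l\<^sup>2 / (L\<^sup>2 * (L + ?l))"
    using ge1 by simp
  also have "\<dots> \<le> 1 / L - (x - x\<^sup>2 / 2 - \<bar>x\<bar> ^ 3) / L\<^sup>2 + (4 * x\<^sup>2) / (L\<^sup>2 * (L / 2))"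
    using L ge1 half l4 lower
    by (intro add_mono diff_mono divide_right_mono frac_le mult_left_mono) auto
  also have "(4 * x\<^sup>2) / (L\<^sup>2 * (L / 2)) = 8 * x\<^sup>2 / L ^ 3"
    by (simp add: powers)
  finally have "1 / (L + ?l) \<le> 1 / L - (x - x\<^sup>2 / 2 - \<bar>x\<bar> ^ 3) / L\<^sup>2 + 8 * x\<^sup>2 / L ^ 3" .
  moreover have "0 \<le> 16 * x ^ 4" by simp
  ultimately show ?thesis by linarith
next
  case False
  then have "(1/2) ^ 4 \<le> \<bar>x\<bar> ^ 4" by (intro power_mono) auto
  then have "1 \<le> 16 * x ^ 4" by (simp add: power_divide)
  moreover have "1 / (L + ln (1 + x)) \<le> 1" using ge1 by simp
  moreover have "0 \<le> - (x - x\<^sup>2 / 2 - \<bar>x\<bar> ^ 3) / L\<^sup>2"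
  proof (rule divide_nonneg_nonneg)
    have "0 \<le> x\<^sup>2" "0 \<le> \<bar>x\<bar> ^ 3" by simp_all
    then show "0 \<le> - (x - x\<^sup>2 / 2 - \<bar>x\<bar> ^ 3)" using False by linarith
  qed simp
  moreover have "0 \<le> 1 / L" "0 \<le> 8 * x\<^sup>2 / L ^ 3" using L by auto
  ultimately show ?thesis unfolding minus_divide_left[symmetric] by linarith
qed

section \<open>Independent coins\<close>

lemma indep_vars_PiM_components:
  assumes "\<And>i::'i. prob_space (N i)"
  shows "prob_space.indep_vars (PiM UNIV N) N (\<lambda>i w. w i) UNIV"
proof -
  interpret prob_space "PiM UNIV N" using assms by (intro prob_space_PiM)
  have "distr (PiM UNIV N) (PiM UNIV N) (\<lambda>x. \<lambda>i\<in>UNIV. x i) = PiM UNIV N"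
    by (simp add: restrict_UNIV distr_id2)
  moreover have "(\<Pi>\<^sub>M i\<in>UNIV. distr (PiM UNIV N) (N i) (\<lambda>w. w i)) = PiM UNIV N"
    using assms by (intro PiM_cong distr_PiM_component) auto
  ultimately show ?thesis
    by (subst indep_vars_iff_distr_eq_PiM) auto
qed

text \<open>For \<open>I = {..<n}\<close> this takes the place of measurability with respect to the
  first \<open>n\<close> coins: a real function of this kind factors through a list of
  \<open>n\<close> Booleans, so it is measurable and bounded at once.\<close>

definition depends_on :: "'i set \<Rightarrow> (('i \<Rightarrow> 'b) \<Rightarrow> 'c) \<Rightarrow> bool" where
  "depends_on I g \<longleftrightarrow> (\<forall>s t. (\<forall>i\<in>I. s i = t i) \<longrightarrow> g s = g t)"

lemma depends_onI: "(\<And>s t. (\<And>i. i \<in> I \<Longrightarrow> s i = t i) \<Longrightarrow> g s = g t) \<Longrightarrow> depends_on I g"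
  unfolding depends_on_def by blast

text \<open>The uniform margin \<open>\<epsilon>\<close> is available because the cookies lie in
  (0,1) and tend to 1/2; see \<open>coins_from_cookies\<close>.\<close>

locale coins =
  fixes q :: "nat \<Rightarrow> real" and \<epsilon> :: real
  assumes \<epsilon>_pos: "0 < \<epsilon>" and q_ge: "\<epsilon> \<le> q i" and q_le: "q i \<le> 1 - \<epsilon>"
begin

lemma q_bounds: "0 < q i" "q i < 1" "0 \<le> q i" "q i \<le> 1"
  using \<epsilon>_pos q_ge[of i] q_le[of i] by linarith+

definition S :: "(nat \<Rightarrow> bool) measure" where
  "S = PiM UNIV (\<lambda>i. measure_pmf (bernoulli_pmf (q i)))"

sublocale S: prob_space S
  unfolding S_def by (intro prob_space_PiM) (rule prob_space_measure_pmf)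

lemma space_S [simp]: "space S = UNIV"
  by (simp add: S_def space_PiM)

lemma prob_UNIV [simp]: "S.prob UNIV = 1"
  using S.prob_space by simp

lemma sets_S: "sets S = sets (PiM UNIV (\<lambda>_::nat. count_space UNIV))"
  unfolding S_def by (intro sets_PiM_cong) auto

lemma measurable_coin [measurable]: "(\<lambda>s. s i) \<in> measurable S (count_space UNIV)"
  unfolding measurable_cong_sets[OF sets_S refl] by measurable

lemma measurable_coin_pred [measurable]: "Measurable.pred S (\<lambda>s. s i)"
  using measurable_coin .

lemma indep_coins: "S.indep_vars (\<lambda>i. measure_pmf (bernoulli_pmf (q i))) (\<lambda>i s. s i) UNIV"
  unfolding S_def by (rule indep_vars_PiM_components) (rule prob_space_measure_pmf)

lemma measurable_prefix:
  fixes M :: "(nat \<Rightarrow> bool) measure"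
  assumes "\<And>i. i < n \<Longrightarrow> (\<lambda>s. s i) \<in> measurable M (count_space UNIV)"
  shows "(\<lambda>s. map s [0..<n]) \<in> measurable M (count_space UNIV)"
  using assms
proof (induction n)
  case (Suc n)
  have "(\<lambda>s. (\<lambda>l. map s [0..<n] @ [l]) (s n)) \<in> measurable M (count_space UNIV)"
  proof (rule measurable_compose_countable[where g = "\<lambda>s. s n" and f = "\<lambda>l s. map s [0..<n] @ [l]"])
    fix b
    have "(\<lambda>s. map s [0..<n]) \<in> measurable M (count_space UNIV)" using Suc by auto
    then show "(\<lambda>s. map s [0..<n] @ [b]) \<in> measurable M (count_space UNIV)"
      by measurable
  qed (use Suc in auto)
  then show ?case by simp
qed simp

lemma depends_on_prefix:
  assumes "depends_on {..<n} g"
  shows "g s = g (\<lambda>i. map s [0..<n] ! i)"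
  using assms unfolding depends_on_def by (metis (no_types, lifting) add_0 diff_zero lessThan_iff nth_map_upt)

lemma measurable_depends_on:
  assumes "depends_on {..<n} (g :: (nat \<Rightarrow> bool) \<Rightarrow> real)"
  shows "g \<in> borel_measurable S"
proof -
  have "(\<lambda>l. g (\<lambda>i. l ! i)) \<circ> (\<lambda>s. map s [0..<n]) \<in> borel_measurable S"
    by (intro measurable_comp[OF measurable_prefix]) auto
  then show ?thesis using depends_on_prefix[OF assms] by (simp add: comp_def)
qed

lemma bounded_depends_on:
  assumes "depends_on {..<n} (g :: (nat \<Rightarrow> bool) \<Rightarrow> real)"
  shows "\<exists>C. \<forall>s. \<bar>g s\<bar> \<le> C"
proof -
  have fin: "finite {l :: bool list. length l = n}"
    using finite_lists_length_eq[of "UNIV :: bool set" n] by simp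
  have "\<bar>g s\<bar> \<le> (\<Sum>l\<in>{l. length l = n}. \<bar>g (\<lambda>i. l ! i)\<bar>)" for s
    unfolding depends_on_prefix[OF assms, of s]
    by (rule member_le_sum[where f = "\<lambda>l. \<bar>g (\<lambda>i. l ! i)\<bar>"]) (auto simp: fin)
  then show ?thesis by blast
qed

lemma integrable_depends_on:
  assumes "depends_on {..<n} (g :: (nat \<Rightarrow> bool) \<Rightarrow> real)"
  shows "integrable S g"
proof -
  obtain C where "\<forall>s. \<bar>g s\<bar> \<le> C" using bounded_depends_on[OF assms] by blast
  then show ?thesis
    by (intro S.integrable_const_bound[of _ C] measurable_depends_on[OF assms]) auto
qed

lemma prob_coin: "measure S {s. s n} = q n"
proof -
  have "measure S {s. s n} = measure (distr S (measure_pmf (bernoulli_pmf (q n))) (\<lambda>s. s n)) {True}"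
    by (subst measure_distr) (auto simp: vimage_def)
  also have "distr S (measure_pmf (bernoulli_pmf (q n))) (\<lambda>s. s n) = measure_pmf (bernoulli_pmf (q n))"
    unfolding S_def by (intro distr_PiM_component) (auto intro: prob_space_measure_pmf)
  also have "measure (measure_pmf (bernoulli_pmf (q n))) {True} = q n"
    by (simp add: measure_pmf_single q_bounds)
  finally show ?thesis .
qed

lemma integral_coin: "(\<integral>s. (if s n then c else d) \<partial>S) = q n * c + (1 - q n) * (d::real)"
proof -
  have [measurable]: "{s. s n} \<in> sets S" using measurable_coin_pred[of n] by (simp add: pred_def)
  have "(\<integral>s. (if s n then c else d) \<partial>S) = (\<integral>s. d + indicator {s. s n} s * (c - d) \<partial>S)"
    by (intro Bochner_Integration.integral_cong) auto
  also have "\<dots> = d + q n * (c - d)"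
    by (subst Bochner_Integration.integral_add) (auto simp: prob_coin less_top[symmetric] S.emeasure_eq_measure)
  finally show ?thesis by (simp add: algebra_simps)
qed

lemma integral_depends_on_times_coin:
  assumes g: "depends_on {..<n} (g :: (nat \<Rightarrow> bool) \<Rightarrow> real)"
  shows "(\<integral>s. g s * (if s n then c else d) \<partial>S) = (\<integral>s. g s \<partial>S) * (q n * c + (1 - q n) * d)"
proof -
  let ?B = "\<lambda>i. measure_pmf (bernoulli_pmf (q i))"
  let ?g = "\<lambda>s. (\<lambda>l. g (\<lambda>i. l ! i)) (map s [0..<n])" and ?h = "\<lambda>s. (\<lambda>b. if b then c else d) (s n)"
  have "S.indep_var (PiM {..<n} ?B) (\<lambda>s. restrict s {..<n}) (PiM {n} ?B) (\<lambda>s. restrict s {n})"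
    using S.indep_var_restrict[OF indep_coins, of "{..<n}" "{n}"] by simp
  then have "S.indep_var borel (?g \<circ> (\<lambda>s. restrict s {..<n})) borel (?h \<circ> (\<lambda>s. restrict s {n}))"
  proof (rule S.indep_var_compose)
    have "(\<lambda>s. map s [0..<n]) \<in> measurable (PiM {..<n} ?B) (count_space UNIV)"
    proof (rule measurable_prefix)
      fix i assume "i < n"
      then have "(\<lambda>s. s i) \<in> measurable (PiM {..<n} ?B) (?B i)"
        by (intro measurable_component_singleton) auto
      then show "(\<lambda>s. s i) \<in> measurable (PiM {..<n} ?B) (count_space UNIV)" by simp
    qed
    then show "?g \<in> borel_measurable (PiM {..<n} ?B)"
      by (rule measurable_compose) simp
    have "(\<lambda>s. s n) \<in> measurable (PiM {n} ?B) (?B n)"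
      by (intro measurable_component_singleton) auto
    then have "(\<lambda>s. s n) \<in> measurable (PiM {n} ?B) (count_space UNIV)" by simp
    then show "?h \<in> borel_measurable (PiM {n} ?B)"
      by (rule measurable_compose) simp
  qed
  moreover have "?g \<circ> (\<lambda>s. restrict s {..<n}) = g"
  proof
    fix s :: "nat \<Rightarrow> bool"
    have "map (restrict s {..<n}) [0..<n] = map s [0..<n]" by auto
    then show "(?g \<circ> (\<lambda>s. restrict s {..<n})) s = g s"
      using depends_on_prefix[OF g, of s] by (simp add: comp_def del: map_eq_conv)
  qed
  ultimately have "S.indep_var borel g borel (\<lambda>s. if s n then c else d)"
    by (simp add: comp_def)
  moreover have "integrable S g" by (rule integrable_depends_on[OF g])
  moreover have "integrable S (\<lambda>s. if s n then c else d)"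
    by (rule integrable_depends_on[of "Suc n"]) (auto intro!: depends_onI)
  ultimately have "(\<integral>s. g s * (if s n then c else d) \<partial>S) = (\<integral>s. g s \<partial>S) * (\<integral>s. (if s n then c else d) \<partial>S)"
    by (rule S.indep_var_lebesgue_integral)
  then show ?thesis by (simp add: integral_coin)
qed

text \<open>Conditioning on the first \<open>n\<close> coins, carried out as an average over coin
  \<open>n\<close> alone.\<close>

lemma integral_coin_step:
  fixes \<phi> :: "(nat \<Rightarrow> bool) \<Rightarrow> bool \<Rightarrow> real"
  assumes \<phi>: "\<And>b. depends_on {..<n} (\<lambda>s. \<phi> s b)"
  shows "(\<integral>s. \<phi> s (s n) \<partial>S) = (\<integral>s. q n * \<phi> s True + (1 - q n) * \<phi> s False \<partial>S)"
proof -
  have int: "integrable S (\<lambda>s. \<phi> s b)" "integrable S (\<lambda>s. \<phi> s b * (if s n then c else d))" for b c d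
  proof -
    show "integrable S (\<lambda>s. \<phi> s b)" by (rule integrable_depends_on[OF \<phi>])
    have "depends_on {..<Suc n} (\<lambda>s. \<phi> s b * (if s n then c else d))"
      using \<phi>[of b] unfolding depends_on_def by (smt (verit, best) lessThan_iff lessI less_SucI)
    then show "integrable S (\<lambda>s. \<phi> s b * (if s n then c else d))" by (rule integrable_depends_on)
  qed
  have "(\<integral>s. \<phi> s (s n) \<partial>S) =
      (\<integral>s. \<phi> s True * (if s n then 1 else 0) + \<phi> s False * (if s n then 0 else 1) \<partial>S)"
    by (intro Bochner_Integration.integral_cong) auto
  also have "\<dots> = (\<integral>s. \<phi> s True \<partial>S) * q n + (\<integral>s. \<phi> s False \<partial>S) * (1 - q n)"
    by (simp add: Bochner_Integration.integral_add[OF int(2) int(2)]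
         integral_depends_on_times_coin[OF \<phi>])
  also have "\<dots> = (\<integral>s. q n * \<phi> s True + (1 - q n) * \<phi> s False \<partial>S)"
    using int(1) by (simp add: algebra_simps)
  finally show ?thesis .
qed

section \<open>Optional stopping at the m-th failure\<close>

definition fails :: "nat \<Rightarrow> (nat \<Rightarrow> bool) \<Rightarrow> nat" where
  "fails n s = card {j. j < n \<and> \<not> s j}"

text \<open>The numbers of successes and failures among the first \<open>n\<close> coins, stopped at the \<open>m\<close>-th failure.\<close>

definition sc :: "nat \<Rightarrow> nat \<Rightarrow> (nat \<Rightarrow> bool) \<Rightarrow> nat" where
  "sc m n s = card {i. i < n \<and> s i \<and> fails i s < m}"

definition fl :: "nat \<Rightarrow> nat \<Rightarrow> (nat \<Rightarrow> bool) \<Rightarrow> nat" where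
  "fl m n s = min m (fails n s)"

lemma card_less_Suc: "card {i. i < Suc k \<and> P i} = card {i. i < k \<and> P i} + (if P k then 1 else 0)"
proof -
  have "{i. i < Suc k \<and> P i} = (if P k then insert k {i. i < k \<and> P i} else {i. i < k \<and> P i})"
    by (auto simp: less_Suc_eq)
  then show ?thesis by simp
qed

lemma fails_Suc: "fails (Suc n) s = fails n s + (if s n then 0 else 1)"
  unfolding fails_def by (simp add: card_less_Suc)

lemma sc_Suc: "sc m (Suc n) s = sc m n s + (if s n \<and> fl m n s < m then 1 else 0)"
  unfolding sc_def by (simp add: card_less_Suc fl_def min_less_iff_disj)

lemma fl_Suc: "fl m (Suc n) s = fl m n s + (if \<not> s n \<and> fl m n s < m then 1 else 0)"
  unfolding fl_def fails_Suc by (simp add: min_def)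

lemma sc_0 [simp]: "sc m 0 s = 0" and fl_0 [simp]: "fl m 0 s = 0"
  by (simp_all add: sc_def fl_def fails_def)

text \<open>Before the \<open>m\<close>-th failure every coin read is counted, so the index of the
  next coin is recovered from the two counts. This makes the pair a Markov chain with success
  probability \<open>q (a + b)\<close>.\<close>

lemma sc_plus_fl: "fl m n s < m \<Longrightarrow> sc m n s + fl m n s = n"
  by (induction n) (auto simp: sc_Suc fl_Suc split: if_splits)

lemma fl_le: "fl m n s \<le> m" by (simp add: fl_def)

lemma depends_on_sc_fl: "depends_on {..<n} (\<lambda>s. \<phi> (sc m n s) (fl m n s))"
proof -
  have "sc m n s = sc m n t \<and> fl m n s = fl m n t" if "\<And>i. i \<in> {..<n} \<Longrightarrow> s i = t i" for s t
    using that by (induction n) (auto simp: sc_Suc fl_Suc)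
  then show ?thesis by (intro depends_onI) metis
qed

lemma integral_sc_fl_step:
  fixes \<phi> :: "nat \<Rightarrow> nat \<Rightarrow> real"
  shows "(\<integral>s. \<phi> (sc m (Suc n) s) (fl m (Suc n) s) \<partial>S) =
    (\<integral>s. (\<lambda>a b. if b < m then q (a + b) * \<phi> (Suc a) b + (1 - q (a + b)) * \<phi> a (Suc b) else \<phi> a b)
       (sc m n s) (fl m n s) \<partial>S)"
proof -
  let ?\<phi> = "\<lambda>s c. (\<lambda>a b. if b < m then (if c then \<phi> (Suc a) b else \<phi> a (Suc b)) else \<phi> a b) (sc m n s) (fl m n s)"
  have "(\<integral>s. \<phi> (sc m (Suc n) s) (fl m (Suc n) s) \<partial>S) = (\<integral>s. ?\<phi> s (s n) \<partial>S)"
    by (intro Bochner_Integration.integral_cong) (auto simp: sc_Suc fl_Suc)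
  also have "\<dots> = (\<integral>s. q n * ?\<phi> s True + (1 - q n) * ?\<phi> s False \<partial>S)"
    by (rule integral_coin_step) (rule depends_on_sc_fl)
  also have "\<dots> = (\<integral>s. (\<lambda>a b. if b < m then q (a + b) * \<phi> (Suc a) b + (1 - q (a + b)) * \<phi> a (Suc b) else \<phi> a b)
       (sc m n s) (fl m n s) \<partial>S)"
    by (intro Bochner_Integration.integral_cong) (auto simp: sc_plus_fl ring_distribs)
  finally show ?thesis .
qed

lemma integrable_sc_fl: "integrable S (\<lambda>s. \<phi> (sc m n s) (fl m n s) :: real)"
  by (rule integrable_depends_on[OF depends_on_sc_fl])

text \<open>A supermartingale inequality for the stopped counts. The one-step condition is confined
  to \<open>b < m\<close> because the pair is frozen from the \<open>m\<close>-th failure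
  on.\<close>

lemma integral_sc_fl_le:
  fixes \<phi> :: "nat \<Rightarrow> nat \<Rightarrow> real"
  assumes "\<And>a b. b < m \<Longrightarrow> q (a + b) * \<phi> (Suc a) b + (1 - q (a + b)) * \<phi> a (Suc b) \<le> \<phi> a b"
  shows "(\<integral>s. \<phi> (sc m n s) (fl m n s) \<partial>S) \<le> \<phi> 0 0"
proof (induction n)
  case 0
  then show ?case by (simp add: S.prob_space)
next
  case (Suc n)
  have "(\<integral>s. \<phi> (sc m (Suc n) s) (fl m (Suc n) s) \<partial>S) \<le> (\<integral>s. \<phi> (sc m n s) (fl m n s) \<partial>S)"
    unfolding integral_sc_fl_step
    by (rule integral_mono[OF integrable_sc_fl[of "\<lambda>a b. if b < m then q (a + b) * \<phi> (Suc a) b + (1 - q (a + b)) * \<phi> a (Suc b) else \<phi> a b"] integrable_sc_fl])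
       (use assms in auto)
  with Suc show ?case by linarith
qed

lemma integral_sc_fl_eq:
  fixes \<phi> :: "nat \<Rightarrow> nat \<Rightarrow> real"
  assumes "\<And>a b. b < m \<Longrightarrow> q (a + b) * \<phi> (Suc a) b + (1 - q (a + b)) * \<phi> a (Suc b) = \<phi> a b"
  shows "(\<integral>s. \<phi> (sc m n s) (fl m n s) \<partial>S) = \<phi> 0 0"
proof (rule antisym)
  show "(\<integral>s. \<phi> (sc m n s) (fl m n s) \<partial>S) \<le> \<phi> 0 0"
    by (rule integral_sc_fl_le) (simp add: assms)
  have "(\<integral>s. - \<phi> (sc m n s) (fl m n s) \<partial>S) \<le> - \<phi> 0 0"
    by (rule integral_sc_fl_le[of m "\<lambda>a b. - \<phi> a b"]) (use assms in \<open>smt (verit) mult_minus_right\<close>)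
  then show "\<phi> 0 0 \<le> (\<integral>s. \<phi> (sc m n s) (fl m n s) \<partial>S)" by simp
qed

end

context coins
begin

lemma integral_all_coins:
  defines "ind \<equiv> (\<lambda>n k b (s::nat \<Rightarrow> bool). if \<forall>i\<in>{n..<n+k}. s i = b then 1 else 0 :: real)"
  shows "\<epsilon> ^ k \<le> (\<integral>s. ind n k b s \<partial>S) \<and> (\<integral>s. ind n k b s \<partial>S) \<le> (1 - \<epsilon>) ^ k"
proof (induction k)
  case 0
  then show ?case by (simp add: ind_def)
next
  case (Suc k)
  let ?c = "if b then 1 else 0 :: real" and ?d = "if b then 0 else 1 :: real"
  let ?r = "q (n + k) * ?c + (1 - q (n + k)) * ?d"
  have "(\<integral>s. ind n (Suc k) b s \<partial>S) = (\<integral>s. ind n k b s * (if s (n + k) then ?c else ?d) \<partial>S)"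
    by (intro Bochner_Integration.integral_cong) (auto simp: ind_def less_Suc_eq)
  also have "\<dots> = (\<integral>s. ind n k b s \<partial>S) * ?r"
    by (rule integral_depends_on_times_coin) (auto intro!: depends_onI simp: ind_def)
  finally have eq: "(\<integral>s. ind n (Suc k) b s \<partial>S) = (\<integral>s. ind n k b s \<partial>S) * ?r" .
  have r: "\<epsilon> \<le> ?r" "?r \<le> 1 - \<epsilon>" using q_ge[of "n + k"] q_le[of "n + k"] by auto
  have "\<epsilon> ^ k * \<epsilon> \<le> (\<integral>s. ind n k b s \<partial>S) * ?r"
    using Suc r \<epsilon>_pos by (intro mult_mono) (auto simp: ind_def intro!: Bochner_Integration.integral_nonneg)
  moreover have "(\<integral>s. ind n k b s \<partial>S) * ?r \<le> (1 - \<epsilon>) ^ k * (1 - \<epsilon>)"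
    using Suc r \<epsilon>_pos by (intro mult_mono) (auto simp: ind_def intro!: zero_le_power)
  ultimately show ?case unfolding eq by (simp add: mult.commute)
qed

lemma measure_all_coins:
  "\<epsilon> ^ k \<le> measure S {s. \<forall>i\<in>{n..<n+k}. s i = b}"
  "measure S {s. \<forall>i\<in>{n..<n+k}. s i = b} \<le> (1 - \<epsilon>) ^ k"
proof -
  have "{s \<in> space S. \<forall>i\<in>{n..<n+k}. s i = b} \<in> sets S" by measurable
  moreover have "(\<integral>s. (if \<forall>i\<in>{n..<n+k}. s i = b then 1 else 0 :: real) \<partial>S) =
      (\<integral>s. indicator {s. \<forall>i\<in>{n..<n+k}. s i = b} s \<partial>S)"
    by (intro Bochner_Integration.integral_cong) (auto simp: indicator_def)
  ultimately have "measure S {s. \<forall>i\<in>{n..<n+k}. s i = b} =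
      (\<integral>s. (if \<forall>i\<in>{n..<n+k}. s i = b then 1 else 0 :: real) \<partial>S)"
    by simp
  then show "\<epsilon> ^ k \<le> measure S {s. \<forall>i\<in>{n..<n+k}. s i = b}"
    "measure S {s. \<forall>i\<in>{n..<n+k}. s i = b} \<le> (1 - \<epsilon>) ^ k"
    using integral_all_coins[of k n b] by auto
qed

lemma AE_infinite_coins: "AE s in S. infinite {i. s i = b}"
proof -
  have "AE s in S. \<not> (\<forall>i\<ge>n. s i = (\<not> b))" for n
  proof -
    let ?N = "{s \<in> space S. \<forall>i\<ge>n. s i = (\<not> b)}"
    have [measurable]: "?N \<in> sets S" by measurable
    have le: "measure S ?N \<le> (1 - \<epsilon>) ^ k" for k
    proof -
      have *: "{s \<in> space S. \<forall>i\<in>{n..<n+k}. s i = (\<not> b)} \<in> sets S" by measurable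
      have "measure S ?N \<le> measure S {s. \<forall>i\<in>{n..<n+k}. s i = (\<not> b)}"
        using * by (intro S.finite_measure_mono) auto
      with measure_all_coins(2)[of n k "\<not> b"] show ?thesis by linarith
    qed
    have "(\<lambda>k. (1 - \<epsilon>) ^ k) \<longlonglongrightarrow> 0"
      using \<epsilon>_pos q_bounds[of 0] q_ge[of 0] q_le[of 0] by (intro LIMSEQ_realpow_zero) linarith+
    then have "measure S ?N \<le> 0"
      by (rule LIMSEQ_le_const) (use le in blast)
    then have "?N \<in> null_sets S"
      using \<open>?N \<in> sets S\<close> by (simp only: null_sets_def S.emeasure_eq_measure measure_le_0_iff) simp
    then show ?thesis by (rule AE_I'[of ?N]) auto
  qed
  then have "AE s in S. \<forall>n. \<not> (\<forall>i\<ge>n. s i = (\<not> b))" by (subst AE_all_countable) blast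
  then show ?thesis
    by eventually_elim (auto simp: infinite_nat_iff_unbounded_le)
qed

lemma measurable_succ_before [measurable]: "(\<lambda>s. succ_before s m) \<in> measurable S (count_space UNIV)"
  unfolding succ_before_def by measurable

lemma measurable_fun_succ_before:
  "(\<lambda>s. h (succ_before s m) :: real) \<in> borel_measurable S"
  by (rule measurable_compose[OF measurable_succ_before]) simp

text \<open>An initial run of \<open>m\<close> failures suffices.\<close>

lemma prob_succ_before_0: "0 < measure S {s. succ_before s m = 0}"
proof -
  have "succ_before s m = 0" if s: "\<forall>i\<in>{0..<0+m}. s i = False" for s
  proof -
    have "\<not> (s i \<and> card {j. j < i \<and> \<not> s j} < m)" for i
    proof (cases "i < m")
      case False
      then have "{..<m} \<subseteq> {j. j < i \<and> \<not> s j}" using s by auto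
      then have "card {..<m} \<le> card {j. j < i \<and> \<not> s j}" by (intro card_mono) auto
      then show ?thesis by simp
    qed (use s in auto)
    then have "{i. s i \<and> card {j. j < i \<and> \<not> s j} < m} = {}" by blast
    then show ?thesis unfolding succ_before_def by (simp only: card.empty)
  qed
  then have "{s. \<forall>i\<in>{0..<0+m}. s i = False} \<subseteq> {s. succ_before s m = 0}" by blast
  moreover have "{s \<in> space S. succ_before s m = 0} \<in> sets S" by measurable
  ultimately have "measure S {s. \<forall>i\<in>{0..<0+m}. s i = False} \<le> measure S {s. succ_before s m = 0}"
    by (intro S.finite_measure_mono) auto
  moreover have "0 < \<epsilon> ^ m" using \<epsilon>_pos by simp
  ultimately show ?thesis using measure_all_coins(1)[of m 0 False] by linarith
qed

text \<open>An initial run of \<open>k\<close> successes is counted in full when \<open>m\<close> is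
  positive; almost surely there are infinitely many failures, so the cardinality is not the junk
  value.\<close>

lemma prob_succ_before_ge:
  assumes "1 \<le> m" shows "0 < measure S {s. k \<le> succ_before s m}"
proof -
  have "AE s in S. s \<in> {s. \<forall>i\<in>{0..<0+k}. s i = True} \<longrightarrow> s \<in> {s. k \<le> succ_before s m}"
    using AE_infinite_coins[of False]
  proof eventually_elim
    case (elim s)
    show ?case
    proof clarsimp
      assume s: "\<forall>i\<in>{0..<k}. s i"
      have "{..<k} \<subseteq> {i. s i \<and> card {j. j < i \<and> \<not> s j} < m}"
      proof
        fix i assume i: "i \<in> {..<k}"
        then have "{j. j < i \<and> \<not> s j} = {}" using s by auto
        then have "card {j. j < i \<and> \<not> s j} = 0" by (metis card.empty)
        then have "card {j. j < i \<and> \<not> s j} < m" using assms by linarith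
        with i s show "i \<in> {i. s i \<and> card {j. j < i \<and> \<not> s j} < m}" by simp
      qed
      then have "card {..<k} \<le> succ_before s m"
        unfolding succ_before_def using elim by (intro card_mono finite_succ_before) auto
      then show "k \<le> succ_before s m" by simp
    qed
  qed
  moreover have "{s \<in> space S. k \<le> succ_before s m} \<in> sets S" by measurable
  ultimately have "measure S {s. \<forall>i\<in>{0..<0+k}. s i = True} \<le> measure S {s. k \<le> succ_before s m}"
    by (intro S.finite_measure_mono_AE) auto
  moreover have "0 < \<epsilon> ^ k" using \<epsilon>_pos by simp
  ultimately show ?thesis using measure_all_coins(1)[of k 0 True] by linarith
qed

text \<open>The stopped counts no longer change after the \<open>m\<close>-th failure. Identities
  with a finite horizon can therefore be passed to \<open>succ_before\<close> by almost sure
  convergence.\<close>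

lemma eventually_sc_fl:
  assumes inf: "infinite {i. \<not> s i}"
  shows "\<forall>\<^sub>F n in sequentially. sc m n s = succ_before s m \<and> fl m n s = m"
proof -
  have fin: "finite {i. s i \<and> fails i s < m}"
    unfolding fails_def by (rule finite_succ_before[OF inf])
  then obtain n1 where n1: "\<And>i. s i \<Longrightarrow> fails i s < m \<Longrightarrow> i < n1"
    unfolding finite_nat_set_iff_bounded by auto
  obtain F where F: "finite F" "card F = m" "F \<subseteq> {i. \<not> s i}"
    using infinite_arbitrarily_large[OF inf] by blast
  then obtain n2 where n2: "\<And>i. i \<in> F \<Longrightarrow> i < n2"
    unfolding finite_nat_set_iff_bounded by auto
  have "sc m n s = succ_before s m \<and> fl m n s = m" if n: "n \<ge> max n1 n2" for n
  proof
    have "{i. i < n \<and> s i \<and> fails i s < m} = {i. s i \<and> fails i s < m}"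
      using n1 n by force
    then show "sc m n s = succ_before s m"
      unfolding sc_def succ_before_def fails_def by simp
    have "F \<subseteq> {j. j < n \<and> \<not> s j}"
      using F(3) n2 n by force
    then have "card F \<le> fails n s" unfolding fails_def by (intro card_mono) auto
    then show "fl m n s = m" using F by (simp add: fl_def)
  qed
  then show ?thesis unfolding eventually_sequentially by blast
qed

lemma AE_sc_fl_tendsto:
  "AE s in S. (\<lambda>n. \<phi> (sc m n s) (fl m n s) :: real) \<longlonglongrightarrow> \<phi> (succ_before s m) m"
  using AE_infinite_coins[of False]
proof eventually_elim
  case (elim s)
  then have "infinite {i. \<not> s i}" by simp
  then show ?case
    by (intro tendsto_eventually eventually_mono[OF eventually_sc_fl[of s m]]) auto
qed

section \<open>The compensated walk and its fourth moment\<close>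

definition drift :: "nat \<Rightarrow> real" where "drift t = (\<Sum>i<t. 2 * q i - 1)"

text \<open>The compensator of the square of \<open>Y\<close>: a step of size 1 up or down has
  variance \<open>4 * q i * (1 - q i)\<close>.\<close>

definition var :: "nat \<Rightarrow> real" where "var t = (\<Sum>i<t. 4 * q i * (1 - q i))"

text \<open>The martingale part of the number of successes minus the number of failures.\<close>

definition Y :: "nat \<Rightarrow> nat \<Rightarrow> real" where "Y a b = real a - real b - drift (a + b)"

lemma Y_0 [simp]: "Y 0 0 = 0" by (simp add: Y_def drift_def)

lemma Y_Suc: "Y (Suc a) b = Y a b + 2 * (1 - q (a + b))" "Y a (Suc b) = Y a b - 2 * q (a + b)"
  by (simp_all add: Y_def drift_def algebra_simps)

text \<open>The sum \<open>b + c\<close> of the constants of \<open>quartic_step\<close>, which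
  bounds the initial value of that supermartingale in units of \<open>m\<^sup>2\<close>.\<close>

definition C4 :: real where "C4 = 20 / \<epsilon> / \<epsilon> + (8 + 4 * (20 / \<epsilon>)) / \<epsilon>"

text \<open>The function of \<open>quartic_step\<close>, taken at the number of failures still
  missing, dominates the fourth power and decreases in the mean; its value at the start is
  \<open>b * m\<^sup>2 + c * m\<close>.\<close>

lemma integral_Y4_le:
  assumes "1 \<le> m"
  shows "(\<integral>s. Y (sc m n s) (fl m n s) ^ 4 \<partial>S) \<le> C4 * real m ^ 2"
proof -
  define a where "a = 20 / \<epsilon>"
  define b where "b = a / \<epsilon>"
  define c where "c = (8 + 4 * a) / \<epsilon>"
  define \<Psi> where "\<Psi> y r = y ^ 4 + a * y\<^sup>2 * r + b * r\<^sup>2 + c * r" for y r :: real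
  have abc: "a \<ge> 0" "b \<ge> 0" "c \<ge> 0" "C4 = b + c" using \<epsilon>_pos by (auto simp: a_def b_def c_def C4_def)
  have "(\<integral>s. Y (sc m n s) (fl m n s) ^ 4 \<partial>S) \<le> (\<integral>s. \<Psi> (Y (sc m n s) (fl m n s)) (real m - real (fl m n s)) \<partial>S)"
    by (rule integral_mono[OF integrable_sc_fl[of "\<lambda>a b. Y a b ^ 4"] integrable_sc_fl[of "\<lambda>a b. \<Psi> (Y a b) (real m - real b)"]])
       (use abc in \<open>auto simp: \<Psi>_def fl_le\<close>)
  also have "\<dots> \<le> \<Psi> (Y 0 0) (real m - real 0)"
  proof (rule integral_sc_fl_le[of m "\<lambda>a b. \<Psi> (Y a b) (real m - real b)"])
    fix u v assume "v < m"
    then have "1 \<le> real m - real v" by linarith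
    from quartic_step[OF this \<epsilon>_pos q_ge q_le, of "u + v" "Y u v"]
    show "q (u + v) * \<Psi> (Y (Suc u) v) (real m - real v) + (1 - q (u + v)) * \<Psi> (Y u (Suc v)) (real m - real (Suc v))
        \<le> \<Psi> (Y u v) (real m - real v)"
      unfolding \<Psi>_def a_def b_def c_def Y_Suc by (simp add: algebra_simps)
  qed
  also have "\<dots> = b * real m ^ 2 + c * real m" by (simp add: \<Psi>_def)
  also have "\<dots> \<le> b * real m ^ 2 + c * real m ^ 2"
    using abc assms by (intro add_left_mono mult_left_mono) (auto simp: power2_eq_square)
  finally show ?thesis by (simp add: abc algebra_simps)
qed

end

section \<open>Moments of the number of successes before the m-th failure\<close>

locale coins_bdd = coins +
  fixes B :: real
  assumes drift_le: "\<bar>drift t\<bar> \<le> B"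
begin

lemma B_nonneg: "0 \<le> B" using drift_le[of 0] by simp

abbreviation trials :: "nat \<Rightarrow> (nat \<Rightarrow> bool) \<Rightarrow> nat" where
  "trials m s \<equiv> succ_before s m + m"

abbreviation Yinf :: "nat \<Rightarrow> (nat \<Rightarrow> bool) \<Rightarrow> real" where
  "Yinf m s \<equiv> Y (succ_before s m) m"

lemma measurable_Yinf [measurable]: "Yinf m \<in> borel_measurable S"
  by (rule measurable_compose[OF measurable_succ_before]) simp

text \<open>Fatou's lemma carries the bound, which is uniform in the horizon \<open>n\<close>, over
  to the \<open>m\<close>-th failure.\<close>

lemma nn_integral_Yinf4:
  assumes "1 \<le> m"
  shows "(\<integral>\<^sup>+s. ennreal (Yinf m s ^ 4) \<partial>S) \<le> ennreal (C4 * real m ^ 2)"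
proof -
  have "(\<integral>\<^sup>+s. ennreal (Yinf m s ^ 4) \<partial>S) =
      (\<integral>\<^sup>+s. liminf (\<lambda>n. ennreal (Y (sc m n s) (fl m n s) ^ 4)) \<partial>S)"
  proof (rule nn_integral_cong_AE)
    show "AE s in S. ennreal (Yinf m s ^ 4) = liminf (\<lambda>n. ennreal (Y (sc m n s) (fl m n s) ^ 4))"
      using AE_sc_fl_tendsto[of "\<lambda>a b. Y a b ^ 4" m]
    proof eventually_elim
      case (elim s)
      then have "(\<lambda>n. ennreal (Y (sc m n s) (fl m n s) ^ 4)) \<longlonglongrightarrow> ennreal (Yinf m s ^ 4)"
        by (rule tendsto_ennrealI)
      then show ?case using lim_imp_Liminf[OF sequentially_bot] by metis
    qed
  qed
  also have "\<dots> \<le> liminf (\<lambda>n. \<integral>\<^sup>+s. ennreal (Y (sc m n s) (fl m n s) ^ 4) \<partial>S)"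
    using measurable_depends_on[OF depends_on_sc_fl[of _ "\<lambda>a b. Y a b ^ 4"]]
    by (intro nn_integral_liminf) simp
  also have "\<dots> \<le> liminf (\<lambda>n::nat. ennreal (C4 * real m ^ 2))"
  proof (intro Liminf_mono always_eventually allI)
    fix n
    have "(\<integral>\<^sup>+s. ennreal (Y (sc m n s) (fl m n s) ^ 4) \<partial>S) = ennreal (\<integral>s. Y (sc m n s) (fl m n s) ^ 4 \<partial>S)"
      by (rule nn_integral_eq_integral[OF integrable_sc_fl[of "\<lambda>a b. Y a b ^ 4"]]) simp
    also have "\<dots> \<le> ennreal (C4 * real m ^ 2)"
      by (rule ennreal_leI[OF integral_Y4_le[OF assms]])
    finally show "(\<integral>\<^sup>+s. ennreal (Y (sc m n s) (fl m n s) ^ 4) \<partial>S) \<le> ennreal (C4 * real m ^ 2)" .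
  qed
  also have "\<dots> = ennreal (C4 * real m ^ 2)" by (simp add: Liminf_const)
  finally show ?thesis .
qed

lemma C4_nonneg: "0 \<le> C4"
  using \<epsilon>_pos by (simp add: C4_def)

lemma Yinf4:
  assumes "1 \<le> m"
  shows "integrable S (\<lambda>s. Yinf m s ^ 4)" "(\<integral>s. Yinf m s ^ 4 \<partial>S) \<le> C4 * real m ^ 2"
proof -
  show "integrable S (\<lambda>s. Yinf m s ^ 4)"
    using order.strict_trans1[OF nn_integral_Yinf4[OF assms] ennreal_less_top] by (intro integrableI_nonneg) auto
  show "(\<integral>s. Yinf m s ^ 4 \<partial>S) \<le> C4 * real m ^ 2"
    using nn_integral_Yinf4[OF assms] C4_nonneg
    by (subst integral_eq_nn_integral) (auto simp: enn2real_leI)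
qed

lemma Yinf2_integrable:
  assumes "1 \<le> m"
  shows "integrable S (\<lambda>s. (Yinf m s)\<^sup>2)"
proof (rule Bochner_Integration.integrable_bound)
  show "integrable S (\<lambda>s. 1 + Yinf m s ^ 4)" using Yinf4(1)[OF assms] by simp
  have "y\<^sup>2 \<le> 1 + y ^ 4" for y :: real
    using zero_le_power2[of "y\<^sup>2 - 1"] by (simp add: power2_diff power_mult[symmetric]) (smt (verit) zero_le_power2)
  then show "AE s in S. norm ((Yinf m s)\<^sup>2) \<le> norm (1 + Yinf m s ^ 4)" by simp
qed measurable

lemma Yinf_integrable:
  assumes "1 \<le> m"
  shows "integrable S (Yinf m)"
proof (rule Bochner_Integration.integrable_bound)
  show "integrable S (\<lambda>s. 1 + (Yinf m s)\<^sup>2)" using Yinf2_integrable[OF assms] by simp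
  have "\<bar>y\<bar> \<le> 1 + y\<^sup>2" for y :: real
    using zero_le_power2[of "\<bar>y\<bar> - 1"] zero_le_power2[of y] by (simp add: power2_diff del: zero_le_power2)
  then show "AE s in S. norm (Yinf m s) \<le> norm (1 + (Yinf m s)\<^sup>2)" by simp
qed measurable

abbreviation W :: "nat \<Rightarrow> (nat \<Rightarrow> bool) \<Rightarrow> real" where
  "W m s \<equiv> \<bar>Yinf m s\<bar> + 2 * real m + 2 * B"

text \<open>The counts grow with \<open>n\<close>, so their final values dominate them, and the
  final number of successes is recovered from \<open>Yinf\<close> because the drift is bounded. The
  moment bounds on \<open>Yinf\<close> thus supply an integrable dominating function.\<close>

lemma AE_bounds:
  "AE s in S. \<forall>n. real (sc m n s + fl m n s) \<le> W m s \<and>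
     \<bar>Y (sc m n s) (fl m n s)\<bar> \<le> W m s"
  using AE_infinite_coins[of False]
proof eventually_elim
  case (elim s)
  then have inf: "infinite {i. \<not> s i}" by simp
  have "sc m n s \<le> succ_before s m" for n
    unfolding sc_def succ_before_def fails_def
    by (intro card_mono finite_succ_before inf) auto
  then have "real (sc m n s) \<le> real (succ_before s m)" for n by simp
  moreover have "real (succ_before s m) \<le> \<bar>Yinf m s\<bar> + real m + B"
    using drift_le[of "succ_before s m + m"] unfolding Y_def by linarith
  moreover have "real (fl m n s) \<le> real m" for n by (simp add: fl_le)
  ultimately have *: "real (sc m n s + fl m n s) \<le> \<bar>Yinf m s\<bar> + 2 * real m + B" for n
    unfolding of_nat_add by (smt (verit))
  then show ?case
  proof (intro allI conjI)
    fix n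
    show "real (sc m n s + fl m n s) \<le> W m s" using *[of n] B_nonneg by linarith
    show "\<bar>Y (sc m n s) (fl m n s)\<bar> \<le> W m s"
      using *[of n] drift_le[of "sc m n s + fl m n s"] unfolding Y_def by linarith
  qed
qed

lemma W_integrable:
  assumes "1 \<le> m"
  shows "integrable S (W m)"
    "integrable S (\<lambda>s. (W m s)\<^sup>2)"
  using Yinf2_integrable[OF assms] Yinf_integrable[OF assms]
  by (simp_all add: power2_eq_square algebra_simps)

text \<open>Wald's first identity: optional stopping of the martingale \<open>Y\<close>, with
  dominated convergence.\<close>

lemma integral_Yinf:
  assumes "1 \<le> m" shows "(\<integral>s. Yinf m s \<partial>S) = 0"
proof -
  have "(\<lambda>n. \<integral>s. Y (sc m n s) (fl m n s) \<partial>S) \<longlonglongrightarrow> (\<integral>s. Yinf m s \<partial>S)"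
  proof (rule integral_dominated_convergence[where w = "W m"])
    show "integrable S (W m)" by (rule W_integrable(1)[OF assms])
    show "AE s in S. (\<lambda>n. Y (sc m n s) (fl m n s)) \<longlonglongrightarrow> Yinf m s" by (rule AE_sc_fl_tendsto)
    show "AE s in S. norm (Y (sc m n s) (fl m n s)) \<le> W m s" for n
      using AE_bounds[of m] by eventually_elim simp
    show "(\<lambda>s. Y (sc m n s) (fl m n s)) \<in> borel_measurable S" for n
      by (rule measurable_depends_on[OF depends_on_sc_fl])
  qed measurable
  moreover have "(\<integral>s. Y (sc m n s) (fl m n s) \<partial>S) = Y 0 0" for n
    by (rule integral_sc_fl_eq) (simp add: Y_Suc algebra_simps)
  ultimately show ?thesis by (simp add: LIMSEQ_const_iff)
qed

lemma var_Suc: "var (Suc t) = var t + 4 * q t * (1 - q t)" by (simp add: var_def)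

lemma var_bounds: "0 \<le> var t" "var t \<le> real t"
proof -
  show "0 \<le> var t" unfolding var_def using q_bounds by (intro sum_nonneg) (simp add: less_imp_le)
  have "var t \<le> (\<Sum>i<t. 1)" unfolding var_def
  proof (rule sum_mono)
    fix i show "4 * q i * (1 - q i) \<le> 1"
      using zero_le_power2[of "1 - 2 * q i"] by (simp add: power2_eq_square algebra_simps)
  qed
  then show "var t \<le> real t" by simp
qed

text \<open>Wald's second identity, from the martingale formed by the square of \<open>Y\<close>
  minus \<open>var\<close>.\<close>

lemma integral_Yinf2:
  assumes "1 \<le> m" shows "(\<integral>s. (Yinf m s)\<^sup>2 - var (trials m s) \<partial>S) = 0"
proof -
  let ?\<phi> = "\<lambda>a b. (Y a b)\<^sup>2 - var (a + b)"
  have "(\<lambda>n. \<integral>s. ?\<phi> (sc m n s) (fl m n s) \<partial>S) \<longlonglongrightarrow> (\<integral>s. ?\<phi> (succ_before s m) m \<partial>S)"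
  proof (rule integral_dominated_convergence[where
        w = "\<lambda>s. (W m s)\<^sup>2 + (W m s)"])
    show "integrable S (\<lambda>s. (W m s)\<^sup>2 + (W m s))"
      by (intro Bochner_Integration.integrable_add W_integrable[OF assms])
    show "AE s in S. (\<lambda>n. ?\<phi> (sc m n s) (fl m n s)) \<longlonglongrightarrow> ?\<phi> (succ_before s m) m"
      by (rule AE_sc_fl_tendsto)
    show "AE s in S. norm (?\<phi> (sc m n s) (fl m n s)) \<le>
        (W m s)\<^sup>2 + (W m s)" for n
      using AE_bounds[of m]
    proof eventually_elim
      case (elim s)
      let ?w = "W m s"
      have "real (sc m n s + fl m n s) \<le> ?w" "\<bar>Y (sc m n s) (fl m n s)\<bar> \<le> ?w" using elim by blast+
      moreover from this(2) have "(Y (sc m n s) (fl m n s))\<^sup>2 \<le> ?w\<^sup>2"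
        by (metis abs_ge_zero power2_abs power_mono)
      ultimately show ?case using var_bounds[of "sc m n s + fl m n s"]
        zero_le_power2[of "Y (sc m n s) (fl m n s)"] zero_le_power2[of ?w]
        unfolding real_norm_def by linarith
    qed
    show "(\<lambda>s. ?\<phi> (sc m n s) (fl m n s)) \<in> borel_measurable S" for n
      by (rule measurable_depends_on[OF depends_on_sc_fl])
    show "(\<lambda>s. ?\<phi> (succ_before s m) m) \<in> borel_measurable S"
      by (rule measurable_compose[OF measurable_succ_before]) simp
  qed
  moreover have "(\<integral>s. ?\<phi> (sc m n s) (fl m n s) \<partial>S) = ?\<phi> 0 0" for n
    by (rule integral_sc_fl_eq) (simp add: Y_Suc var_Suc power2_eq_square algebra_simps)
  ultimately show ?thesis by (simp add: LIMSEQ_const_iff var_def)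
qed

definition Z :: "nat \<Rightarrow> (nat \<Rightarrow> bool) \<Rightarrow> real" where "Z m s = real (succ_before s m) - real m"

text \<open>By \<open>R_eq\<close> this is the amount by which the variance of \<open>t\<close>
  steps falls short of \<open>t\<close>. It can be unbounded although the drift is bounded, as
  convergence of the series need not be absolute.\<close>

definition R :: "nat \<Rightarrow> real" where "R t = (\<Sum>i<t. (2 * q i - 1)\<^sup>2)"

abbreviation mean_R :: "nat \<Rightarrow> real" where "mean_R m \<equiv> \<integral>s. R (trials m s) \<partial>S"

lemma Z_eq: "Z m s = Yinf m s + drift (trials m s)"
  by (simp add: Z_def Y_def)

declare measurable_fun_succ_before [measurable]

lemma measurable_Z [measurable]: "Z m \<in> borel_measurable S"
  unfolding Z_def by measurable

lemma drift_integrable: "integrable S (\<lambda>s. drift (trials m s))"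
  by (rule S.integrable_const_bound[of _ B]) (use drift_le in auto)

lemma Z_integrable: "1 \<le> m \<Longrightarrow> integrable S (Z m)"
  unfolding Z_eq[abs_def] by (intro Bochner_Integration.integrable_add Yinf_integrable drift_integrable)

lemma integral_Z: "1 \<le> m \<Longrightarrow> (\<integral>s. Z m s \<partial>S) = (\<integral>s. drift (trials m s) \<partial>S)"
  unfolding Z_eq by (simp add: Yinf_integrable drift_integrable integral_Yinf)

lemma R_eq: "R t = real t - var t"
proof -
  have "(2 * q i - 1)\<^sup>2 = 1 - 4 * q i * (1 - q i)" for i by (simp add: power2_eq_square algebra_simps)
  then show ?thesis by (simp add: R_def var_def sum_subtractf)
qed

lemma R_integrable:
  assumes "1 \<le> m" shows "integrable S (\<lambda>s. R (trials m s))"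
proof (rule Bochner_Integration.integrable_bound)
  show "integrable S (\<lambda>s. Z m s + 2 * real m)" using Z_integrable[OF assms] by simp
  show "AE s in S. norm (R (trials m s)) \<le> norm (Z m s + 2 * real m)"
  proof (intro AE_I2)
    fix s
    show "norm (R (trials m s)) \<le> norm (Z m s + 2 * real m)"
      using var_bounds[of "succ_before s m + m"] by (simp add: R_eq Z_def)
  qed
qed measurable

text \<open>The number of trials is \<open>2 * m + Z m s\<close>, and \<open>var\<close> falls short
  of it by \<open>R\<close>; the rest is Wald's two identities.\<close>

lemma integral_Yinf2':
  assumes m: "1 \<le> m"
  shows "(\<integral>s. (Yinf m s)\<^sup>2 \<partial>S) =
    2 * real m + (\<integral>s. drift (trials m s) \<partial>S) - mean_R m"
proof -
  have "(\<integral>s. (Yinf m s)\<^sup>2 \<partial>S) - (\<integral>s. Z m s + 2 * real m - R (trials m s) \<partial>S) =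
     (\<integral>s. (Yinf m s)\<^sup>2 - (Z m s + 2 * real m - R (trials m s)) \<partial>S)"
    using Yinf2_integrable[OF m] Z_integrable[OF m] R_integrable[OF m] by simp
  also have "\<dots> = (\<integral>s. (Yinf m s)\<^sup>2 - var (trials m s) \<partial>S)"
    by (simp add: R_eq Z_def algebra_simps)
  finally have "(\<integral>s. (Yinf m s)\<^sup>2 \<partial>S) = (\<integral>s. Z m s + 2 * real m - R (trials m s) \<partial>S)"
    using integral_Yinf2[OF m] by simp
  also have "\<dots> = (\<integral>s. Z m s \<partial>S) + 2 * real m - mean_R m"
    using Z_integrable[OF m] R_integrable[OF m] by simp
  finally show ?thesis using integral_Z[OF m] by simp
qed

lemma abs_integral_drift_le: "\<bar>\<integral>s. drift (trials m s) \<partial>S\<bar> \<le> B"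
proof -
  have "(\<integral>s. drift (trials m s) \<partial>S) \<le> (\<integral>s. B \<partial>S)"
    using drift_le by (intro integral_mono drift_integrable) (auto simp: abs_le_iff)
  moreover have "(\<integral>s. - B \<partial>S) \<le> (\<integral>s. drift (trials m s) \<partial>S)"
    using drift_le abs_le_D2 minus_le_iff by (intro integral_mono drift_integrable) (auto, smt (verit))
  ultimately show ?thesis by simp
qed

lemma R_nonneg: "0 \<le> R t" unfolding R_def by (intro sum_nonneg) auto

lemma integral_R_nonneg: "0 \<le> mean_R m"
  using R_nonneg by (intro Bochner_Integration.integral_nonneg)

lemma Z2_integrable:
  assumes m: "1 \<le> m" shows "integrable S (\<lambda>s. (Z m s)\<^sup>2)"
proof (rule Bochner_Integration.integrable_bound)
  show "integrable S (\<lambda>s. (W m s)\<^sup>2)" by (rule W_integrable[OF m])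
  have "\<bar>Z m s\<bar> \<le> W m s" for s
    using drift_le[of "succ_before s m + m"] B_nonneg unfolding Z_eq by linarith
  then have "(Z m s)\<^sup>2 \<le> (W m s)\<^sup>2" for s
    by (metis abs_ge_zero power2_abs power_mono)
  then show "AE s in S. norm ((Z m s)\<^sup>2) \<le> norm ((W m s)\<^sup>2)" by simp
qed measurable

text \<open>The cross term is linear in \<open>Yinf\<close>. Weighted AM-GM, 2 |y| <= y^2 / sqrt m +
  sqrt m, keeps its mean of order sqrt m because the second moment of \<open>Yinf\<close> is of
  order \<open>m\<close>.\<close>

lemma integral_Z2_near:
  assumes m: "1 \<le> m"
  shows "\<bar>(\<integral>s. (Z m s)\<^sup>2 \<partial>S) - (\<integral>s. (Yinf m s)\<^sup>2 \<partial>S)\<bar> \<le> (3 * B + 2 * B\<^sup>2) * sqrt (real m)"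
proof -
  let ?r = "sqrt (real m)"
  have r: "1 \<le> ?r" "?r * ?r = real m" using m by auto
  have pw: "\<bar>(Z m s)\<^sup>2 - (Yinf m s)\<^sup>2\<bar> \<le> B * ((Yinf m s)\<^sup>2 / ?r + ?r) + B\<^sup>2" for s
  proof -
    let ?y = "Yinf m s" and ?d = "drift (trials m s)"
    have "(Z m s)\<^sup>2 - ?y\<^sup>2 = 2 * ?y * ?d + ?d\<^sup>2" unfolding Z_eq by (simp add: power2_eq_square algebra_simps)
    moreover have "\<bar>2 * ?y * ?d\<bar> \<le> (2 * \<bar>?y\<bar>) * B"
      unfolding abs_mult using drift_le by (intro mult_mono) auto
    moreover have "2 * \<bar>?y\<bar> \<le> ?y\<^sup>2 / ?r + ?r"
    proof -
      have "0 \<le> (\<bar>?y\<bar> - ?r)\<^sup>2 / ?r" using r by simp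
      also have "\<dots> = ?y\<^sup>2 / ?r + ?r - 2 * \<bar>?y\<bar>" using r
        by (simp add: power2_eq_square field_simps)
      finally show ?thesis by simp
    qed
    then have "(2 * \<bar>?y\<bar>) * B \<le> (?y\<^sup>2 / ?r + ?r) * B" using B_nonneg by (intro mult_right_mono)
    moreover have "?d\<^sup>2 \<le> B\<^sup>2" using drift_le by (metis abs_ge_zero power2_abs power_mono)
    ultimately show ?thesis using zero_le_power2[of ?d] unfolding mult.commute[of B] by linarith
  qed
  have "(\<integral>s. (Yinf m s)\<^sup>2 \<partial>S) \<le> 2 * real m + B"
    using integral_Yinf2'[OF m] abs_integral_drift_le[of m] integral_R_nonneg[of m] by linarith
  then have y2: "(\<integral>s. (Yinf m s)\<^sup>2 \<partial>S) / ?r \<le> 2 * ?r + B"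
  proof -
    have "(\<integral>s. (Yinf m s)\<^sup>2 \<partial>S) \<le> (2 * ?r + B) * ?r"
    proof -
      have "(2 * ?r + B) * ?r = 2 * (?r * ?r) + B * ?r" by (simp add: algebra_simps)
      with \<open>(\<integral>s. (Yinf m s)\<^sup>2 \<partial>S) \<le> 2 * real m + B\<close> mult_left_mono[OF r(1) B_nonneg]
      show ?thesis unfolding r(2) by linarith
    qed
    then show ?thesis using r by (subst pos_divide_le_eq) auto
  qed
  have "\<bar>(\<integral>s. (Z m s)\<^sup>2 \<partial>S) - (\<integral>s. (Yinf m s)\<^sup>2 \<partial>S)\<bar> = \<bar>\<integral>s. (Z m s)\<^sup>2 - (Yinf m s)\<^sup>2 \<partial>S\<bar>"
    using Z2_integrable[OF m] Yinf2_integrable[OF m] by simp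
  also have "\<dots> \<le> (\<integral>s. \<bar>(Z m s)\<^sup>2 - (Yinf m s)\<^sup>2\<bar> \<partial>S)" by (rule integral_abs_bound)
  also have "\<dots> \<le> (\<integral>s. B * ((Yinf m s)\<^sup>2 / ?r + ?r) + B\<^sup>2 \<partial>S)"
    using Z2_integrable[OF m] Yinf2_integrable[OF m] pw by (intro integral_mono) auto
  also have "\<dots> = B * ((\<integral>s. (Yinf m s)\<^sup>2 \<partial>S) / ?r + ?r) + B\<^sup>2"
    using Yinf2_integrable[OF m] by simp
  also have "\<dots> \<le> B * (2 * ?r + B + ?r) + B\<^sup>2" using y2 B_nonneg by (intro add_right_mono mult_left_mono) auto
  also have "\<dots> = 3 * B * ?r + 2 * B\<^sup>2 * 1" by (simp add: power2_eq_square algebra_simps)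
  also have "\<dots> \<le> 3 * B * ?r + 2 * B\<^sup>2 * ?r" using r by (intro add_left_mono mult_left_mono) auto
  finally show ?thesis by (simp add: algebra_simps)
qed

text \<open>The constant of \<open>integral_Z2_near\<close> plus \<open>B\<close>, which absorbs the
  mean drift.\<close>

definition K2 :: real where "K2 = 4 * B + 2 * B\<^sup>2"

lemma integral_Z2_le: "1 \<le> m \<Longrightarrow> (\<integral>s. (Z m s)\<^sup>2 \<partial>S) \<le> 2 * real m + K2 * sqrt (real m)"
proof -
  assume m: "1 \<le> m"
  have "B * 1 \<le> B * sqrt (real m)" using m B_nonneg by (intro mult_left_mono) auto
  with integral_Z2_near[OF m] integral_Yinf2'[OF m] abs_integral_drift_le[of m] integral_R_nonneg[of m]
  show ?thesis unfolding K2_def abs_le_iff ring_distribs by linarith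
qed

lemma integral_Z2_ge:
  "1 \<le> m \<Longrightarrow> 2 * real m - K2 * sqrt (real m) - mean_R m \<le> (\<integral>s. (Z m s)\<^sup>2 \<partial>S)"
proof -
  assume m: "1 \<le> m"
  have "B * 1 \<le> B * sqrt (real m)" using m B_nonneg by (intro mult_left_mono) auto
  with integral_Z2_near[OF m] integral_Yinf2'[OF m] abs_integral_drift_le[of m]
  show ?thesis unfolding K2_def abs_le_iff ring_distribs by linarith
qed

definition K4 :: real where "K4 = 8 * C4 + 8 * B ^ 4"

lemma Z4_le: "Z m s ^ 4 \<le> 8 * Yinf m s ^ 4 + 8 * B ^ 4"
proof -
  let ?y = "Yinf m s" and ?d = "drift (trials m s)"
  have sq: "(x + y)\<^sup>2 \<le> 2 * x\<^sup>2 + 2 * y\<^sup>2" for x y :: real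
    using zero_le_power2[of "x - y"] by (simp add: power2_sum power2_diff)
  have "Z m s ^ 4 = ((?y + ?d)\<^sup>2)\<^sup>2" unfolding Z_eq by (simp add: power_mult[symmetric])
  also have "\<dots> \<le> (2 * ?y\<^sup>2 + 2 * ?d\<^sup>2)\<^sup>2" by (intro power_mono sq) auto
  also have "\<dots> \<le> 2 * (2 * ?y\<^sup>2)\<^sup>2 + 2 * (2 * ?d\<^sup>2)\<^sup>2" by (rule sq)
  also have "\<dots> = 8 * ?y ^ 4 + 8 * \<bar>?d\<bar> ^ 4" by (simp add: power_mult_distrib power_mult[symmetric])
  also have "\<dots> \<le> 8 * ?y ^ 4 + 8 * B ^ 4" using drift_le by (intro add_left_mono mult_left_mono power_mono) auto
  finally show ?thesis .
qed

lemma Z4: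
  assumes m: "1 \<le> m"
  shows "integrable S (\<lambda>s. Z m s ^ 4)" "(\<integral>s. Z m s ^ 4 \<partial>S) \<le> K4 * real m ^ 2"
proof -
  have i: "integrable S (\<lambda>s. 8 * Yinf m s ^ 4 + 8 * B ^ 4)" using Yinf4(1)[OF m] by simp
  show *: "integrable S (\<lambda>s. Z m s ^ 4)"
    by (rule Bochner_Integration.integrable_bound[OF i]) (use Z4_le in auto)
  have "(\<integral>s. Z m s ^ 4 \<partial>S) \<le> (\<integral>s. 8 * Yinf m s ^ 4 + 8 * B ^ 4 \<partial>S)"
    using * i by (rule integral_mono) (rule Z4_le)
  also have "\<dots> = 8 * (\<integral>s. Yinf m s ^ 4 \<partial>S) + 8 * B ^ 4 * 1" using Yinf4(1)[OF m] by simp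
  also have "\<dots> \<le> 8 * (C4 * real m ^ 2) + 8 * B ^ 4 * real m ^ 2"
    using m Yinf4(2)[OF m] by (intro add_mono mult_left_mono) auto
  finally show "(\<integral>s. Z m s ^ 4 \<partial>S) \<le> K4 * real m ^ 2" by (simp add: K4_def algebra_simps)
qed

definition K3 :: real where "K3 = 2 + K2 + K4"

text \<open>Interpolation between the second and the fourth moment by weighted AM-GM; the weight
  sqrt m makes both contributions of order m^(3/2).\<close>

lemma Z3:
  assumes m: "1 \<le> m"
  shows "integrable S (\<lambda>s. \<bar>Z m s\<bar> ^ 3)" "(\<integral>s. \<bar>Z m s\<bar> ^ 3 \<partial>S) \<le> K3 * (real m * sqrt (real m))"
proof -
  let ?r = "sqrt (real m)"
  have r: "1 \<le> ?r" "?r * ?r = real m" using m by auto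
  have pw: "\<bar>z\<bar> ^ 3 \<le> ?r * z\<^sup>2 + z ^ 4 / ?r" for z :: real
  proof -
    have "0 \<le> z\<^sup>2 * (\<bar>z\<bar> - ?r)\<^sup>2 / ?r" using r by simp
    also have "\<dots> = ?r * z\<^sup>2 + z ^ 4 / ?r - 2 * \<bar>z\<bar> ^ 3"
      using r by (simp add: power2_eq_square power3_eq_cube power4_eq_xxxx field_simps abs_mult_self_eq)
    finally show ?thesis using zero_le_power_abs[of z 3] by linarith
  qed
  have i: "integrable S (\<lambda>s. ?r * (Z m s)\<^sup>2 + Z m s ^ 4 / ?r)" using Z2_integrable[OF m] Z4(1)[OF m] by simp
  show *: "integrable S (\<lambda>s. \<bar>Z m s\<bar> ^ 3)"
    by (rule Bochner_Integration.integrable_bound[OF i]) (use pw r in \<open>auto simp: abs_of_nonneg\<close>)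
  have "(\<integral>s. \<bar>Z m s\<bar> ^ 3 \<partial>S) \<le> (\<integral>s. ?r * (Z m s)\<^sup>2 + Z m s ^ 4 / ?r \<partial>S)"
    using * i by (rule integral_mono) (rule pw)
  also have "\<dots> = ?r * (\<integral>s. (Z m s)\<^sup>2 \<partial>S) + (\<integral>s. Z m s ^ 4 \<partial>S) / ?r"
    using Z2_integrable[OF m] Z4(1)[OF m] by simp
  also have "\<dots> \<le> ?r * (2 * real m + K2 * ?r) + (K4 * real m ^ 2) / ?r"
    using integral_Z2_le[OF m] Z4(2)[OF m] r by (intro add_mono mult_left_mono divide_right_mono) auto
  also have "(K4 * real m ^ 2) / ?r = K4 * (real m * ?r)"
    using r by (simp add: field_simps power2_eq_square)
  also have "?r * (2 * real m + K2 * ?r) = 2 * (real m * ?r) + K2 * (real m * 1)"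
    using r by (simp add: algebra_simps)
  also have "\<dots> \<le> 2 * (real m * ?r) + K2 * (real m * ?r)"
    using r B_nonneg by (intro add_left_mono mult_left_mono) (auto simp: K2_def)
  finally show "(\<integral>s. \<bar>Z m s\<bar> ^ 3 \<partial>S) \<le> K3 * (real m * ?r)"
    by (simp add: K3_def algebra_simps)
qed

end

section \<open>Lyapunov functions\<close>

context coins_bdd
begin

lemma integral_Z_poly:
  assumes m: "1 \<le> m"
  shows "integrable S (\<lambda>s. c0 + c1 * Z m s + c2 * (Z m s)\<^sup>2 + c3 * \<bar>Z m s\<bar> ^ 3 + c4 * Z m s ^ 4)" (is ?int)
    "(\<integral>s. c0 + c1 * Z m s + c2 * (Z m s)\<^sup>2 + c3 * \<bar>Z m s\<bar> ^ 3 + c4 * Z m s ^ 4 \<partial>S) =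
      c0 + c1 * (\<integral>s. Z m s \<partial>S) + c2 * (\<integral>s. (Z m s)\<^sup>2 \<partial>S) + c3 * (\<integral>s. \<bar>Z m s\<bar> ^ 3 \<partial>S)
      + c4 * (\<integral>s. Z m s ^ 4 \<partial>S)" (is ?eq)
proof -
  have i: "integrable S (Z m)" "integrable S (\<lambda>s. (Z m s)\<^sup>2)" "integrable S (\<lambda>s. \<bar>Z m s\<bar> ^ 3)"
      "integrable S (\<lambda>s. Z m s ^ 4)"
    using Z_integrable[OF m] Z2_integrable[OF m] Z3(1)[OF m] Z4(1)[OF m] by auto
  show ?int using i by simp
  show ?eq using i by simp
qed

lemma ln_succ_before:
  defines "x \<equiv> \<lambda>m s. Z m s / (real m + 3)"
  shows "ln (real (succ_before s m) + 3) = ln (real m + 3) + ln (1 + x m s)" "-1 < x m s"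
proof -
  have *: "1 + x m s = (real (succ_before s m) + 3) / (real m + 3)"
    by (simp add: x_def Z_def field_simps)
  show "ln (real (succ_before s m) + 3) = ln (real m + 3) + ln (1 + x m s)"
    unfolding * by (simp add: ln_div)
  have "0 < 1 + x m s" unfolding * by simp
  then show "-1 < x m s" by simp
qed

lemma sqrt_ln_integrable:
  assumes m: "1 \<le> m"
  shows "integrable S (\<lambda>s. sqrt (ln (real (succ_before s m) + 3)))"
proof (rule Bochner_Integration.integrable_bound)
  show "integrable S (\<lambda>s. Z m s + real m + 3)" using Z_integrable[OF m] by simp
  have "sqrt (ln (real k + 3)) \<le> real k + 3" for k
  proof -
    have "ln (real k + 3) \<le> real k + 3 - 1" by (rule ln_le_minus_one) simp
    also have "\<dots> \<le> (real k + 3) * (real k + 3)" by (simp add: algebra_simps)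
    finally show ?thesis by (intro real_le_lsqrt) (auto simp: power2_eq_square)
  qed
  then show "AE s in S. norm (sqrt (ln (real (succ_before s m) + 3))) \<le> norm (Z m s + real m + 3)"
    by (simp add: Z_def)
qed measurable

text \<open>With \<open>a\<close> and \<open>v\<close> the first two moments of \<open>Z m\<close>,
  the change multiplied by \<open>L\<^sup>2 * M\<close> and divided by \<open>sqrt L\<close> is, to
  leading order, \<open>L / 2 * (a - v / (2 * M)) - v / (8 * M)\<close>. Bounding \<open>v\<close>
  from below costs \<open>mean_R\<close>, which is why it occurs in \<open>H1\<close> and
  \<open>H2\<close>; what remains is the deterministic inequality \<open>big\<close>.\<close>

lemma lyapunov_sqrt_ln_step:
  assumes m: "1 \<le> m"
  defines "M \<equiv> real m + 3" defines "L \<equiv> ln M"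
  assumes H1: "(\<integral>s. Z m s \<partial>S) + mean_R m / (2 * real m) \<le> 1 + 1 / (8 * L)"
    and H2: "mean_R m \<le> real m / 2"
    and big: "L / 2 * (1 / (8 * L) + 1 - real m / M + K2 * sqrt (real m) / (2 * M) + K3 * (real m * sqrt (real m)) / (3 * M\<^sup>2))
      - ((2 * real m - K2 * sqrt (real m) - real m / 2) / M - K3 * (real m * sqrt (real m)) / M\<^sup>2) / 8
      + K3 * (real m * sqrt (real m)) / (16 * L * M\<^sup>2) \<le> 0"
  shows "(\<integral>s. sqrt (ln (real (succ_before s m) + 3)) \<partial>S) \<le> sqrt (ln (real m + 3))"
proof -
  have M: "3 < M" using m by (simp add: M_def)
  then have "ln (exp 1) \<le> ln M" using exp_le by (intro ln_le_cancel_iff[THEN iffD2]) auto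
  then have L: "1 \<le> L" by (simp add: L_def)
  define a where "a = (\<integral>s. Z m s \<partial>S)"
  define v where "v = (\<integral>s. (Z m s)\<^sup>2 \<partial>S)"
  define w where "w = (\<integral>s. \<bar>Z m s\<bar> ^ 3 \<partial>S)"
  define \<rho> where "\<rho> = mean_R m"
  define k2 where "k2 = K2 * sqrt (real m)"
  define k3 where "k3 = K3 * (real m * sqrt (real m))"
  have w: "w \<le> k3" "0 \<le> w" using Z3(2)[OF m] by (auto simp: w_def k3_def intro!: Bochner_Integration.integral_nonneg)
  have v: "2 * real m - k2 - \<rho> \<le> v" using integral_Z2_ge[OF m] by (simp add: v_def k2_def \<rho>_def)
  have \<rho>: "0 \<le> \<rho>" unfolding \<rho>_def by (rule integral_R_nonneg)
  have aH: "a + \<rho> / (2 * real m) \<le> 1 + 1 / (8 * L)" using H1 by (simp add: a_def \<rho>_def)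
  have rH: "\<rho> \<le> real m / 2" using H2 by (simp add: \<rho>_def)
  have mM: "real m \<le> M" "0 < real m" using m by (auto simp: M_def)
  let ?c1 = "1 / (2 * L * M)" and ?c2 = "- 1 / (4 * L * M\<^sup>2) - 1 / (8 * L\<^sup>2 * M\<^sup>2)"
    and ?c3 = "1 / (6 * L * M ^ 3) + 1 / (8 * L\<^sup>2 * M ^ 3) + 1 / (16 * L ^ 3 * M ^ 3)"
  let ?U = "\<lambda>s. 1 + ?c1 * Z m s + ?c2 * (Z m s)\<^sup>2 + ?c3 * \<bar>Z m s\<bar> ^ 3 + 0 * Z m s ^ 4"
  have pw: "sqrt (ln (real (succ_before s m) + 3)) \<le> sqrt L * ?U s" for s
  proof -
    let ?x = "Z m s / M"
    have eq: "ln (real (succ_before s m) + 3) = L + ln (1 + ?x)" and x: "-1 < ?x"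
      using ln_succ_before[where s = s and m = m] by (simp_all add: M_def L_def)
    have "0 \<le> ln (real (succ_before s m) + 3)" by simp
    then have "sqrt (ln (real (succ_before s m) + 3)) \<le> sqrt L * (1 + (?x - ?x\<^sup>2 / 2 + \<bar>?x\<bar> ^ 3 / 3) / (2 * L)
      - (?x\<^sup>2 - \<bar>?x\<bar> ^ 3) / (8 * L\<^sup>2) + \<bar>?x\<bar> ^ 3 / (16 * L ^ 3))"
      unfolding eq using L by (intro sqrt_ln_upper x) auto
    also have "\<bar>?x\<bar> = \<bar>Z m s\<bar> / M" using M by simp
    also have "1 + (?x - ?x\<^sup>2 / 2 + (\<bar>Z m s\<bar> / M) ^ 3 / 3) / (2 * L)
      - (?x\<^sup>2 - (\<bar>Z m s\<bar> / M) ^ 3) / (8 * L\<^sup>2) + (\<bar>Z m s\<bar> / M) ^ 3 / (16 * L ^ 3) = ?U s"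
      by (simp add: power_divide add_divide_distrib diff_divide_distrib algebra_simps)
    finally show ?thesis .
  qed
  have "(\<integral>s. sqrt (ln (real (succ_before s m) + 3)) \<partial>S) \<le> (\<integral>s. sqrt L * ?U s \<partial>S)"
    by (intro integral_mono sqrt_ln_integrable[OF m] integrable_mult_right integral_Z_poly(1)[OF m] pw)
  also have "\<dots> = sqrt L * (1 + ?c1 * a + ?c2 * v + ?c3 * w + 0 * (\<integral>s. Z m s ^ 4 \<partial>S))"
    unfolding a_def v_def w_def by (subst integral_mult_right_zero, subst integral_Z_poly(2)[OF m]) simp
  also have "\<dots> \<le> sqrt L * 1"
  proof (rule mult_left_mono)
    have "L\<^sup>2 * M * (?c1 * a + ?c2 * v + ?c3 * w) =
       L / 2 * (a - v / (2 * M) + w / (3 * M\<^sup>2)) - (v / M - w / M\<^sup>2) / 8 + w / (16 * L * M\<^sup>2)"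
      using L M by (simp add: field_simps powers)
    also have "\<dots> \<le> L / 2 * (1 / (8 * L) + 1 - real m / M + k2 / (2 * M) + k3 / (3 * M\<^sup>2))
      - ((2 * real m - k2 - real m / 2) / M - k3 / M\<^sup>2) / 8 + k3 / (16 * L * M\<^sup>2)"
    proof -
      have "(2 * real m - k2 - \<rho>) / (2 * M) \<le> v / (2 * M)" using v M by (intro divide_right_mono) auto
      moreover have "(2 * real m - k2 - \<rho>) / (2 * M) = real m / M - k2 / (2 * M) - \<rho> / (2 * M)"
        using M by (simp add: field_simps)
      moreover have "\<rho> / (2 * M) \<le> \<rho> / (2 * real m)" using \<rho> mM by (intro divide_left_mono) auto
      moreover have "w / (3 * M\<^sup>2) \<le> k3 / (3 * M\<^sup>2)" using w by (intro divide_right_mono) auto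
      ultimately have "a - v / (2 * M) + w / (3 * M\<^sup>2) \<le>
          1 / (8 * L) + 1 - real m / M + k2 / (2 * M) + k3 / (3 * M\<^sup>2)"
        using aH by linarith
      then have "L / 2 * (a - v / (2 * M) + w / (3 * M\<^sup>2)) \<le>
          L / 2 * (1 / (8 * L) + 1 - real m / M + k2 / (2 * M) + k3 / (3 * M\<^sup>2))"
        using L by (intro mult_left_mono) auto
      moreover have "(2 * real m - k2 - real m / 2) / M \<le> v / M"
        using v rH M by (intro divide_right_mono) auto
      moreover have "w / M\<^sup>2 \<le> k3 / M\<^sup>2" using w by (intro divide_right_mono) auto
      moreover have "w / (16 * L * M\<^sup>2) \<le> k3 / (16 * L * M\<^sup>2)" using w L by (intro divide_right_mono) auto
      moreover have "x - (y - z) / 8 + u \<le> x' - (y' - z') / 8 + u'"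
        if "x \<le> x'" "y' \<le> y" "z \<le> z'" "u \<le> u'" for x x' y y' z z' u u' :: real
        using that by (intro add_mono diff_mono divide_right_mono) auto
      ultimately show ?thesis by blast
    qed
    also have "\<dots> \<le> 0" using big unfolding k2_def k3_def .
    finally have "?c1 * a + ?c2 * v + ?c3 * w \<le> 0"
      using L M by (simp only: mult_le_0_iff) (auto simp: zero_less_mult_iff)
    then show "1 + ?c1 * a + ?c2 * v + ?c3 * w + 0 * (\<integral>s. Z m s ^ 4 \<partial>S) \<le> 1" by simp
  qed (use L in auto)
  finally show ?thesis by (simp add: L_def M_def)
qed

lemma lyapunov_sqrt_ln:
  assumes H1: "\<forall>\<^sub>F m in sequentially. (\<integral>s. Z m s \<partial>S) + mean_R m / (2 * real m)
      \<le> 1 + 1 / (8 * ln (real m + 3))"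
    and H2: "\<forall>\<^sub>F m in sequentially. mean_R m \<le> real m / 2"
  shows "\<forall>\<^sub>F m in sequentially. (\<integral>s. sqrt (ln (real (succ_before s m) + 3)) \<partial>S) \<le> sqrt (ln (real m + 3))"
proof -
  \<comment> \<open>The slack in \<open>H1\<close> contributes 1/16, and the second moment, at least
    about 3 m / 2 by \<open>H2\<close>, contributes -3/16; the other terms vanish in the
    limit.\<close>
  have lim: "((\<lambda>m::nat. ln (real m + 3) / 2 * (1 / (8 * ln (real m + 3)) + 1 - real m / (real m + 3)
        + c2 * sqrt (real m) / (2 * (real m + 3)) + c3 * (real m * sqrt (real m)) / (3 * (real m + 3)\<^sup>2))
      - ((2 * real m - c2 * sqrt (real m) - real m / 2) / (real m + 3) - c3 * (real m * sqrt (real m)) / (real m + 3)\<^sup>2) / 8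
      + c3 * (real m * sqrt (real m)) / (16 * ln (real m + 3) * (real m + 3)\<^sup>2)) \<longlongrightarrow> - 1 / 8) sequentially" for c2 c3 :: real
    by real_asymp
  have "- 1 / 8 < (0::real)" by simp
  from order_tendstoD(2)[OF lim[of K2 K3] this] H1 H2 eventually_ge_at_top[of "1::nat"] show ?thesis
    by eventually_elim (rule lyapunov_sqrt_ln_step, auto)
qed

text \<open>The convexity of the reciprocal logarithm works against the drift, so the second moment
  enters through its upper bound, which is free of \<open>mean_R\<close>. To leading order the
  change is at most \<open>(1 - c) / (M * L\<^sup>2)\<close>.\<close>

lemma lyapunov_inverse_ln_step:
  assumes m: "1 \<le> m"
  defines "M \<equiv> real m + 3" defines "L \<equiv> ln M"
  assumes L: "2 \<le> L" and a: "c \<le> (\<integral>s. Z m s \<partial>S)"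
    and big: "- c + (2 * real m + K2 * sqrt (real m)) / (2 * M) + K3 * (real m * sqrt (real m)) / M\<^sup>2
      + 8 * (2 * real m + K2 * sqrt (real m)) / (M * L) + 16 * (K4 * (real m)\<^sup>2) * L\<^sup>2 / M ^ 3 \<le> 0"
  shows "(\<integral>s. 1 / ln (real (succ_before s m) + 3) \<partial>S) \<le> 1 / ln (real m + 3)"
proof -
  have M: "3 < M" using m by (simp add: M_def)
  let ?c0 = "1 / L" and ?c1 = "- 1 / (M * L\<^sup>2)" and ?c2 = "1 / (2 * M\<^sup>2 * L\<^sup>2) + 8 / (M\<^sup>2 * L ^ 3)"
    and ?c3 = "1 / (M ^ 3 * L\<^sup>2)" and ?c4 = "16 / M ^ 4"
  let ?U = "\<lambda>s. ?c0 + ?c1 * Z m s + ?c2 * (Z m s)\<^sup>2 + ?c3 * \<bar>Z m s\<bar> ^ 3 + ?c4 * Z m s ^ 4"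
  have ln_ge: "1 \<le> ln (real k + 3)" for k :: nat
  proof -
    have "ln (exp 1) \<le> ln (real k + 3)" using exp_le by (intro ln_le_cancel_iff[THEN iffD2]) auto
    then show ?thesis by simp
  qed
  have pw: "1 / ln (real (succ_before s m) + 3) \<le> ?U s" for s
  proof -
    let ?x = "Z m s / M"
    have eq: "ln (real (succ_before s m) + 3) = L + ln (1 + ?x)" and x: "-1 < ?x"
      using ln_succ_before[where s = s and m = m] by (simp_all add: M_def L_def)
    have "1 / ln (real (succ_before s m) + 3) \<le>
        1 / L - (?x - ?x\<^sup>2 / 2 - \<bar>?x\<bar> ^ 3) / L\<^sup>2 + 8 * ?x\<^sup>2 / L ^ 3 + 16 * ?x ^ 4"
      using ln_ge[of "succ_before s m"] unfolding eq by (intro inverse_ln_upper x L)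
    also have "\<bar>?x\<bar> = \<bar>Z m s\<bar> / M" using M by simp
    also have "1 / L - (?x - ?x\<^sup>2 / 2 - (\<bar>Z m s\<bar> / M) ^ 3) / L\<^sup>2 + 8 * ?x\<^sup>2 / L ^ 3 + 16 * ?x ^ 4 = ?U s"
      by (simp add: power_divide add_divide_distrib diff_divide_distrib algebra_simps)
    finally show ?thesis .
  qed
  have "(\<integral>s. 1 / ln (real (succ_before s m) + 3) \<partial>S) \<le> (\<integral>s. ?U s \<partial>S)"
  proof (intro integral_mono integral_Z_poly(1)[OF m] pw)
    show "integrable S (\<lambda>s. 1 / ln (real (succ_before s m) + 3))"
      by (rule S.integrable_const_bound[of _ 1]) (use ln_ge in \<open>auto simp: abs_of_pos less_le_trans[OF zero_less_one] order.trans[OF zero_le_one]\<close>)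
  qed
  also have "\<dots> = ?c0 + ?c1 * (\<integral>s. Z m s \<partial>S) + ?c2 * (\<integral>s. (Z m s)\<^sup>2 \<partial>S) + ?c3 * (\<integral>s. \<bar>Z m s\<bar> ^ 3 \<partial>S)
      + ?c4 * (\<integral>s. Z m s ^ 4 \<partial>S)"
    by (rule integral_Z_poly(2)[OF m])
  also have "\<dots> \<le> ?c0 + ?c1 * c + ?c2 * (2 * real m + K2 * sqrt (real m)) + ?c3 * (K3 * (real m * sqrt (real m)))
      + ?c4 * (K4 * (real m)\<^sup>2)"
    using a L M integral_Z2_le[OF m] Z3(2)[OF m] Z4(2)[OF m]
    by (intro add_mono mult_left_mono mult_left_mono_neg) (auto intro!: divide_nonneg_nonneg add_nonneg_nonneg)
  also have "\<dots> = ?c0 + (- c + (2 * real m + K2 * sqrt (real m)) / (2 * M) + K3 * (real m * sqrt (real m)) / M\<^sup>2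
      + 8 * (2 * real m + K2 * sqrt (real m)) / (M * L) + 16 * (K4 * (real m)\<^sup>2) * L\<^sup>2 / M ^ 3) / (M * L\<^sup>2)"
  proof -
    have "?c0 + ?c1 * c + ?c2 * P + ?c3 * Q + ?c4 * W = ?c0 + (- c + P / (2 * M) + Q / M\<^sup>2
        + 8 * P / (M * L) + 16 * W * L\<^sup>2 / M ^ 3) / (M * L\<^sup>2)" for P Q W
    proof -
      have "P / (2 * M) / (M * L\<^sup>2) + 8 * P / (M * L) / (M * L\<^sup>2) = ?c2 * P"
        by (simp add: powers distrib_left mult_ac)
      moreover have "Q / M\<^sup>2 / (M * L\<^sup>2) = ?c3 * Q" by (simp add: powers)
      moreover have "16 * W * L\<^sup>2 / M ^ 3 / (M * L\<^sup>2) = ?c4 * W"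
        using L M by (simp add: powers)
      moreover have "- c / (M * L\<^sup>2) = ?c1 * c" by simp
      ultimately show ?thesis unfolding add_divide_distrib by linarith
    qed
    then show ?thesis .
  qed
  also have "\<dots> \<le> ?c0"
    using big L M by (simp add: divide_nonpos_nonneg)
  finally show ?thesis by (simp add: L_def M_def)
qed

lemma lyapunov_inverse_ln:
  assumes c: "1 < c" and H: "\<forall>\<^sub>F m in sequentially. c \<le> (\<integral>s. Z m s \<partial>S)"
  shows "\<forall>\<^sub>F m in sequentially. (\<integral>s. 1 / ln (real (succ_before s m) + 3) \<partial>S) \<le> 1 / ln (real m + 3)"
proof -
  \<comment> \<open>The summand 1 in the limit comes from half the second moment divided by
    \<open>m + 3\<close>.\<close>
  have lim: "((\<lambda>m::nat. - c + (2 * real m + c2 * sqrt (real m)) / (2 * (real m + 3)) + c3 * (real m * sqrt (real m)) / (real m + 3)\<^sup>2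
      + 8 * (2 * real m + c2 * sqrt (real m)) / ((real m + 3) * ln (real m + 3))
      + 16 * (c4 * (real m)\<^sup>2) * (ln (real m + 3))\<^sup>2 / (real m + 3) ^ 3) \<longlongrightarrow> - c + 1) sequentially" for c2 c3 c4 :: real
    by real_asymp
  have "- c + 1 < 0" using c by simp
  note order_tendstoD(2)[OF lim[of K2 K3 K4] this]
  moreover have "\<forall>\<^sub>F m::nat in sequentially. 2 \<le> ln (real m + 3)" by real_asymp
  ultimately show ?thesis using H eventually_ge_at_top[of "1::nat"]
    by eventually_elim (rule lyapunov_inverse_ln_step, auto)
qed

end

section \<open>Extinction and survival of the crossing chain\<close>

context coins
begin

lemma succ_before_0 [simp]: "succ_before s 0 = 0"
  by (simp add: succ_before_def)

declare measurable_fun_succ_before [measurable]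

text \<open>The transition operator of the crossing chain: a step from \<open>m\<close> reads a
  fresh stack of law \<open>S\<close>.\<close>

definition K :: "(nat \<Rightarrow> real) \<Rightarrow> nat \<Rightarrow> real" where
  "K h m = (\<integral>s. h (succ_before s m) \<partial>S)"

lemma integrable_bounded_succ_before:
  assumes "\<And>k. \<bar>h k\<bar> \<le> (C::real)" shows "integrable S (\<lambda>s. h (succ_before s m))"
  by (rule S.integrable_const_bound[of _ C]) (use assms in auto)

lemma K_mono:
  assumes "\<And>k. \<bar>g k\<bar> \<le> C" "\<And>k. \<bar>h k\<bar> \<le> D" "\<And>k. g k \<le> h k"
  shows "K g m \<le> K h m"
  unfolding K_def using assms by (intro integral_mono integrable_bounded_succ_before) auto

text \<open>From every \<open>m\<close> the chain jumps to 0 with positive probability, so a strict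
  inequality at 0 makes the average strict.\<close>

lemma K_less:
  assumes le: "\<And>k. h k \<le> c" and less: "h 0 < c" and int: "integrable S (\<lambda>s. h (succ_before s m))"
  shows "K h m < c"
proof -
  let ?E = "{s. succ_before s m = 0}"
  have "{s \<in> space S. succ_before s m = 0} \<in> sets S" by measurable
  then have E: "?E \<in> sets S" by simp
  have i: "integrable S (\<lambda>s. (c - h 0) * indicator ?E s)" using E by (simp add: S.emeasure_eq_measure)
  have "(c - h 0) * measure S ?E = (\<integral>s. (c - h 0) * indicator ?E s \<partial>S)" using E by simp
  also have "\<dots> \<le> (\<integral>s. c - h (succ_before s m) \<partial>S)"
    using i int le by (intro integral_mono) (auto simp: indicator_def)
  also have "\<dots> = c - K h m" using int by (simp add: K_def)
  finally have "(c - h 0) * measure S ?E \<le> c - K h m" .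
  moreover have "0 < (c - h 0) * measure S ?E" using less prob_succ_before_0[of m] by simp
  ultimately show ?thesis by linarith
qed

text \<open>A maximum principle replaces the usual supermartingale argument: a Lyapunov function
  tending to infinity bounds a subharmonic function by its maximum on a finite set, and there
  the positive probability of jumping to 0 makes the maximum vanish.\<close>

lemma subharmonic_eq_0:
  fixes u f :: "nat \<Rightarrow> real"
  assumes u: "\<And>m. 0 \<le> u m" "\<And>m. u m \<le> 1" "u 0 = 0" "\<And>m. u m \<le> K u m"
    and f: "\<And>m. 0 \<le> f m" "filterlim f at_top sequentially" "\<And>m. m0 \<le> m \<Longrightarrow> integrable S (\<lambda>s. f (succ_before s m))"
      "\<And>m. m0 \<le> m \<Longrightarrow> K f m \<le> f m"
    and m0: "1 \<le> m0"
  shows "u m = 0"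
proof -
  \<comment> \<open>The maximum over the finitely many states where \<open>f\<close> is not known to
    be superharmonic.\<close>
  define c where "c = Max (u ` {..<m0})"
  have c_ge: "u k \<le> c" if "k < m0" for k
    unfolding c_def using that by (intro Max_ge) auto
  have c0: "0 \<le> c" using c_ge[of 0] m0 u by simp
  have ui: "integrable S (\<lambda>s. u (succ_before s k))" for k
    using u by (intro integrable_bounded_succ_before[of _ 1]) auto
  have bound: "u k \<le> c + e * f k" if e: "0 < e" for e k
  proof (rule ccontr)
    assume "\<not> u k \<le> c + e * f k"
    define h where "h j = u j - c - e * f j" for j
    have hk: "0 < h k" using \<open>\<not> u k \<le> c + e * f k\<close> by (simp add: h_def)
    \<comment> \<open>Outside \<open>F\<close> the penalty \<open>e * f j\<close> is at least 1 and
      hence at least \<open>u j\<close>, so a positive supremum of \<open>h\<close> is attained on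
      this finite set.\<close>
    define F where "F = {j. e * f j < 1}"
    have "\<forall>\<^sub>F j in sequentially. 1 / e \<le> f j" using f(2) unfolding filterlim_at_top by blast
    then obtain n where n: "\<And>j. n \<le> j \<Longrightarrow> 1 / e \<le> f j" unfolding eventually_sequentially by blast
    have "F \<subseteq> {..<n}"
    proof
      fix j assume "j \<in> F"
      then have "f j < 1 / e" using e by (simp add: F_def pos_less_divide_eq mult.commute)
      then show "j \<in> {..<n}" using n[of j] by (meson lessThan_iff not_le)
    qed
    then have finF: "finite F" by (rule finite_subset) simp
    have notF: "h j \<le> 0" if "j \<notin> F" for j using that u(2)[of j] c0 by (simp add: F_def h_def)
    then have kF: "k \<in> F" using hk not_le by blast
    have "Max (h ` F) \<in> h ` F" using finF kF by (intro Max_in) auto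
    then obtain j where j: "j \<in> F" "h j = Max (h ` F)" by auto
    have "h k \<le> h j" unfolding j(2) using finF kF by (intro Max_ge) auto
    with hk have hj: "0 < h j" by simp
    have max: "h i \<le> h j" for i
    proof (cases "i \<in> F")
      case True then show ?thesis unfolding j(2) using finF by (intro Max_ge) auto
    next
      case False then show ?thesis using notF[of i] hj by simp
    qed
    have jm0: "m0 \<le> j"
    proof (rule ccontr)
      assume "\<not> m0 \<le> j"
      moreover have "0 \<le> e * f j" using f(1)[of j] e by simp
      ultimately have "h j \<le> 0" using c_ge[of j] by (simp add: h_def)
      with hj show False by simp
    qed
    have int: "integrable S (\<lambda>s. h (succ_before s j))"
      unfolding h_def using ui f(3)[OF jm0] by simp
    have "0 \<le> e * f 0" using f(1)[of 0] e by simp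
    then have "h 0 \<le> 0" using c0 u(3) by (simp add: h_def)
    then have "K h j < h j" using hj by (intro K_less max int) simp
    moreover have "K h j = K u j - c - e * K f j"
      unfolding K_def h_def using ui f(3)[OF jm0] by simp
    moreover have "e * K f j \<le> e * f j" using f(4)[OF jm0] e by simp
    ultimately show False using u(4)[of j] by (simp add: h_def)
  qed
  have le: "u k \<le> c" for k
  proof (rule field_le_epsilon)
    fix e :: real assume "0 < e"
    have "u k \<le> c + e / (1 + f k) * f k" using \<open>0 < e\<close> f(1)[of k] by (intro bound) (simp add: add_pos_nonneg)
    also have "\<dots> \<le> c + e" using \<open>0 < e\<close> f(1)[of k] by (simp add: divide_le_eq)
    finally show "u k \<le> c + e" .
  qed
  \<comment> \<open>The bound \<open>c\<close> is attained, and a positive maximum would contradict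
    the possible jump to 0, where \<open>u\<close> vanishes.\<close>
  have "c = 0"
  proof (rule ccontr)
    assume "c \<noteq> 0"
    have "c \<in> u ` {..<m0}" unfolding c_def using m0 by (intro Max_in) (auto simp: lessThan_empty_iff)
    then obtain j where "u j = c" by auto
    moreover have "K u j < c" using \<open>c \<noteq> 0\<close> c0 u(3) by (intro K_less le ui) simp
    ultimately show False using u(4)[of j] by simp
  qed
  with le[of m] u(1)[of m] show ?thesis by simp
qed

text \<open>The probability that the chain from \<open>m\<close> has not died after \<open>k\<close>
  steps, by \<open>prob_chain_alive\<close>. Iterating \<open>K\<close> defines it through the law
  of a single stack.\<close>

definition alive :: "nat \<Rightarrow> nat \<Rightarrow> real" where
  "alive k = (K ^^ k) (\<lambda>m. if m = 0 then 0 else 1)"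

lemma alive_0: "alive 0 m = (if m = 0 then 0 else 1)" by (simp add: alive_def)
lemma alive_Suc: "alive (Suc k) = K (alive k)" by (simp add: alive_def)

lemma alive_bounds: "0 \<le> alive k m \<and> alive k m \<le> 1 \<and> alive k 0 = 0"
proof (induction k arbitrary: m)
  case 0
  then show ?case by (simp add: alive_0)
next
  case (Suc k)
  have b: "\<bar>alive k j\<bar> \<le> 1" for j using Suc[of j] by simp
  have "0 \<le> K (alive k) m" unfolding K_def using Suc by (intro Bochner_Integration.integral_nonneg) blast
  moreover have "K (alive k) m \<le> K (\<lambda>_. 1) m" using Suc b by (intro K_mono[of _ 1 _ 1]) auto
  moreover have "K (alive k) 0 = 0" using Suc by (simp add: K_def)
  ultimately show ?case by (simp add: alive_Suc K_def)
qed

lemma alive_abs: "\<bar>alive k m\<bar> \<le> 1" using alive_bounds[of k m] by simp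

lemma alive_decreasing: "alive (Suc k) m \<le> alive k m"
proof (induction k arbitrary: m)
  case 0
  show ?case using alive_bounds[of "Suc 0" m] by (auto simp: alive_0)
next
  case (Suc k)
  then have "K (alive (Suc k)) m \<le> K (alive k) m" by (intro K_mono[of _ 1 _ 1] alive_abs)
  then show ?case by (simp add: alive_Suc)
qed

text \<open>The survival probabilities decrease to a bounded function that is fixed by
  \<open>K\<close> and vanishes at 0; \<open>subharmonic_eq_0\<close> applies to it.\<close>

lemma alive_tendsto_0:
  assumes f: "\<And>m. 0 \<le> f m" "filterlim f at_top sequentially" "\<And>m. m0 \<le> m \<Longrightarrow> integrable S (\<lambda>s. f (succ_before s m))"
      "\<And>m. m0 \<le> m \<Longrightarrow> K f m \<le> f m" and m0: "1 \<le> m0"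
  shows "(\<lambda>k. alive k m) \<longlonglongrightarrow> 0"
proof -
  have dec: "decseq (\<lambda>k. alive k j)" for j by (rule decseq_SucI) (rule alive_decreasing)
  have "\<exists>L. (\<lambda>k. alive k j) \<longlonglongrightarrow> L \<and> (\<forall>k. L \<le> alive k j)" for j
  proof -
    have "\<forall>k. 0 \<le> alive k j" using alive_bounds by simp
    from decseq_convergent[OF dec this] show ?thesis by blast
  qed
  then have "\<forall>j. \<exists>L. (\<lambda>k. alive k j) \<longlonglongrightarrow> L \<and> (\<forall>k. L \<le> alive k j)" by blast
  from choice[OF this] obtain u where u: "\<And>j. (\<lambda>k. alive k j) \<longlonglongrightarrow> u j" "\<And>j k. u j \<le> alive k j" by blast
  have u01: "0 \<le> u j" "u j \<le> 1" for j
  proof -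
    show "0 \<le> u j" by (rule LIMSEQ_le_const[OF u(1)]) (simp add: alive_bounds)
    show "u j \<le> 1" using u(2)[of j 0] alive_bounds[of 0 j] by linarith
  qed
  have "u 0 = 0" using u(2)[of 0 0] u01(1)[of 0] by (simp add: alive_0)
  have "(\<lambda>k. K (alive k) j) \<longlonglongrightarrow> K u j" for j
    unfolding K_def
  proof (rule integral_dominated_convergence[where w = "\<lambda>_. 1"])
    show "AE s in S. (\<lambda>k. alive k (succ_before s j)) \<longlonglongrightarrow> u (succ_before s j)" using u(1) by blast
    show "AE s in S. norm (alive k (succ_before s j)) \<le> 1" for k using alive_abs by simp
  qed (simp_all add: measurable_fun_succ_before)
  moreover have "(\<lambda>k. K (alive k) j) \<longlonglongrightarrow> u j" for j
    using LIMSEQ_Suc[OF u(1)[of j]] by (simp add: alive_Suc)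
  ultimately have "K u j = u j" for j by (rule LIMSEQ_unique)
  then have "u j \<le> K u j" for j by simp
  then have "u m = 0"
    by (rule subharmonic_eq_0[where u = u and f = f, OF u01 \<open>u 0 = 0\<close> _ f m0])
  with u(1)[of m] show ?thesis by simp
qed

text \<open>The function \<open>g\<close> is subharmonic, vanishes up to \<open>m0\<close> and lies
  below \<open>alive 0\<close>, so iterating \<open>K\<close> keeps every \<open>alive k\<close>
  above it. From 1 the chain moves beyond \<open>m0\<close>, where \<open>g\<close> is positive, in
  one step with positive probability.\<close>

lemma alive_bounded_below:
  assumes f: "\<And>m. 0 < f m" "antimono f" "f (Suc m0) < f m0"
      "\<And>m. m0 \<le> m \<Longrightarrow> K f m \<le> f m"
  shows "\<exists>c>0. \<forall>k. c \<le> alive k 1"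
proof -
  define g where "g m = max 0 (1 - f m / f m0)" for m
  have f_le: "f m \<le> f 0" for m using f(2) by (simp add: antimonoD)
  have g01: "0 \<le> g m" "g m \<le> 1" for m using f(1)[of m] f(1)[of m0] by (auto simp: g_def)
  then have g_abs: "\<bar>g m\<bar> \<le> 1" for m by simp
  have gi: "integrable S (\<lambda>s. g (succ_before s m))" for m by (intro integrable_bounded_succ_before[of _ 1] g_abs)
  have fi: "integrable S (\<lambda>s. f (succ_before s m))" for m
    using f_le f(1) by (intro integrable_bounded_succ_before[of _ "f 0"]) (simp add: less_imp_le)
  have g_small: "g m = 0" if "m \<le> m0" for m
    using antimonoD[OF f(2) that] f(1)[of m0] by (simp add: g_def)
  have sub: "g m \<le> K g m" for m
  proof (cases "m \<le> m0")
    case True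
    have "0 \<le> K g m" unfolding K_def using g01 by (intro Bochner_Integration.integral_nonneg) auto
    with g_small[OF True] show ?thesis by simp
  next
    case False
    have "f m \<le> f m0" using False by (intro antimonoD[OF f(2)]) simp
    then have "g m = 1 - f m / f m0" using f(1)[of m0] by (simp add: g_def)
    also have "\<dots> \<le> 1 - K f m / f m0" using f(4)[of m] f(1)[of m0] False by (simp add: divide_right_mono)
    also have "\<dots> = K (\<lambda>j. 1 - f j / f m0) m" unfolding K_def using fi[of m] by simp
    also have "\<dots> \<le> K g m"
      unfolding K_def using fi[of m] gi[of m] by (intro integral_mono) (auto simp: g_def)
    finally show ?thesis .
  qed
  have below: "g m \<le> alive k m" for k m
  proof (induction k arbitrary: m)
    case 0
    show ?case using g01(2)[of m] g_small[of 0] by (simp add: alive_0)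
  next
    case (Suc k)
    have "g m \<le> K g m" by (rule sub)
    also have "\<dots> \<le> K (alive k) m" using Suc by (intro K_mono[of _ 1 _ 1] g_abs alive_abs)
    finally show ?case by (simp add: alive_Suc)
  qed
  let ?E = "{s. Suc m0 \<le> succ_before s 1}" and ?g = "g (Suc m0)"
  have gpos: "0 < ?g" using f(3) f(1)[of m0] by (simp add: g_def)
  have "{s \<in> space S. Suc m0 \<le> succ_before s 1} \<in> sets S" by measurable
  then have E: "?E \<in> sets S" by simp
  have "?g * measure S ?E = (\<integral>s. ?g * indicator ?E s \<partial>S)" using E by simp
  also have "\<dots> \<le> K g 1"
    unfolding K_def
  proof (rule integral_mono)
    show "integrable S (\<lambda>s. ?g * indicator ?E s)" using E by (simp add: S.emeasure_eq_measure)
    fix s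
    have "?g \<le> g j" if "Suc m0 \<le> j" for j
    proof -
      have "f j / f m0 \<le> f (Suc m0) / f m0"
        using antimonoD[OF f(2) that] f(1)[of m0] by (intro divide_right_mono) auto
      then show ?thesis by (auto simp: g_def)
    qed
    then show "?g * indicator ?E s \<le> g (succ_before s 1)" using g01(1) by (auto simp: indicator_def)
  qed (rule gi)
  finally have low: "?g * measure S ?E \<le> K g 1" .
  have "?g * measure S ?E \<le> alive k 1" for k
  proof -
    have "K g 1 \<le> K (alive k) 1" by (intro K_mono[of _ 1 _ 1] g_abs alive_abs below)
    with low alive_decreasing[of k 1] show ?thesis by (simp add: alive_Suc)
  qed
  moreover have "0 < ?g * measure S ?E" using gpos prob_succ_before_ge[of 1 "Suc m0"] by simp
  ultimately show ?thesis by blast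
qed

end

section \<open>From the drift to extinction or survival\<close>

context coins_bdd
begin

text \<open>The number of trials is at least \<open>m\<close>, so only partial sums from index
  \<open>m\<close> on are averaged.\<close>

lemma integral_drift_bounds:
  shows "(\<And>t. m \<le> t \<Longrightarrow> drift t \<le> b) \<Longrightarrow> (\<integral>s. drift (trials m s) \<partial>S) \<le> b"
    and "(\<And>t. m \<le> t \<Longrightarrow> b \<le> drift t) \<Longrightarrow> b \<le> (\<integral>s. drift (trials m s) \<partial>S)"
proof -
  assume "\<And>t. m \<le> t \<Longrightarrow> drift t \<le> b"
  then have "(\<integral>s. drift (trials m s) \<partial>S) \<le> (\<integral>s. b \<partial>S)"
    by (intro integral_mono drift_integrable) auto
  then show "(\<integral>s. drift (trials m s) \<partial>S) \<le> b" by simp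
next
  assume "\<And>t. m \<le> t \<Longrightarrow> b \<le> drift t"
  then have "(\<integral>s. b \<partial>S) \<le> (\<integral>s. drift (trials m s) \<partial>S)"
    by (intro integral_mono drift_integrable) auto
  then show "b \<le> (\<integral>s. drift (trials m s) \<partial>S)" by simp
qed

lemma R_split_le:
  assumes "k \<le> t" "\<And>i. k \<le> i \<Longrightarrow> (2 * q i - 1)\<^sup>2 \<le> w"
  shows "R t \<le> R k + w * real (t - k)"
proof -
  have "{..<t} = {..<k} \<union> {k..<t}" using assms(1) by auto
  then have "R t = R k + (\<Sum>i\<in>{k..<t}. (2 * q i - 1)\<^sup>2)"
    unfolding R_def by (simp add: sum.union_disjoint ivl_disj_int)
  also have "(\<Sum>i\<in>{k..<t}. (2 * q i - 1)\<^sup>2) \<le> (\<Sum>i\<in>{k..<t}. w)" using assms(2) by (intro sum_mono) auto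
  finally show ?thesis by (simp add: mult.commute)
qed

text \<open>Beyond the first \<open>m\<close> trials there are \<open>m + Z m s\<close> more, at
  most \<open>m + B\<close> in the mean, and each adds at most \<open>w\<close>.\<close>

lemma integral_R_le:
  assumes m: "1 \<le> m" and w: "\<And>i. m \<le> i \<Longrightarrow> (2 * q i - 1)\<^sup>2 \<le> w"
  shows "mean_R m \<le> R m + w * (real m + B)"
proof -
  have w0: "0 \<le> w" using w[of m] zero_le_power2[of "2 * q m - 1"] by linarith
  have "mean_R m \<le> (\<integral>s. R m + w * (real m + Z m s) \<partial>S)"
  proof (rule integral_mono[OF R_integrable[OF m]])
    show "integrable S (\<lambda>s. R m + w * (real m + Z m s))" using Z_integrable[OF m] by simp
    show "R (trials m s) \<le> R m + w * (real m + Z m s)" for s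
      using R_split_le[of m "succ_before s m + m" w] w by (simp add: Z_def)
  qed
  also have "\<dots> = R m + w * (real m + (\<integral>s. Z m s \<partial>S))" using Z_integrable[OF m] by simp
  also have "\<dots> \<le> R m + w * (real m + B)"
    using integral_Z[OF m] abs_integral_drift_le[of m] w0 by (intro add_left_mono mult_left_mono) auto
  finally show ?thesis .
qed

lemma R_le: "R t \<le> real t"
  using var_bounds(1)[of t] R_eq[of t] by simp

text \<open>The increment is at most 1 in absolute value, so its square is at most its absolute
  value. Control of the partial sums thus gives control of the variance deficit without absolute
  convergence.\<close>

lemma sqr_le: "(2 * q i - 1)\<^sup>2 \<le> \<bar>drift (Suc i) - drift i\<bar>"
proof -
  have "\<bar>2 * q i - 1\<bar> \<le> 1" using q_bounds[of i] by linarith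
  then have "\<bar>2 * q i - 1\<bar> * \<bar>2 * q i - 1\<bar> \<le> 1 * \<bar>2 * q i - 1\<bar>" by (intro mult_right_mono) auto
  then show ?thesis by (simp add: drift_def power2_eq_square)
qed

lemma alive_dies_if:
  assumes H1: "\<forall>\<^sub>F m in sequentially. (\<integral>s. Z m s \<partial>S) + mean_R m / (2 * real m)
      \<le> 1 + 1 / (8 * ln (real m + 3))"
    and H2: "\<forall>\<^sub>F m in sequentially. mean_R m \<le> real m / 2"
  shows "(\<lambda>k. alive k m) \<longlonglongrightarrow> 0"
proof -
  have "\<forall>\<^sub>F m in sequentially. 1 \<le> m \<and> K (\<lambda>j. sqrt (ln (real j + 3))) m \<le> sqrt (ln (real m + 3))"
    unfolding K_def using lyapunov_sqrt_ln[OF H1 H2] eventually_ge_at_top[of "1::nat"] by eventually_elim simp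
  then obtain m0 where m0: "\<And>m. m0 \<le> m \<Longrightarrow> 1 \<le> m \<and> K (\<lambda>j. sqrt (ln (real j + 3))) m \<le> sqrt (ln (real m + 3))"
    unfolding eventually_sequentially by blast
  show ?thesis
  proof (rule alive_tendsto_0[where f = "\<lambda>j. sqrt (ln (real j + 3))" and ?m0.0 = m0])
    show "filterlim (\<lambda>j::nat. sqrt (ln (real j + 3))) at_top sequentially" by real_asymp
  qed (use m0 sqrt_ln_integrable in auto)
qed

lemma alive_dies_subcritical:
  assumes lim: "drift \<longlonglongrightarrow> \<delta>" and \<delta>: "\<delta> < 1"
  shows "(\<lambda>k. alive k m) \<longlonglongrightarrow> 0"
proof -
  \<comment> \<open>The first bound yields \<open>\<delta> + 3 * \<eta> \<le> 1\<close>, with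
    \<open>\<eta>\<close> spent on the mean and \<open>2 * \<eta>\<close> on the variance deficit;
    the second yields \<open>4 * \<eta> \<le> 1 / 2\<close>.\<close>
  define \<eta> where "\<eta> = min ((1 - \<delta>) / 8) (1 / 8)"
  have \<eta>: "0 < \<eta>" "\<eta> \<le> (1 - \<delta>) / 8" "\<eta> \<le> 1 / 8"
  proof -
    show "0 < \<eta>" using \<delta> by (simp add: \<eta>_def)
    show "\<eta> \<le> (1 - \<delta>) / 8" unfolding \<eta>_def by (rule min.cobounded1)
    show "\<eta> \<le> 1 / 8" unfolding \<eta>_def by (rule min.cobounded2)
  qed
  have "\<forall>\<^sub>F t in sequentially. \<bar>drift t - \<delta>\<bar> < \<eta> / 2"
    using tendstoD[OF lim, of "\<eta> / 2"] \<eta> by (simp add: dist_real_def)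
  then obtain t0 where t0: "\<And>t. t0 \<le> t \<Longrightarrow> \<bar>drift t - \<delta>\<bar> < \<eta> / 2" unfolding eventually_sequentially by blast
  have e: "(2 * q i - 1)\<^sup>2 \<le> \<eta>" if "t0 \<le> i" for i
    using sqr_le[of i] t0[of i] t0[of "Suc i"] that by linarith
  have Rb: "mean_R m \<le> real t0 + \<eta> * real m + \<eta> * (real m + B)" if m: "max 1 t0 \<le> m" for m
  proof -
    have "mean_R m \<le> R m + \<eta> * (real m + B)"
      using e m by (intro integral_R_le) auto
    moreover have "R m \<le> R t0 + \<eta> * real (m - t0)" using e m by (intro R_split_le) auto
    moreover have "\<eta> * real (m - t0) \<le> \<eta> * real m" using \<eta> by (intro mult_left_mono) auto
    ultimately show ?thesis using R_le[of t0] by linarith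
  qed
  have "((\<lambda>m::nat. (real t0 + \<eta> * B) / real m) \<longlongrightarrow> 0) sequentially" by real_asymp
  then have "\<forall>\<^sub>F m::nat in sequentially. (real t0 + \<eta> * B) / real m < 2 * \<eta>"
    using \<eta> by (intro order_tendstoD) auto
  then have Rm: "\<forall>\<^sub>F m in sequentially. mean_R m \<le> 4 * \<eta> * real m"
    using eventually_ge_at_top[of "max 1 t0"]
  proof eventually_elim
    case (elim m)
    then have "real t0 + \<eta> * B < 2 * \<eta> * real m" by (simp add: pos_divide_less_eq)
    with Rb[OF elim(2)] show ?case by (simp add: algebra_simps)
  qed
  show ?thesis
  proof (rule alive_dies_if)
    show "\<forall>\<^sub>F m in sequentially. mean_R m \<le> real m / 2"
      using Rm
    proof eventually_elim
      case (elim m)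
      have "4 * \<eta> * real m \<le> 1 / 2 * real m" using \<eta> by (intro mult_right_mono) auto
      with elim show ?case by simp
    qed
    show "\<forall>\<^sub>F m in sequentially. (\<integral>s. Z m s \<partial>S) + mean_R m / (2 * real m)
        \<le> 1 + 1 / (8 * ln (real m + 3))"
      using Rm eventually_ge_at_top[of "max 1 t0"]
    proof eventually_elim
      case (elim m)
      have "(\<integral>s. Z m s \<partial>S) \<le> \<delta> + \<eta>"
      proof -
        have "drift t \<le> \<delta> + \<eta>" if "m \<le> t" for t using t0[of t] that elim(2) \<eta>(1) unfolding abs_less_iff by simp
        then show ?thesis using integral_Z[of m] integral_drift_bounds(1)[of m "\<delta> + \<eta>"] elim(2) by simp
      qed
      moreover have "mean_R m / (2 * real m) \<le> 2 * \<eta>"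
        using elim by (subst pos_divide_le_eq) auto
      moreover have "0 \<le> 1 / (8 * ln (real m + 3))" by simp
      moreover have "\<delta> + \<eta> + 2 * \<eta> \<le> 1" using \<eta>(2) \<delta> by simp
      ultimately show ?case by (smt (verit))
    qed
  qed
qed

lemma alive_dies_critical:
  assumes crit: "\<And>\<eta>. 0 < \<eta> \<Longrightarrow> \<forall>\<^sub>F t in sequentially. \<bar>drift t - 1\<bar> \<le> \<eta> / ln (real t)"
  shows "(\<lambda>k. alive k m) \<longlonglongrightarrow> 0"
proof -
  \<comment> \<open>In units of 1 / ln m the mean costs \<open>\<eta>\<close> and the variance
    deficit \<open>3 * \<eta> / 2\<close>; with this value they add up to 1/16, below the 1/8 that
    \<open>alive_dies_if\<close> allows.\<close>
  define \<eta> :: real where "\<eta> = 1 / 40"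
  have \<eta>: "0 < \<eta>" by (simp add: \<eta>_def)
  from crit[of "\<eta> / 2"] \<eta> obtain t1 where t1: "\<And>t. t1 \<le> t \<Longrightarrow> \<bar>drift t - 1\<bar> \<le> \<eta> / 2 / ln (real t)"
    unfolding eventually_sequentially by auto
  define t0 where "t0 = max 2 t1"
  have t0: "\<bar>drift t - 1\<bar> \<le> \<eta> / 2 / ln (real k)" if "t0 \<le> k" "k \<le> t" for t k
  proof -
    have "\<eta> / 2 / ln (real t) \<le> \<eta> / 2 / ln (real k)" using that \<eta> by (intro divide_left_mono) (auto simp: t0_def)
    with t1[of t] that show ?thesis by (auto simp: t0_def)
  qed
  have e: "(2 * q i - 1)\<^sup>2 \<le> \<eta> / ln (real k)" if "t0 \<le> k" "k \<le> i" for i k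
    using sqr_le[of i] t0[of k i] t0[of k "Suc i"] that by auto
  define U where "U m = sqrt (real m) + 1 + 2 * \<eta> * real m / ln (real m) + \<eta> / ln (real m) * (real m + B)" for m :: nat
  have Rb: "mean_R m \<le> U m" if m: "t0\<^sup>2 \<le> m" for m
  proof -
    \<comment> \<open>The sum is split at sqrt m: the terms before it cost at most sqrt m + 1, and
      beyond it the logarithm has lost only a factor 2.\<close>
    define k where "k = nat \<lceil>sqrt (real m)\<rceil>"
    have k: "sqrt (real m) \<le> real k" "real k \<le> sqrt (real m) + 1"
      using real_sqrt_ge_zero[of "real m"] by (auto simp: k_def)
    have "real t0 \<le> sqrt (real m)"
      using m by (metis of_nat_le_iff of_nat_power real_le_rsqrt)
    with k have t0k: "t0 \<le> k" by linarith
    have "2 \<le> t0" by (simp add: t0_def)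
    moreover from this have "t0 \<le> t0\<^sup>2" by (intro self_le_power) auto
    ultimately have m2: "2 \<le> m" "t0 \<le> m" using m by linarith+
    have km: "k \<le> m"
    proof -
      have "sqrt (real m) \<le> real m" using m2 by (simp add: real_le_lsqrt power2_eq_square)
      then show ?thesis by (simp add: k_def)
    qed
    have "mean_R m \<le> R m + \<eta> / ln (real m) * (real m + B)"
      using e[OF m2(2)] m2 by (intro integral_R_le) auto
    moreover have "R m \<le> R k + \<eta> / ln (real k) * real (m - k)"
      using e[OF t0k] km by (intro R_split_le) auto
    moreover have "\<eta> / ln (real k) * real (m - k) \<le> (\<eta> / (ln (real m) / 2)) * real m"
    proof (intro mult_mono divide_left_mono)
      have "ln (real m) / 2 = ln (sqrt (real m))" using m2 by (simp add: ln_sqrt)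
      also have "\<dots> \<le> ln (real k)" using k m2 by (intro ln_mono) auto
      finally show "ln (real m) / 2 \<le> ln (real k)" .
    qed (use \<eta> m2 t0k in \<open>auto simp: t0_def\<close>)
    ultimately show ?thesis using R_le[of k] k by (simp add: U_def)
  qed
  have l1: "((\<lambda>m::nat. U m / real m)
      \<longlongrightarrow> 0) sequentially" unfolding U_def \<eta>_def by real_asymp
  have l2: "((\<lambda>m::nat. ln (real m + 3) * (\<eta> / ln (real m) + U m / (2 * real m))) \<longlongrightarrow> 1 / 16) sequentially" unfolding U_def \<eta>_def by real_asymp
  have ev0: "\<forall>\<^sub>F m in sequentially. t0\<^sup>2 \<le> m \<and> t0 \<le> m \<and> 2 \<le> m"
    using eventually_ge_at_top[of "t0\<^sup>2"] eventually_ge_at_top[of t0] eventually_ge_at_top[of "2::nat"] by eventually_elim auto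
  show ?thesis
  proof (rule alive_dies_if)
    show "\<forall>\<^sub>F m in sequentially. mean_R m \<le> real m / 2"
      using order_tendstoD(2)[OF l1, of "1/2", simplified] ev0
    proof eventually_elim
      case (elim m)
      then have "U m \<le> 1 / 2 * real m"
        by (simp add: pos_divide_less_eq)
      moreover have "t0\<^sup>2 \<le> m" using elim by blast
      ultimately show ?case using Rb[of m] by linarith
    qed
    show "\<forall>\<^sub>F m in sequentially. (\<integral>s. Z m s \<partial>S) + mean_R m / (2 * real m)
        \<le> 1 + 1 / (8 * ln (real m + 3))"
      using order_tendstoD(2)[OF l2, of "1/8", simplified] ev0
    proof eventually_elim
      case (elim m)
      have L: "0 < ln (real m + 3)" by simp
      have "(\<integral>s. Z m s \<partial>S) \<le> 1 + \<eta> / ln (real m)"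
      proof -
        have "drift t \<le> 1 + \<eta> / ln (real m)" if "m \<le> t" for t
        proof -
          have "\<eta> / 2 / ln (real m) \<le> \<eta> / ln (real m)" using elim \<eta> by (intro divide_right_mono) auto
          then show ?thesis using t0[of m t] that elim by auto
        qed
        then show ?thesis using integral_Z[of m] integral_drift_bounds(1)[of m "1 + \<eta> / ln (real m)"] elim by simp
      qed
      moreover have "mean_R m / (2 * real m) \<le>
          U m / (2 * real m)"
        using Rb[of m] elim by (intro divide_right_mono) auto
      moreover have "\<eta> / ln (real m) + U m / (2 * real m) \<le> 1 / (8 * ln (real m + 3))"
        using elim(1) L by (simp only: pos_le_divide_eq) (simp add: mult_ac less_imp_le)
      ultimately show ?case by linarith
    qed
  qed
qed

lemma alive_survives:
  assumes lim: "drift \<longlonglongrightarrow> \<delta>" and \<delta>: "1 < \<delta>"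
  shows "\<exists>c>0. \<forall>k. c \<le> alive k 1"
proof -
  define c where "c = (1 + \<delta>) / 2"
  have c: "1 < c" "c < \<delta>" using \<delta> by (auto simp: c_def)
  obtain t0 where t0: "\<And>t. t0 \<le> t \<Longrightarrow> c < drift t"
    using order_tendstoD(1)[OF lim c(2)] unfolding eventually_sequentially by blast
  have "\<forall>\<^sub>F m in sequentially. c \<le> (\<integral>s. Z m s \<partial>S)"
    using eventually_ge_at_top[of "max 1 t0"]
  proof eventually_elim
    case (elim m)
    then show ?case using integral_Z[of m] integral_drift_bounds(2)[of m c] t0 by (auto simp: less_imp_le)
  qed
  from lyapunov_inverse_ln[OF c(1) this] obtain m0 where
    m0: "\<And>m. m0 \<le> m \<Longrightarrow> K (\<lambda>j. 1 / ln (real j + 3)) m \<le> 1 / ln (real m + 3)"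
    unfolding eventually_sequentially K_def by blast
  show ?thesis
  proof (rule alive_bounded_below[where f = "\<lambda>j. 1 / ln (real j + 3)" and ?m0.0 = m0])
    show "antimono (\<lambda>j. 1 / ln (real j + 3))" by (intro antimonoI divide_left_mono ln_mono) auto
    show "1 / ln (real (Suc m0) + 3) < 1 / ln (real m0 + 3)" by (intro divide_strict_left_mono) auto
  qed (use m0 in auto)
qed

end

section \<open>Independent stacks\<close>

lemma measurable_succ_before_general:
  fixes s :: "'b \<Rightarrow> nat \<Rightarrow> bool"
  assumes [measurable]: "\<And>i. Measurable.pred M (\<lambda>w. s w i)"
  shows "(\<lambda>w. succ_before (s w) m) \<in> measurable M (count_space UNIV)"
  unfolding succ_before_def by measurable

lemma measurable_chain:
  fixes a :: "'b \<Rightarrow> int \<Rightarrow> nat \<Rightarrow> bool"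
  assumes "\<And>x i. N \<le> x \<Longrightarrow> x < N + int k \<Longrightarrow> Measurable.pred M (\<lambda>w. a w x i)"
  shows "(\<lambda>w. chain (a w) N m k) \<in> measurable M (count_space UNIV)"
  using assms
proof (induction k)
  case (Suc k)
  have "(\<lambda>w. (\<lambda>v w. succ_before (a w (N + int k)) v) (chain (a w) N m k) w) \<in> measurable M (count_space UNIV)"
  proof (rule measurable_compose_countable[where f = "\<lambda>v w. succ_before (a w (N + int k)) v"])
    show "(\<lambda>w. succ_before (a w (N + int k)) v) \<in> measurable M (count_space UNIV)" for v
      using Suc.prems by (intro measurable_succ_before_general) auto
    show "(\<lambda>w. chain (a w) N m k) \<in> measurable M (count_space UNIV)"
      using Suc by auto
  qed
  then show ?case by simp
qed simp

lemma chain_cong: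
  assumes "\<And>x. N \<le> x \<Longrightarrow> x < N + int k \<Longrightarrow> a x = b x"
  shows "chain a N m k = chain b N m k"
  using assms by (induction k) auto

lemma chain_stays_0: "chain a N m k = 0 \<Longrightarrow> chain a N m (k + j) = 0"
  by (induction j) (auto simp: succ_before_def)

context coins
begin

abbreviation coin_law :: "int \<times> nat \<Rightarrow> bool measure" where
  "coin_law z \<equiv> measure_pmf (bernoulli_pmf (q (snd z)))"

text \<open>Indexing all coins by site and position at once makes groups of stacks and single coins
  independent by restriction to disjoint index sets; \<open>curry\<close> recovers the
  stacks.\<close>

definition Omega :: "(int \<times> nat \<Rightarrow> bool) measure" where
  "Omega = PiM UNIV coin_law"

sublocale Omega: prob_space Omega
  unfolding Omega_def by (intro prob_space_PiM) (rule prob_space_measure_pmf)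

lemma space_Omega [simp]: "space Omega = UNIV"
  by (simp add: Omega_def space_PiM)

lemma sets_Omega: "sets Omega = sets (PiM UNIV (\<lambda>_::int \<times> nat. count_space UNIV))"
  unfolding Omega_def by (intro sets_PiM_cong) auto

lemma measurable_coin_Omega [measurable]: "Measurable.pred Omega (\<lambda>w. w z)"
  unfolding measurable_cong_sets[OF sets_Omega refl] by measurable

lemma indep_coins_Omega: "Omega.indep_vars coin_law (\<lambda>z w. w z) UNIV"
  unfolding Omega_def by (rule indep_vars_PiM_components) (rule prob_space_measure_pmf)

lemma measurable_stack: "(\<lambda>w i. w (x, i)) \<in> measurable Omega S"
proof -
  have "(\<lambda>w i. w (x, i)) \<in> measurable Omega (PiM UNIV (\<lambda>_::nat. count_space UNIV))"
    by (rule measurable_PiM_single') (auto intro: measurable_coin_Omega)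
  then show ?thesis by (simp only: measurable_cong_sets[OF refl sets_S])
qed

lemma distr_stack: "distr Omega S (\<lambda>w i. w (x, i)) = S"
proof -
  have "distr (PiM UNIV coin_law) (\<Pi>\<^sub>M i\<in>UNIV. coin_law (x, i)) (\<lambda>w. \<lambda>i\<in>UNIV. w (x, i)) = (\<Pi>\<^sub>M i\<in>UNIV. coin_law (x, i))"
    by (rule distr_PiM_reindex) (auto intro: prob_space_measure_pmf inj_onI)
  then show ?thesis by (simp add: Omega_def S_def restrict_UNIV)
qed

text \<open>The Markov property: the first \<open>k\<close> steps read the stacks at
  \<open>N\<close> up to \<open>N + k - 1\<close>, the next one reads the independent stack at
  \<open>N + k\<close>, and Fubini averages over it.\<close>

lemma integral_chain_Suc:
  fixes h :: "nat \<Rightarrow> real"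
  assumes h: "\<And>j. \<bar>h j\<bar> \<le> C"
  shows "(\<integral>w. h (chain (curry w) N m (Suc k)) \<partial>Omega) = (\<integral>w. K h (chain (curry w) N m k) \<partial>Omega)"
proof -
  let ?A = "{N..<N + int k} \<times> (UNIV::nat set)" and ?B = "{N + int k} \<times> (UNIV::nat set)"
  let ?X = "\<lambda>w::int \<times> nat \<Rightarrow> bool. restrict w ?A" and ?Y = "\<lambda>w::int \<times> nat \<Rightarrow> bool. restrict w ?B"
  let ?PA = "PiM ?A coin_law" and ?PB = "PiM ?B coin_law"
  have ind: "Omega.indep_var ?PA ?X ?PB ?Y"
    by (rule Omega.indep_var_restrict[OF indep_coins_Omega]) auto
  note ind' = ind[unfolded Omega.indep_var_distribution_eq]
  have mX: "?X \<in> measurable Omega ?PA" by (rule conjunct1[OF ind'])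
  have mY: "?Y \<in> measurable Omega ?PB" by (rule conjunct1[OF conjunct2[OF ind']])
  have eq: "distr Omega ?PA ?X \<Otimes>\<^sub>M distr Omega ?PB ?Y = distr Omega (?PA \<Otimes>\<^sub>M ?PB) (\<lambda>w. (?X w, ?Y w))"
    by (rule conjunct2[OF conjunct2[OF ind']])
  interpret DX: prob_space "distr Omega ?PA ?X" by (rule Omega.prob_space_distr[OF mX])
  interpret DY: prob_space "distr Omega ?PB ?Y" by (rule Omega.prob_space_distr[OF mY])
  interpret D: pair_prob_space "distr Omega ?PA ?X" "distr Omega ?PB ?Y" ..
  let ?V = "\<lambda>f::int \<times> nat \<Rightarrow> bool. chain (curry f) N m k"
  let ?s = "\<lambda>f::int \<times> nat \<Rightarrow> bool. (\<lambda>i. f (N + int k, i))"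
  let ?\<phi> = "\<lambda>(f, g). h (succ_before (?s g) (?V f))"
  have mV: "?V \<in> measurable ?PA (count_space UNIV)"
  proof (rule measurable_chain)
    fix x i assume "N \<le> x" "x < N + int k"
    then have "(\<lambda>f. f (x, i)) \<in> measurable ?PA (coin_law (x, i))"
      by (intro measurable_component_singleton) auto
    then show "Measurable.pred ?PA (\<lambda>f. curry f x i)" by simp
  qed
  have msB: "(\<lambda>g. succ_before (?s g) j) \<in> measurable ?PB (count_space UNIV)" for j
  proof (rule measurable_succ_before_general)
    fix i
    have "(\<lambda>f. f (N + int k, i)) \<in> measurable ?PB (coin_law (N + int k, i))"
      by (intro measurable_component_singleton) auto
    then show "Measurable.pred ?PB (\<lambda>f. f (N + int k, i))" by simp
  qed
  have mh: "(\<lambda>g. h (succ_before (?s g) j)) \<in> borel_measurable ?PB" for j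
    by (rule measurable_compose[where g = h, OF msB]) simp
  have mKV: "(\<lambda>f. K h (?V f)) \<in> borel_measurable ?PA"
    by (rule measurable_compose[where g = "K h", OF mV]) simp
  have m\<phi>: "?\<phi> \<in> borel_measurable (?PA \<Otimes>\<^sub>M ?PB)"
  proof -
    have 1: "(\<lambda>p. ?V (fst p)) \<in> measurable (?PA \<Otimes>\<^sub>M ?PB) (count_space UNIV)"
      by (rule measurable_compose[OF measurable_fst mV])
    have 2: "(\<lambda>p. h (succ_before (?s (snd p)) v)) \<in> borel_measurable (?PA \<Otimes>\<^sub>M ?PB)" for v
    proof -
      have "(\<lambda>p. succ_before (?s (snd p)) v) \<in> measurable (?PA \<Otimes>\<^sub>M ?PB) (count_space UNIV)"
        by (rule measurable_compose[OF measurable_snd msB])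
      then show ?thesis by (rule measurable_compose[where g = h]) simp
    qed
    have "(\<lambda>p. h (succ_before (?s (snd p)) (?V (fst p)))) \<in> borel_measurable (?PA \<Otimes>\<^sub>M ?PB)"
      using measurable_compose_countable[where f = "\<lambda>v p. h (succ_before (?s (snd p)) v)"
          and g = "\<lambda>p. ?V (fst p)", OF 2 1] .
    then show ?thesis by (simp only: case_prod_beta')
  qed
  have int: "integrable (distr Omega ?PA ?X \<Otimes>\<^sub>M distr Omega ?PB ?Y) ?\<phi>"
  proof (rule D.P.integrable_const_bound)
    show "AE p in distr Omega ?PA ?X \<Otimes>\<^sub>M distr Omega ?PB ?Y. norm (?\<phi> p) \<le> C"
      using h by (intro AE_I2) (simp add: case_prod_beta)
    show "?\<phi> \<in> borel_measurable (distr Omega ?PA ?X \<Otimes>\<^sub>M distr Omega ?PB ?Y)"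
      unfolding measurable_cong_sets[OF sets_pair_measure_cong[OF sets_distr sets_distr] refl] by (rule m\<phi>)
  qed
  have "(\<integral>w. h (chain (curry w) N m (Suc k)) \<partial>Omega) = (\<integral>w. ?\<phi> (?X w, ?Y w) \<partial>Omega)"
  proof (rule Bochner_Integration.integral_cong[OF refl])
    fix w
    have "?V (?X w) = ?V w" by (rule chain_cong) (auto simp: fun_eq_iff)
    moreover have "?s (?Y w) = curry w (N + int k)" by auto
    ultimately show "h (chain (curry w) N m (Suc k)) = ?\<phi> (?X w, ?Y w)" by simp
  qed
  also have "\<dots> = (\<integral>p. ?\<phi> p \<partial>(distr Omega ?PA ?X \<Otimes>\<^sub>M distr Omega ?PB ?Y))"
    unfolding eq by (rule integral_distr[symmetric, OF measurable_Pair[OF mX mY] m\<phi>])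
  also have "\<dots> = (\<integral>f. (\<integral>g. ?\<phi> (f, g) \<partial>distr Omega ?PB ?Y) \<partial>distr Omega ?PA ?X)"
    by (rule D.integral_fst'[symmetric, OF int])
  also have "\<dots> = (\<integral>f. K h (?V f) \<partial>distr Omega ?PA ?X)"
  proof (rule Bochner_Integration.integral_cong[OF refl])
    fix f
    have "(\<integral>g. ?\<phi> (f, g) \<partial>distr Omega ?PB ?Y) = (\<integral>w. h (succ_before (?s (?Y w)) (?V f)) \<partial>Omega)"
      by (simp only: prod.case, rule integral_distr[OF mY mh])
    also have "\<dots> = (\<integral>w. h (succ_before (\<lambda>i. w (N + int k, i)) (?V f)) \<partial>Omega)"
      by simp
    also have "\<dots> = (\<integral>s. h (succ_before s (?V f)) \<partial>distr Omega S (\<lambda>w i. w (N + int k, i)))"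
      by (rule integral_distr[symmetric, OF measurable_stack measurable_fun_succ_before])
    finally show "(\<integral>g. ?\<phi> (f, g) \<partial>distr Omega ?PB ?Y) = K h (?V f)"
      by (simp add: K_def distr_stack)
  qed
  also have "\<dots> = (\<integral>w. K h (?V (?X w)) \<partial>Omega)"
    by (rule integral_distr[OF mX mKV])
  also have "\<dots> = (\<integral>w. K h (chain (curry w) N m k) \<partial>Omega)"
  proof (rule Bochner_Integration.integral_cong[OF refl])
    fix w
    have "?V (?X w) = ?V w" by (rule chain_cong) (auto simp: fun_eq_iff)
    then show "K h (?V (?X w)) = K h (?V w)" by simp
  qed
  finally show ?thesis .
qed

lemma K_bounded: "(\<And>j. \<bar>h j\<bar> \<le> C) \<Longrightarrow> \<bar>K h j\<bar> \<le> C"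
proof -
  assume h: "\<And>j. \<bar>h j\<bar> \<le> C"
  have "K h j \<le> K (\<lambda>_. C) j" using h by (intro K_mono[of _ C _ "\<bar>C\<bar>"]) (auto simp: abs_le_iff)
  moreover have "K (\<lambda>_. - C) j \<le> K h j" using h by (intro K_mono[of _ "\<bar>C\<bar>" _ C]) (auto simp: abs_le_iff minus_le_iff)
  ultimately show ?thesis by (simp add: K_def abs_le_iff)
qed

lemma integral_chain:
  fixes h :: "nat \<Rightarrow> real"
  assumes "\<And>j. \<bar>h j\<bar> \<le> C"
  shows "(\<integral>w. h (chain (curry w) N m k) \<partial>Omega) = (K ^^ k) h m"
  using assms
proof (induction k arbitrary: h)
  case 0
  then show ?case using Omega.prob_space by simp
next
  case (Suc k)
  show ?case
    using trans[OF integral_chain_Suc[OF Suc.prems] Suc.IH[OF K_bounded[OF Suc.prems]]]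
    by (simp only: funpow_Suc_right o_apply)
qed

lemma measurable_chain_Omega [measurable]:
  "(\<lambda>w. chain (curry w) N m k) \<in> measurable Omega (count_space UNIV)"
  by (rule measurable_chain) (simp add: measurable_coin_Omega)

lemma prob_chain_alive: "measure Omega {w. chain (curry w) N m k \<noteq> 0} = alive k m"
proof -
  have "{w \<in> space Omega. chain (curry w) N m k \<noteq> 0} \<in> sets Omega" by measurable
  then have "measure Omega {w. chain (curry w) N m k \<noteq> 0} =
      (\<integral>w. indicator {w. chain (curry w) N m k \<noteq> 0} w \<partial>Omega)" by simp
  also have "\<dots> = (\<integral>w. (\<lambda>j. if j = 0 then 0 else 1) (chain (curry w) N m k) \<partial>Omega)"
    by (intro Bochner_Integration.integral_cong) (auto simp: indicator_def)
  also have "\<dots> = alive k m"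
    unfolding alive_def by (rule integral_chain[of _ 1]) auto
  finally show ?thesis .
qed

lemma AE_chain_dies:
  assumes "(\<lambda>k. alive k m) \<longlonglongrightarrow> 0"
  shows "AE w in Omega. \<exists>k. chain (curry w) N m k = 0"
proof -
  let ?N = "{w \<in> space Omega. \<forall>k. chain (curry w) N m k \<noteq> 0}"
  have N: "?N \<in> sets Omega" by measurable
  have "measure Omega ?N \<le> alive k m" for k
  proof -
    have "{w \<in> space Omega. chain (curry w) N m k \<noteq> 0} \<in> sets Omega" by measurable
    then have "measure Omega ?N \<le> measure Omega {w. chain (curry w) N m k \<noteq> 0}"
      by (intro Omega.finite_measure_mono) auto
    then show ?thesis by (simp only: prob_chain_alive)
  qed
  then have "measure Omega ?N \<le> 0" using assms by (intro LIMSEQ_le_const[OF assms]) blast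
  then have "?N \<in> null_sets Omega"
    using N by (simp only: null_sets_def Omega.emeasure_eq_measure measure_le_0_iff) simp
  then show ?thesis by (rule AE_I') auto
qed

lemma prob_chain_survives:
  assumes "\<And>k. c \<le> alive k m"
  shows "c \<le> measure Omega {w. \<forall>k. chain (curry w) N m k \<noteq> 0}"
proof -
  let ?E = "\<lambda>k. {w. chain (curry w) N m k \<noteq> 0}"
  have E: "range ?E \<subseteq> sets Omega"
  proof safe
    fix k
    have "{w \<in> space Omega. chain (curry w) N m k \<noteq> 0} \<in> sets Omega" by measurable
    then show "?E k \<in> sets Omega" by simp
  qed
  have "decseq ?E"
  proof (rule decseq_SucI)
    show "?E (Suc k) \<subseteq> ?E k" for k 
      by (intro Collect_mono impI) (use chain_stays_0[of _ N m k 1] in \<open>metis Suc_eq_plus1\<close>)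
  qed
  then have "(\<lambda>k. measure Omega (?E k)) \<longlonglongrightarrow> measure Omega (\<Inter>k. ?E k)"
    by (rule Omega.finite_Lim_measure_decseq[OF E])
  then have "c \<le> measure Omega (\<Inter>k. ?E k)"
    by (rule LIMSEQ_le_const) (use assms in \<open>simp only: prob_chain_alive, blast\<close>)
  also have "(\<Inter>k. ?E k) = {w. \<forall>k. chain (curry w) N m k \<noteq> 0}" by auto
  finally show ?thesis .
qed

lemma AE_infinitely_many_survive:
  assumes c: "0 < c" "\<And>k. c \<le> alive k 1"
  shows "AE w in Omega. \<exists>\<^sub>F N in sequentially. \<forall>k. chain (curry w) (int N) 1 k \<noteq> 0"
proof -
  define X where "X = (\<lambda>n::nat. \<lambda>w::int \<times> nat \<Rightarrow> bool. restrict w ({int n} \<times> UNIV))"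
  define P where "P = (\<lambda>n::nat. PiM ({int n} \<times> (UNIV::nat set)) coin_law)"
  define A where "A = (\<lambda>n::nat. sigma_sets (space Omega) {X n -` E \<inter> space Omega |E. E \<in> sets (P n)})"
  define T where "T N = {w. \<forall>k. chain (curry w) (int N) 1 k \<noteq> 0}" for N :: nat
  define L where "L = (\<Inter>n. \<Union>N\<in>{n..}. T N)"
  have ind: "Omega.indep_vars P X UNIV"
    unfolding P_def X_def
    by (rule Omega.indep_vars_restrict[OF indep_coins_Omega]) (auto simp: disjoint_family_on_def)
  have indA: "Omega.indep_sets A UNIV" using ind unfolding Omega.indep_vars_def A_def by blast
  have salg: "sigma_algebra (space Omega) (A n)" for n
    unfolding A_def by (rule sigma_algebra_sigma_sets) auto
  have T_tail: "T N \<in> sigma_sets UNIV (\<Union> (A ` {n..}))" if "n \<le> N" for n N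
  proof -
    \<comment> \<open>The space generated by the stacks from \<open>n\<close> on; a set measurable
      in \<open>W\<close> is determined by these stacks, as the tail property demands.\<close>
    define W where "W = sigma (UNIV :: (int \<times> nat \<Rightarrow> bool) set) (\<Union> (A ` {n..}))"
    have setsW: "sets W = sigma_sets UNIV (\<Union> (A ` {n..}))" and spW: "space W = UNIV"
      unfolding W_def by auto
    have [measurable]: "(\<lambda>w. chain (curry w) (int N) 1 k) \<in> measurable W (count_space UNIV)" for k
    proof (rule measurable_chain)
      fix x i assume x: "int N \<le> x"
      let ?j = "nat x"
      have j: "int ?j = x" "n \<le> ?j" using x that by auto
      have "(\<lambda>f. f (x, i)) \<in> measurable (P ?j) (coin_law (x, i))"
        unfolding P_def by (rule measurable_component_singleton) (use j in auto)
      then have "(\<lambda>f. f (x, i)) \<in> measurable (P ?j) (count_space UNIV)" by simp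
      then have "(\<lambda>f. f (x, i)) -` {True} \<inter> space (P ?j) \<in> sets (P ?j)"
        by (rule measurable_sets) simp
      then have "X ?j -` ((\<lambda>f. f (x, i)) -` {True} \<inter> space (P ?j)) \<inter> space Omega \<in> A ?j"
        unfolding A_def by (intro sigma_sets.Basic) blast
      moreover have sp: "X ?j w \<in> space (P ?j)" for w
        by (auto simp: X_def P_def space_PiM)
      moreover have "X ?j -` ((\<lambda>f. f (x, i)) -` {True} \<inter> space (P ?j)) \<inter> space Omega = {w. w (x, i)}"
        using x sp by (auto simp: X_def j)
      ultimately have "{w. w (x, i)} \<in> A ?j" by simp
      then have "{w. w (x, i)} \<in> sets W" unfolding setsW using j by (intro sigma_sets.Basic) auto
      then show "Measurable.pred W (\<lambda>w. curry w x i)" by (simp add: pred_def spW)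
    qed
    have "{w \<in> space W. \<forall>k. chain (curry w) (int N) 1 k \<noteq> 0} \<in> sets W" by measurable
    then show ?thesis unfolding T_def setsW[symmetric] by (simp add: spW)
  qed
  have L_tail: "L \<in> Omega.tail_events A"
    unfolding Omega.tail_events_def
  proof
    fix n
    interpret sg: sigma_algebra UNIV "sigma_sets UNIV (\<Union> (A ` {n..}))"
      by (rule sigma_algebra_sigma_sets) auto
    have "L = (\<Inter>j\<in>{n..}. \<Union>N\<in>{j..}. T N)"
    proof
      show "(\<Inter>j\<in>{n..}. \<Union>N\<in>{j..}. T N) \<subseteq> L"
      proof
        fix w assume *: "w \<in> (\<Inter>j\<in>{n..}. \<Union>N\<in>{j..}. T N)"
        have "w \<in> (\<Union>N\<in>{j..}. T N)" for j
        proof -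
          have "w \<in> (\<Union>N\<in>{max j n..}. T N)" using * by auto
          then show ?thesis by auto
        qed
        then show "w \<in> L" by (simp add: L_def)
      qed
    qed (auto simp: L_def)
    moreover have "(\<Union>N\<in>{j..}. T N) \<in> sigma_sets UNIV (\<Union> (A ` {n..}))" if "n \<le> j" for j
      using that by (intro sg.countable_UN'') (auto intro!: T_tail)
    ultimately show "L \<in> sigma_sets (space Omega) (\<Union> (A ` {n..}))"
      by (simp, intro sg.countable_INT'') auto
  qed
  have T_sets: "T N \<in> sets Omega" for N
  proof -
    have "{w \<in> space Omega. \<forall>k. chain (curry w) (int N) 1 k \<noteq> 0} \<in> sets Omega" by measurable
    then show ?thesis by (simp add: T_def)
  qed
  let ?U = "\<lambda>n. \<Union>N\<in>{n..}. T N"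
  have U_sets: "range ?U \<subseteq> sets Omega" using T_sets by auto
  have "decseq ?U" by (rule decseq_SucI, rule UN_mono) auto
  then have lim: "(\<lambda>n. measure Omega (?U n)) \<longlonglongrightarrow> measure Omega L"
    unfolding L_def by (rule Omega.finite_Lim_measure_decseq[OF U_sets])
  \<comment> \<open>The survival bound is the same at every starting site, so \<open>c\<close>
    bounds all the unions and passes to the limit superior.\<close>
  have "c \<le> measure Omega (?U n)" for n
  proof -
    have "c \<le> measure Omega (T n)" unfolding T_def by (rule prob_chain_survives[OF c(2)])
    also have "\<dots> \<le> measure Omega (?U n)" using U_sets by (intro Omega.finite_measure_mono) auto
    finally show ?thesis .
  qed
  then have "c \<le> measure Omega L" by (intro LIMSEQ_le_const[OF lim]) blast
  with c(1) Omega.kolmogorov_0_1_law[OF salg indA L_tail] have "measure Omega L = 1" by auto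
  moreover have "L \<in> sets Omega" unfolding L_def using U_sets by auto
  ultimately have "AE w in Omega. w \<in> L" by (simp add: Omega.AE_in_set_eq_1)
  then show ?thesis
    by eventually_elim (auto simp: L_def T_def frequently_sequentially)
qed

lemma AE_infinite_stack: "AE w in Omega. \<forall>x. infinite {i. curry w x i = b}"
proof -
  have "AE w in Omega. infinite {i. w (x, i) = b}" for x
  proof -
    have "AE s in distr Omega S (\<lambda>w i. w (x, i)). infinite {i. s i = b}"
      unfolding distr_stack by (rule AE_infinite_coins)
    then show ?thesis by (rule AE_distrD[OF measurable_stack])
  qed
  then show ?thesis by (simp add: AE_all_countable)
qed

lemma AE_pos_dichotomies:
  "AE w in Omega. (filterlim (pos (curry w)) at_top sequentially \<or> filterlim (pos (curry w)) at_bot sequentially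
      \<or> infinite {n. pos (curry w) n = 0}) \<and>
    (\<not> filterlim (pos (curry w)) at_bot sequentially \<longrightarrow> (\<forall>Z. \<exists>n. Z \<le> pos (curry w) n))"
  using AE_infinite_stack[of False] AE_infinite_stack[of True]
proof eventually_elim
  case (elim w)
  then have inf: "\<And>x. infinite {i. \<not> curry w x i}" "\<And>x. infinite {i. curry w x i}" by auto
  show ?case using pos_trichotomy[where a = "curry w", OF inf] pos_unbounded_above[where a = "curry w", OF inf] by blast
qed

lemma AE_pos_not_at_top:
  assumes "\<And>m. (\<lambda>k. alive k m) \<longlonglongrightarrow> 0"
  shows "AE w in Omega. \<not> filterlim (pos (curry w)) at_top sequentially"
proof -
  have "AE w in Omega. \<forall>m. \<exists>k. chain (curry w) 1 m k = 0"
    unfolding AE_all_countable using AE_chain_dies[OF assms] by blast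
  with AE_infinite_stack[of False] show ?thesis
  proof eventually_elim
    case (elim w)
    then have inf: "\<And>x. infinite {i. \<not> curry w x i}" by auto
    show ?case using elim(2) by (intro not_tendsto_at_top_if_chains_die[where a = "curry w", OF inf]) blast
  qed
qed

lemma AE_pos_at_top:
  assumes "0 < c" "\<And>k. c \<le> alive k 1"
  shows "AE w in Omega. (\<forall>Z. \<exists>n. Z \<le> pos (curry w) n) \<longrightarrow> filterlim (pos (curry w)) at_top sequentially"
  using AE_infinitely_many_survive[OF assms]
  by eventually_elim (intro impI tendsto_at_top_if_chains_survive, auto)

end

section \<open>The law of the excited random walk\<close>

definition last_visits :: "int list \<Rightarrow> nat" where
  "last_visits l = card {j. j < length l \<and> l ! j = last l}"

definition step_prob :: "(nat \<Rightarrow> real) \<Rightarrow> int list \<Rightarrow> int \<Rightarrow> real" where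
  "step_prob p l y = (if y = last l + 1 then p (last_visits l)
     else if y = last l - 1 then 1 - p (last_visits l) else 0)"

abbreviation traj :: "(nat \<Rightarrow> 'a \<Rightarrow> int) \<Rightarrow> nat \<Rightarrow> 'a \<Rightarrow> int list" where
  "traj X n w \<equiv> map (\<lambda>i. X i w) [0..<Suc n]"

text \<open>Products in place of conditional probabilities, so paths of probability 0 call for no
  separate care. Both the given walk and the coin-driven one satisfy this, and it determines the law
  of the path.\<close>

definition erw_path_law :: "'a measure \<Rightarrow> (nat \<Rightarrow> real) \<Rightarrow> (nat \<Rightarrow> 'a \<Rightarrow> int) \<Rightarrow> bool" where
  "erw_path_law M p X \<longleftrightarrow> (\<forall>n. X n \<in> measurable M (count_space UNIV)) \<and>
     (\<forall>y. measure M {w \<in> space M. X 0 w = y} = (if y = 0 then 1 else 0)) \<and>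
     (\<forall>n l y. length l = Suc n \<longrightarrow> measure M {w \<in> space M. traj X n w = l \<and> X (Suc n) w = y}
        = measure M {w \<in> space M. traj X n w = l} * step_prob p l y)"

lemma measurable_path:
  assumes "\<And>n. X n \<in> measurable M (count_space UNIV)"
  shows "(\<lambda>w. map (\<lambda>i. X i w :: int) [0..<n]) \<in> measurable M (count_space UNIV)"
proof (induction n)
  case (Suc n)
  have 1: "(\<lambda>w. map (\<lambda>i. X i w) [0..<n] @ [y]) \<in> measurable M (count_space UNIV)" for y
    by (rule measurable_compose[where g = "\<lambda>l. l @ [y]", OF Suc]) simp
  have "(\<lambda>w. map (\<lambda>i. X i w) [0..<n] @ [X n w]) \<in> measurable M (count_space UNIV)"
    using measurable_compose_countable[where f = "\<lambda>y w. map (\<lambda>i. X i w) [0..<n] @ [y]"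
        and g = "X n", OF 1 assms] .
  then show ?case by simp
qed simp

lemma path_prob_unique:
  assumes "erw_path_law M p X" "erw_path_law M' p X'"
  shows "measure M {w \<in> space M. traj X n w = l} = measure M' {w \<in> space M'. traj X' n w = l}"
proof (induction n arbitrary: l)
  case 0
  show ?case
  proof (cases l rule: list.exhaust)
    case (Cons y r)
    show ?thesis
    proof (cases "r = []")
      case True
      with assms Cons show ?thesis by (simp add: erw_path_law_def)
    next
      case False
      with Cons show ?thesis by simp
    qed
  qed simp
next
  case (Suc n)
  show ?case
  proof (cases "length l = Suc (Suc n)")
    case True
    then obtain r y where l: "l = r @ [y]" "length r = Suc n" by (metis length_Suc_conv_rev)
    have *: "traj Z (Suc n) w = l \<longleftrightarrow> traj Z n w = r \<and> Z (Suc n) w = y" for Z :: "nat \<Rightarrow> 'z \<Rightarrow> int" and w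
      unfolding l by (simp del: upt_Suc add: upt_Suc_append) 
    show ?thesis unfolding * using assms l(2) Suc[of r] unfolding erw_path_law_def by simp
  next
    case False
    have neq: "traj Z (Suc n) w \<noteq> l" for Z :: "nat \<Rightarrow> 'z \<Rightarrow> int" and w
    proof
      assume "traj Z (Suc n) w = l"
      then have "length l = length (traj Z (Suc n) w)" by simp
      with False show False by simp
    qed
    show ?thesis by (simp only: neq) simp
  qed
qed

text \<open>A cylinder over finitely many times is an event of one finite trajectory, and the laws
  of finite trajectories agree by \<open>path_prob_unique\<close>.\<close>

lemma path_law_unique:
  assumes M: "prob_space M" "erw_path_law M p X" and M': "prob_space M'" "erw_path_law M' p X'"
  shows "distr M (PiM UNIV (\<lambda>_::nat. count_space UNIV)) (\<lambda>w n. X n w) =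
    distr M' (PiM UNIV (\<lambda>_::nat. count_space UNIV)) (\<lambda>w n. X' n w)"
    (is "distr M ?P ?X = distr M' ?P ?X'")
proof -
  interpret M: prob_space M by fact
  interpret M': prob_space M' by fact
  have mX: "X n \<in> measurable M (count_space UNIV)" and mX': "X' n \<in> measurable M' (count_space UNIV)" for n
    using assms by (auto simp: erw_path_law_def)
  have m: "?X \<in> measurable M ?P" "?X' \<in> measurable M' ?P"
    by (rule measurable_PiM_single'; simp add: mX mX')+
  have mp: "traj X n \<in> measurable M (count_space UNIV)" "traj X' n \<in> measurable M' (count_space UNIV)" for n
    by (intro measurable_path mX mX')+
  have law: "distr M (count_space UNIV) (traj X n) = distr M' (count_space UNIV) (traj X' n)" for n
  proof (rule measure_eqI_countable[where A = UNIV])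
    fix l
    have "emeasure (distr M (count_space UNIV) (traj X n)) {l} = ennreal (measure M {w \<in> space M. traj X n w = l})"
      using mp(1)[of n] by (subst emeasure_distr) (auto simp: M.emeasure_eq_measure vimage_def Int_def conj_commute)
    moreover have "emeasure (distr M' (count_space UNIV) (traj X' n)) {l} = ennreal (measure M' {w \<in> space M'. traj X' n w = l})"
      using mp(2)[of n] by (subst emeasure_distr) (auto simp: M'.emeasure_eq_measure vimage_def Int_def conj_commute)
    ultimately show "emeasure (distr M (count_space UNIV) (traj X n)) {l} = emeasure (distr M' (count_space UNIV) (traj X' n)) {l}"
      by (simp only: path_prob_unique[OF M(2) M'(2)])
  qed auto
  show ?thesis
  proof (rule measure_eqI_PiM_infinite)
    show "finite_measure (distr M ?P ?X)"
      using M.prob_space_distr[OF m(1)] by (simp add: prob_space.finite_measure)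
    fix A :: "nat \<Rightarrow> int set" and J :: "nat set" assume J: "finite J"
    obtain n where n: "\<And>j. j \<in> J \<Longrightarrow> j < n" using J finite_nat_set_iff_bounded by auto
    define B where "B = {l :: int list. \<forall>j\<in>J. l ! j \<in> A j}"
    let ?E = "prod_emb UNIV (\<lambda>_. count_space UNIV) J (Pi\<^sub>E J A)"
    have E: "?E \<in> sets ?P" using J by (intro sets_PiM_I) auto
    have inE: "(\<lambda>n. Z n w) \<in> ?E \<longleftrightarrow> traj Z n w \<in> B" for Z :: "nat \<Rightarrow> 'z \<Rightarrow> int" and w
    proof -
      have "traj Z n w ! j = Z j w" if "j \<in> J" for j using n[OF that] by (simp del: upt_Suc)
      then show ?thesis by (auto simp: B_def prod_emb_def restrict_PiE_iff simp del: upt_Suc)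
    qed
    have 1: "emeasure (distr M ?P ?X) ?E = emeasure (distr M (count_space UNIV) (traj X n)) B"
      using m(1) mp(1)[of n] E by (simp only: emeasure_distr sets_count_space Pow_UNIV UNIV_I) (intro arg_cong[where f = "emeasure M"] set_eqI, simp only: vimage_eq Int_iff inE)
    have 2: "emeasure (distr M' ?P ?X') ?E = emeasure (distr M' (count_space UNIV) (traj X' n)) B"
      using m(2) mp(2)[of n] E by (simp only: emeasure_distr sets_count_space Pow_UNIV UNIV_I) (intro arg_cong[where f = "emeasure M'"] set_eqI, simp only: vimage_eq Int_iff inE)
    show "emeasure (distr M ?P ?X) ?E = emeasure (distr M' ?P ?X') ?E"
      unfolding 1 2 law ..
  qed auto
qed

text \<open>The event that the trajectory equals \<open>l\<close> lies in the history, and on it the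
  visit count is the constant \<open>last_visits l\<close>; the conditional expectation is
  integrated over this event.\<close>

lemma (in excited_random_walk) history_step:
  assumes E: "E \<in> sets M" and c: "AE w in M. real_cond_exp M (history M X n) (indicator E) w = g (visits X n w)"
  shows "measure M ({w \<in> space M. traj X n w = l} \<inter> E) = measure M {w \<in> space M. traj X n w = l} * g (last_visits l)"
proof -
  let ?H = "history M X n"
  let ?A = "{w \<in> space M. traj X n w = l}"
  have gen: "{X j -` A \<inter> space M | j A. j \<le> n} \<subseteq> Pow (space M)" by auto
  have mX: "X j \<in> measurable M (count_space UNIV)" for j by (rule random_variable_X)
  have setsH: "sets ?H = sigma_sets (space M) {X j -` A \<inter> space M | j A. j \<le> n}"
    unfolding history_def using gen by (rule sets_measure_of)
  have spH: "space ?H = space M" unfolding history_def using gen by (rule space_measure_of)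
  have sub: "subalgebra M ?H"
  proof (unfold subalgebra_def, intro conjI)
    show "sets ?H \<subseteq> sets M"
      unfolding setsH using mX by (intro sets.sigma_sets_subset) (auto intro: measurable_sets)
  qed (rule spH)
  interpret H: finite_measure_subalgebra M ?H by unfold_locales (rule sub)
  have XH: "X j \<in> measurable ?H (count_space UNIV)" if "j \<le> n" for j
  proof (rule measurableI)
    fix A assume "A \<in> sets (count_space (UNIV :: int set))"
    show "X j -` A \<inter> space ?H \<in> sets ?H"
      unfolding spH setsH using that by (intro sigma_sets.Basic) blast
  qed simp
  have A: "?A \<in> sets ?H"
  proof (cases "length l = Suc n")
    case True
    have "?A = {w \<in> space ?H. \<forall>j\<in>{..n}. X j w = l ! j}"
      unfolding spH using True by (auto simp: list_eq_iff_nth_eq nth_append less_Suc_eq_le simp del: upt_Suc)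
    also have "\<dots> \<in> sets ?H"
    proof (rule sets.sets_Collect_finite_All')
      fix j assume "j \<in> {..n}"
      then have "X j -` {l ! j} \<inter> space ?H \<in> sets ?H" using XH[of j] by (intro measurable_sets) auto
      then show "{w \<in> space ?H. X j w = l ! j} \<in> sets ?H" by (simp add: vimage_def Int_def conj_commute)
    qed auto
    finally show ?thesis .
  next
    case False
    have "traj X n w \<noteq> l" for w
    proof
      assume "traj X n w = l"
      then have "length l = length (traj X n w)" by simp
      with False show False by simp
    qed
    then have "?A = {}" by blast
    then show ?thesis by (simp only: sets.empty_sets)
  qed
  have AM: "?A \<in> sets M" using A sub by (auto simp: subalgebra_def)
  have vis: "visits X n w = last_visits l" if "traj X n w = l" for w
  proof -
    have "last l = X n w" "length l = Suc n" using that by auto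
    moreover have "l ! j = X j w" if "j < Suc n" for j
      unfolding \<open>traj X n w = l\<close>[symmetric] using that by (simp del: upt_Suc)
    ultimately have "{j. j < length l \<and> l ! j = last l} = {j \<in> {0..n}. X j w = X n w}" by auto
    then show ?thesis by (simp add: visits_def last_visits_def)
  qed
  have "measure M (?A \<inter> E) = (\<integral>w\<in>?A. indicator E w \<partial>M)"
    using AM E by (simp add: set_lebesgue_integral_def indicator_inter_arith[symmetric])
  also have "\<dots> = (\<integral>w\<in>?A. real_cond_exp M ?H (indicator E) w \<partial>M)"
    using E A by (intro H.real_cond_exp_intA) (auto simp: emeasure_eq_measure)
  also have "\<dots> = (\<integral>w. indicator ?A w * g (last_visits l) \<partial>M)"
    unfolding set_lebesgue_integral_def
  proof (rule integral_cong_AE)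
    show "(\<lambda>w. indicator ?A w *\<^sub>R real_cond_exp M ?H (indicator E) w) \<in> borel_measurable M"
      using AM by measurable
    show "(\<lambda>w. indicator ?A w * g (last_visits l)) \<in> borel_measurable M"
      using AM by measurable
    show "AE w in M. indicator ?A w *\<^sub>R real_cond_exp M ?H (indicator E) w = indicator ?A w * g (last_visits l)"
      using c by eventually_elim (use vis in \<open>auto simp: indicator_def simp del: upt_Suc\<close>)
  qed
  also have "\<dots> = measure M ?A * g (last_visits l)" using AM by simp
  finally show ?thesis .
qed

lemma (in excited_random_walk) erw_path_law: "erw_path_law M p X"
  unfolding erw_path_law_def
proof (intro conjI allI impI)
  have mX[measurable]: "X j \<in> measurable M (count_space UNIV)" for j by (rule random_variable_X)
  then show "X n \<in> measurable M (count_space UNIV)" for n .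
  show "measure M {w \<in> space M. X 0 w = y} = (if y = 0 then 1 else 0)" for y
  proof -
    have "{w \<in> space M. X 0 w = y} \<in> sets M" by measurable
    moreover have "AE w in M. w \<in> {w \<in> space M. X 0 w = y} \<longleftrightarrow> w \<in> (if y = 0 then space M else {})"
      using start AE_space by eventually_elim auto
    ultimately have "measure M {w \<in> space M. X 0 w = y} = measure M (if y = 0 then space M else {})"
      by (intro measure_eq_AE) auto
    then show ?thesis using prob_space by (simp split: if_splits)
  qed
  fix n and l :: "int list" and y :: int assume len: "length l = Suc n"
  let ?A = "{w \<in> space M. traj X n w = l}"
  let ?R = "{w \<in> space M. X (Suc n) w = X n w + 1}" and ?L = "{w \<in> space M. X (Suc n) w = X n w - 1}"
  have RL: "?R \<in> sets M" "?L \<in> sets M" by measurable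
  have [measurable]: "traj X n \<in> measurable M (count_space UNIV)" by (rule measurable_path[OF mX])
  have A: "?A \<in> sets M" by measurable
  have pR: "measure M (?A \<inter> ?R) = measure M ?A * p (last_visits l)"
    by (rule history_step[OF RL(1) step_right])
  have pL: "measure M (?A \<inter> ?L) = measure M ?A * (1 - p (last_visits l))"
    by (rule history_step[OF RL(2) step_left])
  have lastA: "last (traj X n w) = X n w" for w by simp
  let ?Y = "{w \<in> space M. traj X n w = l \<and> X (Suc n) w = y}"
  have Y: "?Y \<in> sets M" by measurable
  show "measure M ?Y = measure M ?A * step_prob p l y"
  proof (cases "y = last l + 1 \<or> y = last l - 1")
    case True
    then show ?thesis
    proof
      assume y: "y = last l + 1"
      have "?Y = ?A \<inter> ?R" using y by (auto simp: lastA simp del: upt_Suc)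
      then show ?thesis using pR y by (simp add: step_prob_def del: upt_Suc)
    next
      assume y: "y = last l - 1"
      have "?Y = ?A \<inter> ?L" using y by (auto simp: lastA simp del: upt_Suc)
      then show ?thesis using pL y by (simp add: step_prob_def del: upt_Suc)
    qed
  next
    case False
    \<comment> \<open>The two admissible steps already carry the full probability of
      \<open>?A\<close>, so any other position gets 0.\<close>
    have "measure M ?Y + (measure M (?A \<inter> ?R) + measure M (?A \<inter> ?L)) = measure M (?Y \<union> (?A \<inter> ?R \<union> ?A \<inter> ?L))"
    proof -
      have "measure M (?A \<inter> ?R \<union> ?A \<inter> ?L) = measure M (?A \<inter> ?R) + measure M (?A \<inter> ?L)"
        using A RL by (intro finite_measure_Union) auto
      moreover have "measure M (?Y \<union> (?A \<inter> ?R \<union> ?A \<inter> ?L)) = measure M ?Y + measure M (?A \<inter> ?R \<union> ?A \<inter> ?L)"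
        using A RL Y False by (intro finite_measure_Union) (auto simp: lastA simp del: upt_Suc)
      ultimately show ?thesis by linarith
    qed
    also have "\<dots> \<le> measure M ?A" using A by (intro finite_measure_mono) auto
    finally have "measure M ?Y \<le> 0" unfolding pR pL by (simp add: algebra_simps)
    then have "measure M ?Y = 0" by (simp add: measure_le_0_iff)
    then show ?thesis using False by (simp add: step_prob_def)
  qed
qed

lemma measurable_walk:
  fixes a :: "'b \<Rightarrow> int \<Rightarrow> nat \<Rightarrow> bool"
  assumes [measurable]: "\<And>x i. Measurable.pred M (\<lambda>w. a w x i)"
  shows "(\<lambda>w. pos (a w) n) \<in> measurable M (count_space UNIV) \<and>
    (\<forall>x. (\<lambda>w. used (a w) n x) \<in> measurable M (count_space UNIV))"
proof (induction n)
  case (Suc n)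
  then have P [measurable]: "(\<lambda>w. pos (a w) n) \<in> measurable M (count_space UNIV)"
    and U [measurable]: "(\<lambda>w. used (a w) n x) \<in> measurable M (count_space UNIV)" for x by auto
  have a: "(\<lambda>w. if a w y k then y + 1 else y - 1) \<in> measurable M (count_space UNIV)" for y k
    by measurable
  have b: "(\<lambda>w. if a w y (used (a w) n y) then y + 1 else y - 1) \<in> measurable M (count_space UNIV)" for y
    using measurable_compose_countable[where f = "\<lambda>k w. if a w y k then y + 1 else y - 1"
      and g = "\<lambda>w. used (a w) n y", OF a U] .
  have "(\<lambda>w. pos (a w) (Suc n)) \<in> measurable M (count_space UNIV)"
    unfolding pos_Suc
    using measurable_compose_countable[where f = "\<lambda>y w. if a w y (used (a w) n y) then y + 1 else y - 1"
      and g = "\<lambda>w. pos (a w) n", OF b P] .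
  moreover have "(\<lambda>w. used (a w) (Suc n) x) \<in> measurable M (count_space UNIV)" for x
  proof -
    have "used (a w) (Suc n) x = (if pos (a w) n = x then Suc (used (a w) n x) else used (a w) n x)" for w
      by (simp add: used_Suc)
    then show ?thesis by simp
  qed
  ultimately show ?case by blast
qed simp

section \<open>The coin-driven walk as an excited random walk\<close>

context coins
begin

lemma prob_coin_Omega: "measure Omega {w. w z = b} = (if b then q (snd z) else 1 - q (snd z))"
proof -
  have "measure Omega {w. w z = b} = measure (distr Omega (coin_law z) (\<lambda>w. w z)) {b}"
    by (subst measure_distr) (auto simp: vimage_def)
  also have "distr Omega (coin_law z) (\<lambda>w. w z) = coin_law z"
    unfolding Omega_def by (intro distr_PiM_component) (auto intro: prob_space_measure_pmf)
  also have "measure (coin_law z) {b} = (if b then q (snd z) else 1 - q (snd z))"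
    by (simp add: measure_pmf_single q_bounds)
  finally show ?thesis .
qed

lemma measurable_pos [measurable]: "(\<lambda>w. pos (curry w) n) \<in> measurable Omega (count_space UNIV)"
  by (rule conjunct1[OF measurable_walk]) (simp add: measurable_coin_Omega)

text \<open>The coin read at time \<open>j\<close> along the path \<open>l\<close>. Every visit to a site uses a new coin, which
  makes the steps independent.\<close>

definition path_coin :: "int list \<Rightarrow> nat \<Rightarrow> int \<times> nat" where
  "path_coin l j = (l ! j, card {i. i < j \<and> l ! i = l ! j})"

lemma path_coin_neq: "j < n \<Longrightarrow> path_coin l j \<noteq> path_coin l n"
proof
  assume j: "j < n" and eq: "path_coin l j = path_coin l n"
  then have "{i. i < j \<and> l ! i = l ! j} \<subset> {i. i < n \<and> l ! i = l ! n}"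
    by (auto simp: path_coin_def)
  then have "card {i. i < j \<and> l ! i = l ! j} < card {i. i < n \<and> l ! i = l ! n}"
    by (intro psubset_card_mono) auto
  with eq show False by (simp add: path_coin_def)
qed

text \<open>For a fixed path the coins read along it are known in advance, so following the path is
  a condition on these coins alone.\<close>

lemma pos_eq_iff:
  "(\<forall>i\<le>n. pos (curry w) i = l ! i) \<longleftrightarrow>
    l ! 0 = 0 \<and> (\<forall>j<n. l ! Suc j = (if w (path_coin l j) then l ! j + 1 else l ! j - 1))"
proof (induction n)
  case (Suc n)
  let ?A = "\<forall>i\<le>n. pos (curry w) i = l ! i"
  let ?r = "if w (path_coin l n) then l ! n + 1 else l ! n - 1"
  have key: "pos (curry w) (Suc n) = ?r" if *: ?A
  proof -
    have "{j. j < n \<and> pos (curry w) j = l ! n} = {i. i < n \<and> l ! i = l ! n}" using * by auto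
    then have "used (curry w) n (l ! n) = snd (path_coin l n)" by (simp add: used_eq_card path_coin_def)
    then show ?thesis using * by (simp add: pos_Suc path_coin_def)
  qed
  have "(\<forall>i\<le>Suc n. pos (curry w) i = l ! i) \<longleftrightarrow> ?A \<and> pos (curry w) (Suc n) = l ! Suc n"
    by (auto simp: le_Suc_eq)
  also have "\<dots> \<longleftrightarrow> ?A \<and> l ! Suc n = ?r"
  proof (rule conj_cong[OF refl])
    assume ?A
    show "pos (curry w) (Suc n) = l ! Suc n \<longleftrightarrow> l ! Suc n = ?r"
      unfolding key[OF \<open>?A\<close>] by (rule eq_commute)
  qed
  finally show ?case unfolding Suc All_less_Suc by (simp only: conj_ac)
qed auto

text \<open>The trajectory up to time \<open>n\<close> is decided by coins other than the next one,
  hence is independent of it. The shift in \<open>q (i - 1)\<close> translates cookies counted from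
  1 into coins counted from 0.\<close>

lemma erw_path_law_pos: "erw_path_law Omega (\<lambda>i. q (i - 1)) (\<lambda>n w. pos (curry w) n)"
  unfolding erw_path_law_def
proof (intro conjI allI impI)
  show "(\<lambda>w. pos (curry w) n) \<in> measurable Omega (count_space UNIV)" for n by (rule measurable_pos)
  show "measure Omega {w \<in> space Omega. pos (curry w) 0 = y} = (if y = 0 then 1 else 0)" for y
    using Omega.prob_space by auto
  fix n and l :: "int list" and y :: int assume len: "length l = Suc n"
  let ?W = "\<lambda>n w. pos (curry w) n"
  let ?z = "path_coin l n" and ?C = "path_coin l ` {..<n}"
  let ?A = "{w \<in> space Omega. traj ?W n w = l}"
  have lastl: "last l = l ! n" using len by (metis diff_Suc_1 last_conv_nth length_0_conv nat.distinct(1))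
  have trajA: "traj ?W n w = l \<longleftrightarrow> (\<forall>i\<le>n. ?W i w = l ! i)" for w
    using len by (auto simp: list_eq_iff_nth_eq less_Suc_eq_le simp del: upt_Suc)
  have Aeq: "?A = {w. l ! 0 = 0 \<and> (\<forall>j\<in>{..<n}. l ! Suc j = (if w (path_coin l j) then l ! j + 1 else l ! j - 1))}"
    unfolding trajA pos_eq_iff by auto
  have next_pos: "?W (Suc n) w = (if w ?z then last l + 1 else last l - 1)" if "traj ?W n w = l" for w
  proof -
    \<comment> \<open>The path is prolonged by the actual next position so that
      \<open>pos_eq_iff\<close> applies one step further; this leaves the coin at time
      \<open>n\<close> unchanged.\<close>
    have "\<forall>i\<le>n. ?W i w = (l @ [?W (Suc n) w]) ! i" "?W (Suc n) w = (l @ [?W (Suc n) w]) ! Suc n"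
      using that len unfolding trajA by (auto simp: nth_append)
    then have "\<forall>i\<le>Suc n. ?W i w = (l @ [?W (Suc n) w]) ! i" by (auto simp: le_Suc_eq)
    then have "(l @ [?W (Suc n) w]) ! Suc n = (if w (path_coin (l @ [?W (Suc n) w]) n)
        then (l @ [?W (Suc n) w]) ! n + 1 else (l @ [?W (Suc n) w]) ! n - 1)"
      unfolding pos_eq_iff by blast
    moreover have "path_coin (l @ [?W (Suc n) w]) n = ?z"
      using len by (auto simp: path_coin_def nth_append intro!: arg_cong[where f = card])
    moreover have "(l @ [v]) ! n = l ! n" "(l @ [v]) ! Suc n = v" for v
      using len by (simp_all add: nth_append)
    ultimately show ?thesis by (simp only: lastl)
  qed
  have zC: "?z \<notin> ?C" by (metis imageE lessThan_iff path_coin_neq)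
  have visl: "last_visits l = Suc (snd ?z)"
  proof -
    have "{j. j < length l \<and> l ! j = last l} = insert n {i. i < n \<and> l ! i = l ! n}"
      using len lastl by (auto simp: less_Suc_eq)
    then show ?thesis by (simp add: last_visits_def path_coin_def)
  qed
  have indep: "measure Omega (?A \<inter> {w. w ?z = b}) = measure Omega ?A * (if b then q (snd ?z) else 1 - q (snd ?z))" for b
  proof -
    let ?S = "{f \<in> space (PiM ?C coin_law). l ! 0 = 0 \<and> (\<forall>j\<in>{..<n}. l ! Suc j = (if f (path_coin l j) then l ! j + 1 else l ! j - 1))}"
    let ?T = "{f \<in> space (PiM {?z} coin_law). f ?z = b}"
    have ind: "Omega.indep_var (PiM ?C coin_law) (\<lambda>w. restrict w ?C) (PiM {?z} coin_law) (\<lambda>w. restrict w {?z})"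
      by (rule Omega.indep_var_restrict[OF indep_coins_Omega]) (use zC in auto)
    have mS: "Measurable.pred (PiM ?C coin_law) (\<lambda>f. f (path_coin l j))" if "j < n" for j
    proof -
      have "(\<lambda>f. f (path_coin l j)) \<in> measurable (PiM ?C coin_law) (coin_law (path_coin l j))"
        using that by (intro measurable_component_singleton) auto
      then show ?thesis by simp
    qed
    have "?S \<in> sets (PiM ?C coin_law)"
    proof (intro sets.sets_Collect_conj sets.sets_Collect_const sets.sets_Collect_finite_All)
      fix j assume "j \<in> {..<n}"
      then have [measurable]: "Measurable.pred (PiM ?C coin_law) (\<lambda>f. f (path_coin l j))" by (intro mS) simp
      show "{f \<in> space (PiM ?C coin_law). l ! Suc j = (if f (path_coin l j) then l ! j + 1 else l ! j - 1)} \<in> sets (PiM ?C coin_law)"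
        by measurable
    qed auto
    moreover have "?T \<in> sets (PiM {?z} coin_law)"
    proof -
      have "(\<lambda>f. f ?z) \<in> measurable (PiM {?z} coin_law) (coin_law ?z)"
        by (intro measurable_component_singleton) auto
      then have [measurable]: "Measurable.pred (PiM {?z} coin_law) (\<lambda>f. f ?z)" by simp
      show ?thesis by measurable
    qed
    ultimately have "measure Omega ((\<lambda>w. (restrict w ?C, restrict w {?z})) -` (?S \<times> ?T) \<inter> space Omega) =
        measure Omega ((\<lambda>w. restrict w ?C) -` ?S \<inter> space Omega) * measure Omega ((\<lambda>w. restrict w {?z}) -` ?T \<inter> space Omega)"
      by (rule Omega.indep_varD[OF ind])
    moreover have S: "(\<lambda>w. restrict w ?C) -` ?S \<inter> space Omega = ?A"
      unfolding Aeq by (auto simp: space_PiM)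
    moreover have T: "(\<lambda>w. restrict w {?z}) -` ?T \<inter> space Omega = {w. w ?z = b}"
      by (auto simp: space_PiM)
    moreover have "(\<lambda>w. (restrict w ?C, restrict w {?z})) -` (?S \<times> ?T) \<inter> space Omega =
        ((\<lambda>w. restrict w ?C) -` ?S \<inter> space Omega) \<inter> ((\<lambda>w. restrict w {?z}) -` ?T \<inter> space Omega)"
      by blast
    ultimately show ?thesis by (simp only: prob_coin_Omega)
  qed
  have Y: "{w \<in> space Omega. traj ?W n w = l \<and> ?W (Suc n) w = y} =
    (if y = last l + 1 then ?A \<inter> {w. w ?z = True} else if y = last l - 1 then ?A \<inter> {w. w ?z = False} else {})"
    using next_pos by (auto simp del: upt_Suc split: if_splits)
  show "measure Omega {w \<in> space Omega. traj ?W n w = l \<and> ?W (Suc n) w = y}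
        = measure Omega ?A * step_prob (\<lambda>i. q (i - 1)) l y"
    unfolding Y by (simp only: if_distrib[of "measure Omega"] indep step_prob_def visl) simp
qed

end

section \<open>Recurrence and transience\<close>

lemma last_visits_pos: "l \<noteq> [] \<Longrightarrow> 1 \<le> last_visits l"
proof -
  assume "l \<noteq> []"
  then have "length l - 1 \<in> {j. j < length l \<and> l ! j = last l}" by (simp add: last_conv_nth)
  then have "{j. j < length l \<and> l ! j = last l} \<noteq> {}" by blast
  then show ?thesis by (simp add: last_visits_def Suc_le_eq card_gt_0_iff)
qed

lemma erw_path_law_cong:
  assumes "erw_path_law M p X" and eq: "\<And>i. 1 \<le> i \<Longrightarrow> p i = p' i"
  shows "erw_path_law M p' X"
proof -
  have "step_prob p l y = step_prob p' l y" if "length l = Suc n" for l y n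
  proof -
    have "1 \<le> last_visits l" using that by (intro last_visits_pos) auto
    then show ?thesis by (simp add: step_prob_def eq)
  qed
  with assms(1) show ?thesis unfolding erw_path_law_def by simp
qed

lemma measurable_limit_events:
  assumes [measurable]: "\<And>n. (\<lambda>w. X w n :: int) \<in> measurable M (count_space UNIV)"
  shows "Measurable.pred M (\<lambda>w. filterlim (X w) at_top sequentially)"
    "Measurable.pred M (\<lambda>w. filterlim (X w) at_bot sequentially)"
    "Measurable.pred M (\<lambda>w. infinite {n. X w n = 0})"
    "Measurable.pred M (\<lambda>w. \<forall>Z. \<exists>n. Z \<le> X w n)"
  unfolding filterlim_at_top filterlim_at_bot eventually_sequentially infinite_nat_iff_unbounded_le mem_Collect_eq
  by measurable

text \<open>Convergence of the series forces the cookies towards 1/2; the finitely many early ones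
  lie in (0,1), so the minimum over all distances to 0 and 1 stays positive. The bound
  \<open>B\<close> is that of a convergent sequence.\<close>

lemma coins_from_cookies:
  assumes p: "\<And>j. j \<ge> 1 \<Longrightarrow> 0 < p j \<and> p j < 1"
    and delta: "(\<lambda>k. \<Sum>j=1..k. (2 * p j - 1)) \<longlonglongrightarrow> \<delta>"
  defines "q \<equiv> \<lambda>i. p (Suc i)"
  shows "\<exists>\<epsilon> B. coins_bdd q \<epsilon> B" "coins.drift q = (\<lambda>k. \<Sum>j=1..k. (2 * p j - 1))"
proof -
  let ?D = "\<lambda>k. \<Sum>j=1..k. (2 * p j - 1)"
  have "(\<lambda>k. ?D (Suc k) - ?D k) \<longlonglongrightarrow> \<delta> - \<delta>"
    by (intro tendsto_diff LIMSEQ_Suc delta)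
  then have "(\<lambda>k. 2 * q k - 1) \<longlonglongrightarrow> 0" by (simp add: q_def)
  then have "(\<lambda>k. (2 * q k - 1 + 1) / 2) \<longlonglongrightarrow> (0 + 1) / 2" by (intro tendsto_intros) auto
  then have q: "q \<longlonglongrightarrow> 1 / 2" by simp
  have "\<forall>\<^sub>F k in sequentially. 1 / 4 < q k \<and> q k < 3 / 4"
    using order_tendstoD(1)[OF q, of "1 / 4"] order_tendstoD(2)[OF q, of "3 / 4"] by (simp add: eventually_conj_iff)
  then obtain n where n: "\<And>k. n \<le> k \<Longrightarrow> 1 / 4 < q k \<and> q k < 3 / 4" unfolding eventually_sequentially by blast
  define \<epsilon> where "\<epsilon> = Min (insert (1 / 4) ((\<lambda>k. min (q k) (1 - q k)) ` {..<n}))"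
  have fin: "finite (insert (1 / 4) ((\<lambda>k. min (q k) (1 - q k)) ` {..<n}))" by simp
  have \<epsilon>0: "0 < \<epsilon>" unfolding \<epsilon>_def using p by (subst Min_gr_iff[OF fin]) (auto simp: q_def)
  have \<epsilon>: "\<epsilon> \<le> q k \<and> q k \<le> 1 - \<epsilon>" for k
  proof (cases "k < n")
    case True
    then have "\<epsilon> \<le> min (q k) (1 - q k)" unfolding \<epsilon>_def by (intro Min_le[OF fin]) auto
    then show ?thesis by auto
  next
    case False
    have "\<epsilon> \<le> 1 / 4" unfolding \<epsilon>_def by (intro Min_le[OF fin]) auto
    then show ?thesis using n[of k] False by auto
  qed
  have c: "coins q \<epsilon>" using \<epsilon>0 \<epsilon> by unfold_locales auto
  then interpret coins q \<epsilon> .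
  show d: "drift = ?D"
  proof
    fix k show "drift k = ?D k" unfolding drift_def by (induction k) (simp_all add: q_def)
  qed
  have "Bseq drift" unfolding d using delta by (intro convergent_imp_Bseq convergentI)
  then obtain B where "\<forall>t. norm (drift t) \<le> B" unfolding Bseq_def by blast
  then have "coins_bdd q \<epsilon> B" by unfold_locales auto
  then show "\<exists>\<epsilon> B. coins_bdd q \<epsilon> B" by blast
qed

text \<open>The given walk and the coin-driven one have the same law on path space, where
  \<open>P\<close> is an event.\<close>

lemma (in coins) AE_transfer:
  assumes walk: "excited_random_walk M p X" and q: "\<And>i. q i = p (Suc i)"
    and P: "Measurable.pred (PiM UNIV (\<lambda>_::nat. count_space (UNIV :: int set))) P"
    and AE: "AE w in Omega. P (pos (curry w))"
  shows "AE w in M. P (\<lambda>n. X n w)"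
proof -
  let ?P = "PiM UNIV (\<lambda>_::nat. count_space (UNIV :: int set))"
  interpret excited_random_walk M p X by fact
  have law: "erw_path_law Omega p (\<lambda>n w. pos (curry w) n)"
    by (rule erw_path_law_cong[OF erw_path_law_pos]) (simp add: q)
  have eq: "distr M ?P (\<lambda>w n. X n w) = distr Omega ?P (\<lambda>w n. pos (curry w) n)"
    by (rule path_law_unique[OF prob_space_axioms erw_path_law Omega.prob_space_axioms law])
  have m: "(\<lambda>w n. X n w) \<in> measurable M ?P" "(\<lambda>w n. pos (curry w) n) \<in> measurable Omega ?P"
    by (rule measurable_PiM_single'; simp add: random_variable_X measurable_pos)+
  have S: "{x \<in> space ?P. P x} \<in> sets ?P" using P by (simp add: pred_def)
  have "AE x in distr Omega ?P (\<lambda>w n. pos (curry w) n). P x"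
    using AE by (subst AE_distr_iff[OF m(2) S])
  then have "AE x in distr M ?P (\<lambda>w n. X n w). P x" unfolding eq .
  then show ?thesis by (subst (asm) AE_distr_iff[OF m(1) S])
qed

lemma measurable_coordinate:
  "(\<lambda>x. x n) \<in> measurable (PiM UNIV (\<lambda>_::nat. count_space (UNIV :: int set))) (count_space UNIV)"
  by measurable

text \<open>Reflection preserves visit counts and histories and swaps the two step
  conditions.\<close>

lemma excited_random_walk_uminus:
  assumes "excited_random_walk M p X"
  shows "excited_random_walk M (\<lambda>j. 1 - p j) (\<lambda>n w. - X n w)"
proof -
  interpret excited_random_walk M p X by fact
  have vis: "visits (\<lambda>n w. - X n w) n = visits X n" for n by (auto simp: visits_def)
  have "{(\<lambda>w. - X j w) -` A \<inter> space M | j A. j \<le> n} = {X j -` A \<inter> space M | j A. j \<le> n}" for n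
  proof (intro equalityI subsetI)
    fix S assume "S \<in> {(\<lambda>w. - X j w) -` A \<inter> space M | j A. j \<le> n}"
    then obtain j A where "S = (\<lambda>w. - X j w) -` A \<inter> space M" "j \<le> n" by blast
    moreover from this have "S = X j -` (uminus -` A) \<inter> space M" by auto
    ultimately show "S \<in> {X j -` A \<inter> space M | j A. j \<le> n}" by blast
  next
    fix S assume "S \<in> {X j -` A \<inter> space M | j A. j \<le> n}"
    then obtain j A where "S = X j -` A \<inter> space M" "j \<le> n" by blast
    moreover from this have "S = (\<lambda>w. - X j w) -` (uminus -` A) \<inter> space M" by auto
    ultimately show "S \<in> {(\<lambda>w. - X j w) -` A \<inter> space M | j A. j \<le> n}" by blast
  qed
  then have hist: "history M (\<lambda>n w. - X n w) n = history M X n" for n by (simp add: history_def)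
  show ?thesis
  proof
    show "(\<lambda>w. - X n w) \<in> measurable M (count_space UNIV)" for n
      by (rule measurable_compose[OF random_variable_X]) simp
    show "AE w in M. - X 0 w = 0" using start by eventually_elim simp
    have ev: "{w \<in> space M. - X (Suc n) w = - X n w + 1} = {w \<in> space M. X (Suc n) w = X n w - 1}"
      "{w \<in> space M. - X (Suc n) w = - X n w - 1} = {w \<in> space M. X (Suc n) w = X n w + 1}" for n
      by auto
    show "AE w in M. real_cond_exp M (history M (\<lambda>n w. - X n w) n)
        (indicator {w \<in> space M. - X (Suc n) w = - X n w + 1}) w = 1 - p (visits (\<lambda>n w. - X n w) n w)" for n
      unfolding hist vis ev by (rule step_left)
    show "AE w in M. real_cond_exp M (history M (\<lambda>n w. - X n w) n)
        (indicator {w \<in> space M. - X (Suc n) w = - X n w - 1}) w = 1 - (1 - p (visits (\<lambda>n w. - X n w) n w))" for n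
      unfolding hist vis ev using step_right[of n] by simp
  qed
qed

lemma filterlim_uminus_int:
  fixes W :: "nat \<Rightarrow> int"
  shows "filterlim (\<lambda>n. - W n) at_top sequentially \<longleftrightarrow> filterlim W at_bot sequentially"
    and "filterlim (\<lambda>n. - W n) at_bot sequentially \<longleftrightarrow> filterlim W at_top sequentially"
proof -
  have *: "filterlim (\<lambda>n. - V n) at_top sequentially \<longleftrightarrow> filterlim V at_bot sequentially" for V :: "nat \<Rightarrow> int"
    unfolding filterlim_at_top filterlim_at_bot
  proof (intro iffI allI)
    fix Z assume "\<forall>Z. \<forall>\<^sub>F n in sequentially. Z \<le> - V n"
    then have "\<forall>\<^sub>F n in sequentially. - Z \<le> - V n" by blast
    then show "\<forall>\<^sub>F n in sequentially. V n \<le> Z" by simp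
  next
    fix Z assume "\<forall>Z. \<forall>\<^sub>F n in sequentially. V n \<le> Z"
    then have "\<forall>\<^sub>F n in sequentially. V n \<le> - Z" by blast
    then show "\<forall>\<^sub>F n in sequentially. Z \<le> - V n" by (simp add: le_minus_iff)
  qed
  from *[of W] show "filterlim (\<lambda>n. - W n) at_top sequentially \<longleftrightarrow> filterlim W at_bot sequentially" .
  from *[of "\<lambda>n. - W n"] show "filterlim (\<lambda>n. - W n) at_bot sequentially \<longleftrightarrow> filterlim W at_top sequentially"
    by simp
qed

locale cookie_walk =
  fixes M :: "'a measure" and p :: "nat \<Rightarrow> real" and X :: "nat \<Rightarrow> 'a \<Rightarrow> int" and \<delta> :: real
  assumes p_range: "\<And>j. j \<ge> 1 \<Longrightarrow> 0 < p j \<and> p j < 1"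
    and delta: "(\<lambda>k. \<Sum>j=1..k. (2 * p j - 1)) \<longlonglongrightarrow> \<delta>"
    and walk: "excited_random_walk M p X"
begin

sublocale excited_random_walk M p X by (rule walk)

lemma uminus: "cookie_walk M (\<lambda>j. 1 - p j) (\<lambda>n w. - X n w) (- \<delta>)"
proof (rule cookie_walk.intro)
  show "0 < 1 - p j \<and> 1 - p j < 1" if "1 \<le> j" for j using p_range[OF that] by simp
  have "(\<lambda>k. - (\<Sum>j=1..k. (2 * p j - 1))) \<longlonglongrightarrow> - \<delta>" by (rule tendsto_minus[OF delta])
  moreover have "- (\<Sum>j=1..k. (2 * p j - 1)) = (\<Sum>j=1..k. (2 * (1 - p j) - 1))" for k
    unfolding sum_negf[symmetric] by (rule sum.cong) auto
  ultimately show "(\<lambda>k. \<Sum>j=1..k. (2 * (1 - p j) - 1)) \<longlonglongrightarrow> - \<delta>" by simp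
  show "excited_random_walk M (\<lambda>j. 1 - p j) (\<lambda>n w. - X n w)" by (rule excited_random_walk_uminus[OF walk])
qed

text \<open>The three facts share one interpretation of the coins, whose constants are obtained
  inside the proof. In the second, the alternative to \<open>\<delta> < 1\<close> is the critical
  case, since it forces the partial sums to tend to 1.\<close>

lemma AE_limits:
  shows AE_dichotomies: "AE w in M. (filterlim (\<lambda>n. X n w) at_top sequentially \<or> filterlim (\<lambda>n. X n w) at_bot sequentially
      \<or> infinite {n. X n w = 0}) \<and>
      (\<not> filterlim (\<lambda>n. X n w) at_bot sequentially \<longrightarrow> (\<forall>Z. \<exists>n. Z \<le> X n w))"
    and AE_not_at_top: "\<delta> < 1 \<or> (\<forall>\<eta>>0. \<forall>\<^sub>F t in sequentially. \<bar>(\<Sum>j=1..t. (2 * p j - 1)) - 1\<bar> \<le> \<eta> / ln (real t))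
      \<Longrightarrow> AE w in M. \<not> filterlim (\<lambda>n. X n w) at_top sequentially"
    and AE_at_top_if_unbounded: "1 < \<delta>
      \<Longrightarrow> AE w in M. (\<forall>Z. \<exists>n. Z \<le> X n w) \<longrightarrow> filterlim (\<lambda>n. X n w) at_top sequentially"
proof -
  obtain \<epsilon> B where "coins_bdd (\<lambda>i. p (Suc i)) \<epsilon> B" using coins_from_cookies(1)[OF p_range delta] by blast
  then interpret C: coins_bdd "\<lambda>i. p (Suc i)" \<epsilon> B .
  note [measurable] = measurable_limit_events[where X = "\<lambda>x. x", OF measurable_coordinate]
  have drift: "C.drift = (\<lambda>k. \<Sum>j=1..k. (2 * p j - 1))" by (rule coins_from_cookies(2)[OF p_range delta])
  show "AE w in M. (filterlim (\<lambda>n. X n w) at_top sequentially \<or> filterlim (\<lambda>n. X n w) at_bot sequentially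
      \<or> infinite {n. X n w = 0}) \<and>
      (\<not> filterlim (\<lambda>n. X n w) at_bot sequentially \<longrightarrow> (\<forall>Z. \<exists>n. Z \<le> X n w))"
    by (rule C.AE_transfer[OF walk refl, where P = "\<lambda>x. (filterlim x at_top sequentially \<or>
         filterlim x at_bot sequentially \<or> infinite {n. x n = 0}) \<and>
         (\<not> filterlim x at_bot sequentially \<longrightarrow> (\<forall>Z. \<exists>n. Z \<le> x n))"])
       (measurable, rule C.AE_pos_dichotomies)
  {
    assume *: "\<delta> < 1 \<or> (\<forall>\<eta>>0. \<forall>\<^sub>F t in sequentially. \<bar>(\<Sum>j=1..t. (2 * p j - 1)) - 1\<bar> \<le> \<eta> / ln (real t))"
    have "(\<lambda>k. C.alive k m) \<longlonglongrightarrow> 0" for m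
    proof (cases "\<delta> < 1")
      case True
      then show ?thesis using delta by (intro C.alive_dies_subcritical[of \<delta>]) (simp add: drift)
    next
      case False
      then show ?thesis using * by (intro C.alive_dies_critical) (simp add: drift)
    qed
    then show "AE w in M. \<not> filterlim (\<lambda>n. X n w) at_top sequentially"
      by (intro C.AE_transfer[OF walk refl, where P = "\<lambda>x. \<not> filterlim x at_top sequentially"] C.AE_pos_not_at_top) measurable
  next
    assume "1 < \<delta>"
    then obtain c where c: "0 < c" "\<And>k. c \<le> C.alive k 1"
      using C.alive_survives[of \<delta>] delta by (auto simp: drift)
    show "AE w in M. (\<forall>Z. \<exists>n. Z \<le> X n w) \<longrightarrow> filterlim (\<lambda>n. X n w) at_top sequentially"
      by (rule C.AE_transfer[OF walk refl, where P = "\<lambda>x. (\<forall>Z. \<exists>n. Z \<le> x n) \<longrightarrow> filterlim x at_top sequentially"])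
         (measurable, rule C.AE_pos_at_top[OF c])
  }
qed

text \<open>The reflected walk has parameter \<open>- \<delta> < 1\<close> and so does not tend to
  plus infinity. Hence the walk itself does not tend to minus infinity, is unbounded above, and
  diverges by the surviving chains.\<close>

lemma AE_at_top:
  assumes "1 < \<delta>"
  shows "AE w in M. filterlim (\<lambda>n. X n w) at_top sequentially"
proof -
  interpret U: cookie_walk M "\<lambda>j. 1 - p j" "\<lambda>n w. - X n w" "- \<delta>" by (rule uminus)
  have "AE w in M. \<not> filterlim (\<lambda>n. X n w) at_bot sequentially"
    using U.AE_not_at_top assms by (simp add: filterlim_uminus_int)
  with AE_dichotomies AE_at_top_if_unbounded[OF assms] show ?thesis
    by eventually_elim blast
qed

text \<open>Divergence is excluded in both directions, the downward one by reflection. At most one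
  direction is critical, the other one having parameter below 1.\<close>

lemma AE_recurrent:
  assumes "\<bar>\<delta>\<bar> < 1 \<or> \<bar>\<delta>\<bar> = 1 \<and> (\<forall>\<eta>>0. \<forall>\<^sub>F t in sequentially. \<bar>(\<Sum>j=1..t. (2 * p j - 1)) - \<delta>\<bar> \<le> \<eta> / ln (real t))"
  shows "AE w in M. infinite {n. X n w = 0}"
proof -
  interpret U: cookie_walk M "\<lambda>j. 1 - p j" "\<lambda>n w. - X n w" "- \<delta>" by (rule uminus)
  have neg: "(\<Sum>j=1..t. (2 * (1 - p j) - 1)) = - (\<Sum>j=1..t. (2 * p j - 1))" for t
    unfolding sum_negf[symmetric] by (rule sum.cong) auto
  have "AE w in M. \<not> filterlim (\<lambda>n. X n w) at_top sequentially"
  proof (rule AE_not_at_top)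
    show "\<delta> < 1 \<or> (\<forall>\<eta>>0. \<forall>\<^sub>F t in sequentially. \<bar>(\<Sum>j=1..t. (2 * p j - 1)) - 1\<bar> \<le> \<eta> / ln (real t))"
      using assms by (cases "\<delta> = 1") auto
  qed
  moreover have "AE w in M. \<not> filterlim (\<lambda>n. - X n w) at_top sequentially"
  proof (rule U.AE_not_at_top)
    have "\<bar>- s - 1\<bar> = \<bar>s - (- 1)\<bar>" for s :: real by simp
    then show "- \<delta> < 1 \<or> (\<forall>\<eta>>0. \<forall>\<^sub>F t in sequentially. \<bar>(\<Sum>j=1..t. (2 * (1 - p j) - 1)) - 1\<bar> \<le> \<eta> / ln (real t))"
      unfolding neg using assms by (cases "\<delta> = - 1") auto
  qed
  ultimately show ?thesis using AE_dichotomies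
    by eventually_elim (simp add: filterlim_uminus_int)
qed

text \<open>The tail from \<open>t + 1\<close> on is \<open>\<delta>\<close> minus the
  \<open>t\<close>-th partial sum, and replacing ln (t + 1) by ln t only weakens the bound once
  \<open>t\<close> is at least 2.\<close>

lemma tail_bound:
  assumes o: "(\<lambda>n. \<bar>\<Sum>j. (2 * p (n + j) - 1)\<bar>) \<in> o(\<lambda>n. 1 / ln (real n))" and \<eta>: "0 < \<eta>"
  shows "\<forall>\<^sub>F t in sequentially. \<bar>(\<Sum>j=1..t. (2 * p j - 1)) - \<delta>\<bar> \<le> \<eta> / ln (real t)"
proof -
  have tail: "(\<Sum>j. (2 * p (Suc t + j) - 1)) = \<delta> - (\<Sum>j=1..t. (2 * p j - 1))" for t
  proof (rule sums_unique[symmetric])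
    have "(\<lambda>n. (\<Sum>j=1..t + n. (2 * p j - 1)) - (\<Sum>j=1..t. (2 * p j - 1))) \<longlonglongrightarrow> \<delta> - (\<Sum>j=1..t. (2 * p j - 1))"
      by (intro tendsto_diff tendsto_const) (use LIMSEQ_ignore_initial_segment[OF delta, of t] in \<open>simp add: add.commute\<close>)
    moreover have "(\<Sum>j=1..t + n. (2 * p j - 1)) - (\<Sum>j=1..t. (2 * p j - 1)) = (\<Sum>j<n. (2 * p (Suc t + j) - 1))" for n
      by (induction n) auto
    ultimately show "(\<lambda>j. 2 * p (Suc t + j) - 1) sums (\<delta> - (\<Sum>j=1..t. (2 * p j - 1)))" by (simp add: sums_def)
  qed
  have "\<forall>\<^sub>F n in sequentially. norm (\<bar>\<Sum>j. (2 * p (n + j) - 1)\<bar>) \<le> \<eta> * norm (1 / ln (real n))"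
    by (rule landau_o.smallD[OF o \<eta>])
  then have "\<forall>\<^sub>F t in sequentially. \<bar>\<Sum>j. (2 * p (Suc t + j) - 1)\<bar> \<le> \<eta> * \<bar>1 / ln (real (Suc t))\<bar>"
    by (subst (asm) eventually_sequentially_Suc[symmetric]) simp
  then show ?thesis using eventually_ge_at_top[of "2::nat"]
  proof eventually_elim
    case (elim t)
    have "ln (real t) \<le> ln (real (Suc t))" using elim by (intro ln_mono) auto
    moreover have "0 < ln (real t)" using elim by simp
    ultimately have l: "ln (real t) \<le> ln (real (Suc t))" "0 < ln (real t)" "0 < ln (real (Suc t))" by linarith+
    have "\<eta> / ln (real (Suc t)) \<le> \<eta> / ln (real t)"
      using \<eta> by (intro divide_left_mono l mult_pos_pos) simp
    then have "\<eta> * \<bar>1 / ln (real (Suc t))\<bar> \<le> \<eta> / ln (real t)" using l(3) by (simp del: of_nat_Suc)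
    with elim(1) show ?case unfolding tail by (simp add: abs_minus_commute)
  qed
qed

end

theorem theorem1p1:
  fixes M :: "'a measure" and p :: "nat \<Rightarrow> real" and X :: "nat \<Rightarrow> 'a \<Rightarrow> int" and \<delta> :: real
  assumes p_range: "\<And>j. j \<ge> 1 \<Longrightarrow> 0 < p j \<and> p j < 1"
    and delta: "(\<lambda>k. \<Sum>j=1..k. (2 * p j - 1)) \<longlonglongrightarrow> \<delta>"
    and walk: "excited_random_walk M p X"
  shows "(\<delta> > 1 \<longrightarrow> \<P>(\<omega> in M. filterlim (\<lambda>n. X n \<omega>) at_top sequentially) = 1) \<and>
         (\<delta> < -1 \<longrightarrow> \<P>(\<omega> in M. filterlim (\<lambda>n. X n \<omega>) at_bot sequentially) = 1) \<and>
         (\<bar>\<delta>\<bar> < 1 \<longrightarrow> \<P>(\<omega> in M. infinite {n. X n \<omega> = 0}) = 1) \<and>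
         (\<bar>\<delta>\<bar> = 1 \<and>
            (\<lambda>n. \<bar>\<Sum>j. (2 * p (n + j) - 1)\<bar>) \<in> o(\<lambda>n. 1 / ln (real n)) \<longrightarrow>
          \<P>(\<omega> in M. infinite {n. X n \<omega> = 0}) = 1)"
proof -
  interpret C: cookie_walk M p X \<delta> using p_range delta walk by (rule cookie_walk.intro)
  interpret U: cookie_walk M "\<lambda>j. 1 - p j" "\<lambda>n \<omega>. - X n \<omega>" "- \<delta>" by (rule C.uminus)
  have prob1: "\<P>(\<omega> in M. P \<omega>) = 1" if "Measurable.pred M P" "AE \<omega> in M. P \<omega>" for P
    using that by (subst C.prob_Collect_eq_1) (auto simp: pred_def)
  note meas = measurable_limit_events[where X = "\<lambda>\<omega> n. X n \<omega>", OF C.random_variable_X]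
  show ?thesis
  proof (intro conjI impI)
    assume "1 < \<delta>"
    then show "\<P>(\<omega> in M. filterlim (\<lambda>n. X n \<omega>) at_top sequentially) = 1"
      by (intro prob1 meas C.AE_at_top)
  next
    assume "\<delta> < -1"
    then have "AE \<omega> in M. filterlim (\<lambda>n. X n \<omega>) at_bot sequentially"
      using U.AE_at_top by (simp add: filterlim_uminus_int)
    then show "\<P>(\<omega> in M. filterlim (\<lambda>n. X n \<omega>) at_bot sequentially) = 1"
      by (intro prob1 meas)
  next
    assume "\<bar>\<delta>\<bar> < 1"
    then show "\<P>(\<omega> in M. infinite {n. X n \<omega> = 0}) = 1"
      by (intro prob1 meas C.AE_recurrent) blast
  next
    assume "\<bar>\<delta>\<bar> = 1 \<and> (\<lambda>n. \<bar>\<Sum>j. (2 * p (n + j) - 1)\<bar>) \<in> o(\<lambda>n. 1 / ln (real n))"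
    then show "\<P>(\<omega> in M. infinite {n. X n \<omega> = 0}) = 1"
      using C.tail_bound by (intro prob1 meas C.AE_recurrent) blast
  qed
qed

end
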